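(* Let $\Lambda\colon V\times V\to\mathbb{C}$ be an even continuous $\mathbb{C}$-bilinear form, let $R\ge\frac12$ and $\hbar\in\mathbb{R}\setminus\{0\}$. Then the following statements are equivalent: (i) The complex conjugation is a $^*$-involution with respect to $\star_{\frac{\mathrm{i}\hbar}{2}\Lambda}$, i.e. for homogeneous $a,b\in\widehat{\mathcal{W}}_R(V,\star_{\frac{\mathrm{i}\hbar}{2}\Lambda})$ one has $\overline{a\star_{\frac{\mathrm{i}\hbar}{2}\Lambda}b}=(-1)^{ab}\,\overline{b}\star_{\frac{\mathrm{i}\hbar}{2}\Lambda}\overline{a}$. (ii) $\overline{\Lambda}_+=-\Lambda_+$ and $\overline{\Lambda}_-=\Lambda_-$. (iii) $\overline{\Lambda}_+=-\Lambda_+$ and $\widehat{\mathcal{W}}_R(V)$ is a Poisson $^*$-algebra in the sense that $\overline{\{a,b\}_\Lambda}=\{\overline{a},\overline{b}\}_\Lambda$ for all $a,b\in\widehat{\mathcal{W}}_R(V)$.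
   Context: $V_{\mathbb{R}}$ is a real $\mathbb{Z}_2$-graded Hausdorff locally convex vector space with continuous projections onto the even and odd parts, and $V=V_{\mathbb{R}}\otimes\mathbb{C}$ is its complexification with the induced grading, the induced locally convex topology, and the complex conjugation $v\otimes z\mapsto v\otimes\overline{z}$. In exponents of $-1$ a homogeneous element denotes its $\mathbb{Z}_2$-parity. Symmetric algebra: $S_n$ acts from the right on $V^{\otimes n}$ by $(v_1\otimes\cdots\otimes v_n)\triangleleft\sigma=\pm\, v_{\sigma(1)}\otimes\cdots\otimes v_{\sigma(n)}$ for homogeneous $v_i$, where $\pm$ is the Koszul sign ($-1$ to the number of pairs $i<j$ with $\sigma(i)>\sigma(j)$ and $v_{\sigma(i)},v_{\sigma(j)}$ both odd). $\mathcal{S}_n(v)=\frac1{n!}\sum_{\sigma} v\triangleleft\sigma$, $\mathrm{S}^n(V)=\operatorname{im}\mathcal{S}_n\subseteq V^{\otimes n}$, $\mathrm{S}^0(V)=\mathbb{C}$, $\mathrm{S}^\bullet(V)=\bigoplus_n \mathrm{S}^n(V)$, with product $\mu(v\otimes w)=vw=\mathcal{S}(v\otimes w)$, $\mathcal{S}=\bigoplus_n\mathcal{S}_n$. The complex conjugation extends antilinearly to $\mathrm{S}^\bullet(V)$ with $\overline{ab}=\overline{a}\,\overline{b}$. $\Lambda$ is even if $\Lambda(v,w)=0$ for homogeneous $v,w$ of different parity. With the graded flip $\tau(v\otimes w)=(-1)^{vw}w\otimes v$ set $\Lambda_\pm=\frac12(\Lambda\pm\Lambda\circ\tau)$; and $\overline{\Lambda}(v,w)=\overline{\Lambda(\overline{v},\overline{w})}$,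 with $\overline{\Lambda}_\pm$ the corresponding parts of $\overline{\Lambda}$. $P_\Lambda\colon \mathrm{S}^\bullet(V)\otimes \mathrm{S}^\bullet(V)\to \mathrm{S}^{\bullet-1}(V)\otimes \mathrm{S}^{\bullet-1}(V)$ is the linear extension of $$P_\Lambda(v_1\cdots v_n\otimes w_1\cdots w_m)=\sum_{k,\ell}(-1)^{v_k(v_{k+1}+\cdots+v_n)+w_\ell(w_1+\cdots+w_{\ell-1})}\Lambda(v_k,w_\ell)\,v_1\cdots\widehat{v_k}\cdots v_n\otimes w_1\cdots\widehat{w_\ell}\cdots w_m$$ (homogeneous vectors; hats denote omission; $P_\Lambda$ vanishes if one factor is in $\mathrm{S}^0(V)$). The star product is $a\star_{z\Lambda}b=\sum_{k\ge0}\frac{z^k}{k!}\mu(P_\Lambda^k(a\otimes b))$ with $z=\frac{\mathrm{i}\hbar}{2}$, and the Poisson bracket is $\{a,b\}_\Lambda=2\mu(P_{\Lambda_-}(a\otimes b))$. Topology: for a continuous seminorm $p$ on $V$ let $p^n$ be the projective tensor seminorm on $V^{\otimes n}$ ($p^0=|\cdot|$) and $p_R(v)=\sum_np^n(v_n)\,n!^R$ for $v=\sum_nv_n$. $\mathcal{W}_R(V)$ is $\mathrm{S}^\bullet(V)$ with the topology of all $p_R$ ($p$ a continuous seminorm on $V$) and $\widehat{\mathcal{W}}_R(V)$ is its completion. For $R\ge\frac12$ the star product, the Poisson bracket and the complex conjugation are continuous and extend to $\widehat{\mathcal{W}}_R(V)$; $\widehat{\mathcal{W}}_R(V,\star_{\frac{\mathrm{i}\hbar}{2}\Lambda})$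 denotes $\widehat{\mathcal{W}}_R(V)$ with the star product. *)

theory Defs
  imports "HOL-Analysis.Analysis" "HOL-Library.Poly_Mapping" "HOL-Combinatorics.Permutations"
begin

section \<open>Complex vector spaces\<close>

class complex_vector = ab_group_add +
  fixes scaleC :: "complex \<Rightarrow> 'a \<Rightarrow> 'a"  (infixr \<open>*\<^sub>C\<close> 75)
  assumes scaleC_add_right: "c *\<^sub>C (x + y) = c *\<^sub>C x + c *\<^sub>C y"
    and scaleC_add_left: "(c + d) *\<^sub>C x = c *\<^sub>C x + d *\<^sub>C x"
    and scaleC_scaleC: "c *\<^sub>C d *\<^sub>C x = (c * d) *\<^sub>C x"
    and scaleC_one: "1 *\<^sub>C x = x"

global_interpretation complex_vector: vector_space "scaleC :: complex \<Rightarrow> 'a \<Rightarrow> 'a::complex_vector"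
  by unfold_locales (simp_all add: scaleC_add_right scaleC_add_left scaleC_scaleC scaleC_one)

abbreviation cspan :: "'a::complex_vector set \<Rightarrow> 'a set"
  where "cspan \<equiv> module.span scaleC"

abbreviation clinear :: "('a::complex_vector \<Rightarrow> 'b::complex_vector) \<Rightarrow> bool"
  where "clinear \<equiv> Vector_Spaces.linear scaleC scaleC"

definition cbilinear :: "('a::complex_vector \<Rightarrow> 'b::complex_vector \<Rightarrow> 'c::complex_vector) \<Rightarrow> bool"
  where "cbilinear f \<longleftrightarrow> (\<forall>x. clinear (f x)) \<and> (\<forall>y. clinear (\<lambda>x. f x y))"

lemma clinearI:
  assumes "\<And>x y. f (x + y) = f x + f y" "\<And>c x. f (c *\<^sub>C x) = c *\<^sub>C f x"
  shows "clinear f"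
  using assms by unfold_locales auto

lemma clinear_add: "clinear f \<Longrightarrow> f (x + y) = f x + f y"
  by (simp add: Vector_Spaces.linear.axioms module_hom.add linear_iff_module_hom)

lemma clinear_scale: "clinear f \<Longrightarrow> f (c *\<^sub>C x) = c *\<^sub>C f x"
  by (simp add: module_hom.scale linear_iff_module_hom)

instantiation complex :: complex_vector
begin
definition scaleC_complex :: "complex \<Rightarrow> complex \<Rightarrow> complex"
  where "scaleC_complex c x = c * x"
instance
  by standard (simp_all add: scaleC_complex_def algebra_simps)
end

instantiation poly_mapping :: (type, complex_vector) complex_vector
begin
lift_definition scaleC_poly_mapping :: "complex \<Rightarrow> ('a \<Rightarrow>\<^sub>0 'b) \<Rightarrow> 'a \<Rightarrow>\<^sub>0 'b"
  is "\<lambda>c f k. c *\<^sub>C f k"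
proof -
  fix c :: complex and f :: "'a \<Rightarrow> 'b"
  assume "finite {k. f k \<noteq> 0}"
  moreover have "{k. c *\<^sub>C f k \<noteq> 0} \<subseteq> {k. f k \<noteq> 0}"
    by (auto simp: complex_vector.scale_zero_right)
  ultimately show "finite {k. c *\<^sub>C f k \<noteq> 0}"
    by (rule rev_finite_subset)
qed
instance
  by standard (transfer, simp add: scaleC_add_right scaleC_add_left scaleC_scaleC scaleC_one)+
end

section \<open>Graded spaces and complexification\<close>

text \<open>
  A \<open>\<int>\<^sub>2\<close>-grading is encoded by the projection onto the even part along the odd part.
\<close>

class graded_ab_group = ab_group_add +
  fixes even_part :: "'a \<Rightarrow> 'a"
  assumes even_part_add: "even_part (x + y) = even_part x + even_part y"
    and even_part_idem: "even_part (even_part x) = even_part x"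
begin

text \<open>Parities are Booleans, with \<open>True\<close> for odd.\<close>

definition parity_part :: "bool \<Rightarrow> 'a \<Rightarrow> 'a"
  where "parity_part e v = (if e then v - even_part v else even_part v)"

definition homogeneous :: "bool \<Rightarrow> 'a \<Rightarrow> bool"
  where "homogeneous e v \<longleftrightarrow> parity_part e v = v"

text \<open>\<open>es\<close> is a list of parities for the list \<open>vs\<close> of homogeneous vectors. As \<open>0\<close> has both
  parities, this is a relation.\<close>

definition homogeneous_list :: "bool list \<Rightarrow> 'a list \<Rightarrow> bool"
  where "homogeneous_list es vs \<longleftrightarrow> list_all2 homogeneous es vs"

end

text \<open>The real space \<open>V\<^sub>\<real>\<close>. The second axiom provides a base of convex open neighbourhoods of \<open>0\<close>;
  convexity is spelled out because \<^const>\<open>convex\<close> is not available inside a class specification.\<close>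

class graded_lcs = real_vector + topological_ab_group_add + t2_space + graded_ab_group +
  assumes tendsto_scaleR_Pair:
      "LIM z (nhds a \<times>\<^sub>F nhds x). fst z *\<^sub>R snd z :> nhds (a *\<^sub>R x)"
    and locally_convex_nhds_0:
      "open U \<Longrightarrow> 0 \<in> U \<Longrightarrow>
        \<exists>C. open C \<and> 0 \<in> C \<and> C \<subseteq> U \<and>
          (\<forall>x\<in>C. \<forall>y\<in>C. \<forall>u\<ge>0. \<forall>v\<ge>0. u + v = 1 \<longrightarrow> u *\<^sub>R x + v *\<^sub>R y \<in> C)"
    and even_part_scaleR: "even_part (r *\<^sub>R x) = r *\<^sub>R even_part x"
    and tendsto_even_part: "(even_part \<longlongrightarrow> even_part x) (nhds x)"

class graded_complex_vector = complex_vector + graded_ab_group +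
  assumes even_part_scaleC: "even_part (c *\<^sub>C x) = c *\<^sub>C even_part x"

text \<open>\<open>Cplx v w\<close> stands for \<open>v \<otimes> 1 + w \<otimes> \<i>\<close>.\<close>

datatype 'v complexified = Cplx (Re_part: 'v) (Im_part: 'v)

instantiation complexified :: (ab_group_add) ab_group_add
begin
definition "0 = Cplx 0 0"
definition "x + y = Cplx (Re_part x + Re_part y) (Im_part x + Im_part y)"
definition "- x = Cplx (- Re_part x) (- Im_part x)"
definition "x - y = Cplx (Re_part x - Re_part y) (Im_part x - Im_part y)"
instance
  by standard
    (simp_all add: zero_complexified_def plus_complexified_def uminus_complexified_def
      minus_complexified_def algebra_simps)
end

instantiation complexified :: (real_vector) complex_vector
begin
definition "c *\<^sub>C x = Cplx (Re c *\<^sub>R Re_part x - Im c *\<^sub>R Im_part x)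
                           (Re c *\<^sub>R Im_part x + Im c *\<^sub>R Re_part x)"
instance
  by standard (simp_all add: scaleC_complexified_def plus_complexified_def algebra_simps)
end

instantiation complexified :: (topological_space) topological_space
begin
definition "open U \<longleftrightarrow> open ((\<lambda>(v, w). Cplx v w) -` U)"
instance
proof
  show "open (UNIV :: 'a complexified set)"
    by (simp add: open_complexified_def)
next
  fix S T :: "'a complexified set"
  assume "open S" "open T"
  then show "open (S \<inter> T)"
    by (simp add: open_complexified_def vimage_Int open_Int)
next
  fix K :: "'a complexified set set"
  assume "\<forall>S\<in>K. open S"
  then show "open (\<Union>K)"
    by (auto simp: open_complexified_def vimage_Union)
qed
end

instantiation complexified :: (graded_lcs) graded_complex_vector
begin
definition "even_part x = Cplx (even_part (Re_part x)) (even_part (Im_part x))"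
instance
proof
  have diff: "even_part (a - b) = even_part a - even_part b" for a b :: 'a
    by (metis add_diff_cancel diff_add_cancel even_part_add)
  fix x y :: "'a complexified" and c :: complex
  show "even_part (x + y) = even_part x + even_part y"
    by (simp add: even_part_complexified_def plus_complexified_def even_part_add)
  show "even_part (even_part x) = even_part x"
    by (simp add: even_part_complexified_def even_part_idem)
  show "even_part (c *\<^sub>C x) = c *\<^sub>C even_part x"
    by (simp add: even_part_complexified_def scaleC_complexified_def diff even_part_add
        even_part_scaleR)
qed
end

definition conj_vec :: "'v::ab_group_add complexified \<Rightarrow> 'v complexified"
  where "conj_vec x = Cplx (Re_part x) (- Im_part x)"

section \<open>Tensor products\<close>

definition tensor_algebra_relations :: "('v::complex_vector list \<Rightarrow>\<^sub>0 complex) set"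
  where "tensor_algebra_relations =
    {Poly_Mapping.single (vs[j := u + v]) 1 - Poly_Mapping.single (vs[j := u]) 1
       - Poly_Mapping.single (vs[j := v]) 1 | vs j u v. j < length vs} \<union>
    {Poly_Mapping.single (vs[j := c *\<^sub>C v]) 1 - c *\<^sub>C Poly_Mapping.single (vs[j := v]) 1
       | vs j c v. j < length vs}"

lemma equivp_mod_span: "equivp (\<lambda>x y. x - y \<in> cspan R)" for R :: "'a::complex_vector set"
proof (rule equivpI)
  show "reflp (\<lambda>x y. x - y \<in> cspan R)"
    by (simp add: reflp_def complex_vector.span_zero)
  show "symp (\<lambda>x y. x - y \<in> cspan R)"
    unfolding symp_def by (metis complex_vector.span_neg minus_diff_eq)
  show "transp (\<lambda>x y. x - y \<in> cspan R)"
    unfolding transp_def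
  proof (intro allI impI)
    fix x y z
    assume "x - y \<in> cspan R" "y - z \<in> cspan R"
    then have "(x - y) + (y - z) \<in> cspan R" by (rule complex_vector.span_add)
    then show "x - z \<in> cspan R" by simp
  qed
qed

text \<open>The tensor algebra \<open>\<Oplus>\<^sub>n V\<^sup>\<otimes>\<^sup>n\<close>: the free vector space on finite lists of vectors, modulo
  multilinearity.\<close>

quotient_type (overloaded) 'v tensor_algebra =
    "'v::complex_vector list \<Rightarrow>\<^sub>0 complex" / "\<lambda>x y. x - y \<in> cspan tensor_algebra_relations"
  by (rule equivp_mod_span)

lemma mod_span_add:
  "x - y \<in> cspan R \<Longrightarrow> x' - y' \<in> cspan R \<Longrightarrow> (x + x') - (y + y') \<in> cspan R"
  for R :: "'a::complex_vector set"
  by (simp add: add_diff_add complex_vector.span_add)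

lemma mod_span_diff:
  "x - y \<in> cspan R \<Longrightarrow> x' - y' \<in> cspan R \<Longrightarrow> (x - x') - (y - y') \<in> cspan R"
  for R :: "'a::complex_vector set"
  using complex_vector.span_diff[of "x - y" R "x' - y'"] by (simp add: algebra_simps)

lemma mod_span_minus:
  "x - y \<in> cspan R \<Longrightarrow> (- x) - (- y) \<in> cspan R"
  for R :: "'a::complex_vector set"
  using complex_vector.span_neg[of "x - y" R] by (simp add: algebra_simps)

lemma mod_span_scaleC:
  "x - y \<in> cspan R \<Longrightarrow> c *\<^sub>C x - c *\<^sub>C y \<in> cspan R"
  for R :: "'a::complex_vector set"
  using complex_vector.span_scale[of "x - y" R c]
  by (simp add: complex_vector.scale_right_diff_distrib)

instantiation tensor_algebra :: (complex_vector) complex_vector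
begin
lift_definition zero_tensor_algebra :: "'a tensor_algebra" is 0 .
lift_definition plus_tensor_algebra :: "'a tensor_algebra \<Rightarrow> 'a tensor_algebra \<Rightarrow> 'a tensor_algebra"
  is "(+)" by (rule mod_span_add)
lift_definition minus_tensor_algebra :: "'a tensor_algebra \<Rightarrow> 'a tensor_algebra \<Rightarrow> 'a tensor_algebra"
  is "(-)" by (rule mod_span_diff)
lift_definition uminus_tensor_algebra :: "'a tensor_algebra \<Rightarrow> 'a tensor_algebra"
  is uminus by (rule mod_span_minus)
lift_definition scaleC_tensor_algebra :: "complex \<Rightarrow> 'a tensor_algebra \<Rightarrow> 'a tensor_algebra"
  is scaleC by (rule mod_span_scaleC)
instance
  by standard
    (transfer, simp add: algebra_simps complex_vector.span_zero scaleC_add_right scaleC_add_left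
      scaleC_scaleC scaleC_one)+
end

text \<open>\<open>v\<^sub>1 \<otimes> \<cdots> \<otimes> v\<^sub>n\<close>; the empty list gives \<open>1 \<in> V\<^sup>\<otimes>\<^sup>0 = \<complex>\<close>.\<close>

lift_definition tensor :: "'v::complex_vector list \<Rightarrow> 'v tensor_algebra"
  is "\<lambda>vs. Poly_Mapping.single vs 1" .

definition multilinear :: "('v::complex_vector list \<Rightarrow> 'w::complex_vector) \<Rightarrow> bool"
  where "multilinear f \<longleftrightarrow> (\<forall>vs j. j < length vs \<longrightarrow> clinear (\<lambda>v. f (vs[j := v])))"

lemma multilinearD: "multilinear f \<Longrightarrow> j < length vs \<Longrightarrow> clinear (\<lambda>v. f (vs[j := v]))"
  by (simp add: multilinear_def)

definition free_lift :: "('i \<Rightarrow> 'w::complex_vector) \<Rightarrow> ('i \<Rightarrow>\<^sub>0 complex) \<Rightarrow> 'w"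
  where "free_lift f x = (\<Sum>i\<in>Poly_Mapping.keys x. Poly_Mapping.lookup x i *\<^sub>C f i)"

text \<open>The linear map with \<open>tensor vs \<mapsto> f vs\<close>, for multilinear \<open>f\<close>; see \<open>tensor_lift_tensor\<close>
  and \<open>clinear_tensor_lift\<close> below.\<close>

definition tensor_lift :: "('v::complex_vector list \<Rightarrow> 'w::complex_vector) \<Rightarrow> 'v tensor_algebra \<Rightarrow> 'w"
  where "tensor_lift f x = free_lift f (rep_tensor_algebra x)"

lemma free_lift_superset:
  "finite A \<Longrightarrow> Poly_Mapping.keys x \<subseteq> A \<Longrightarrow> free_lift f x = (\<Sum>i\<in>A. Poly_Mapping.lookup x i *\<^sub>C f i)"
  unfolding free_lift_def
  by (rule sum.mono_neutral_left) (auto simp: in_keys_iff complex_vector.scale_zero_left)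

lemma lookup_scaleC: "Poly_Mapping.lookup (c *\<^sub>C x) i = c *\<^sub>C Poly_Mapping.lookup x i"
  by transfer simp

lemma clinear_free_lift: "clinear (free_lift f)"
proof (rule clinearI)
  fix x y :: "'a \<Rightarrow>\<^sub>0 complex" and c :: complex
  let ?A = "Poly_Mapping.keys x \<union> Poly_Mapping.keys y"
  have "free_lift f (x + y) = (\<Sum>i\<in>?A. Poly_Mapping.lookup (x + y) i *\<^sub>C f i)"
    by (intro free_lift_superset) (auto simp: keys_add)
  also have "\<dots> = (\<Sum>i\<in>?A. Poly_Mapping.lookup x i *\<^sub>C f i) + (\<Sum>i\<in>?A. Poly_Mapping.lookup y i *\<^sub>C f i)"
    by (simp add: lookup_add scaleC_add_left sum.distrib)
  also have "\<dots> = free_lift f x + free_lift f y"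
    by (simp add: free_lift_superset[of ?A])
  finally show "free_lift f (x + y) = free_lift f x + free_lift f y" .
  have "free_lift f (c *\<^sub>C x) = (\<Sum>i\<in>Poly_Mapping.keys x. Poly_Mapping.lookup (c *\<^sub>C x) i *\<^sub>C f i)"
    by (intro free_lift_superset) (auto simp: in_keys_iff lookup_scaleC scaleC_complex_def)
  then show "free_lift f (c *\<^sub>C x) = c *\<^sub>C free_lift f x"
    by (simp add: free_lift_def lookup_scaleC scaleC_complex_def complex_vector.scale_sum_right
        scaleC_scaleC)
qed

lemma free_lift_single: "free_lift f (Poly_Mapping.single i 1) = f i"
  by (simp add: free_lift_def scaleC_one)

lemma free_lift_cong:
  assumes f: "multilinear f" and xy: "x - y \<in> cspan tensor_algebra_relations"
  shows "free_lift f x = free_lift f y"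
proof -
  note lin = clinear_free_lift[of f]
  interpret L: Vector_Spaces.linear scaleC scaleC "free_lift f" by (rule lin)
  have "free_lift f z = 0" if "z \<in> cspan tensor_algebra_relations" for z
    using that
  proof (induction rule: complex_vector.span_induct_alt)
    case base
    show ?case by (rule L.zero)
  next
    case (step c r z)
    have "free_lift f r = 0"
      using step(1) unfolding tensor_algebra_relations_def
      by (auto simp: L.diff L.scale free_lift_single
          clinear_add[OF multilinearD[OF f]] clinear_scale[OF multilinearD[OF f]])
    with step show ?case by (simp add: L.add L.scale)
  qed
  from this[OF xy] show ?thesis by (simp add: L.diff)
qed

lemma tensor_lift_abs:
  assumes "multilinear f"
  shows "tensor_lift f (abs_tensor_algebra x) = free_lift f x"
proof -
  have "rep_tensor_algebra (abs_tensor_algebra x) - x \<in> cspan tensor_algebra_relations"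
    using Quotient3_rep_abs[OF Quotient3_tensor_algebra, of x]
    by (simp add: complex_vector.span_zero)
  from free_lift_cong[OF assms this] show ?thesis
    by (simp add: tensor_lift_def)
qed

lemma tensor_lift_tensor: "multilinear f \<Longrightarrow> tensor_lift f (tensor vs) = f vs"
  by (simp add: tensor.abs_eq tensor_lift_abs free_lift_single)

lemma abs_tensor_algebra_cases: obtains y where "x = abs_tensor_algebra y"
  by (metis Quotient3_abs_rep[OF Quotient3_tensor_algebra])

lemma clinear_tensor_lift:
  assumes "multilinear f"
  shows "clinear (tensor_lift f)"
proof (rule clinearI)
  interpret L: Vector_Spaces.linear scaleC scaleC "free_lift f" by (rule clinear_free_lift)
  fix x y :: "'a tensor_algebra" and c :: complex
  obtain x' y' where [simp]: "x = abs_tensor_algebra x'" "y = abs_tensor_algebra y'"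
    by (metis abs_tensor_algebra_cases)
  show "tensor_lift f (x + y) = tensor_lift f x + tensor_lift f y"
    by (simp add: plus_tensor_algebra.abs_eq tensor_lift_abs assms L.add)
  show "tensor_lift f (c *\<^sub>C x) = c *\<^sub>C tensor_lift f x"
    by (simp add: scaleC_tensor_algebra.abs_eq tensor_lift_abs assms L.scale)
qed

definition tensor_mult :: "'v::complex_vector tensor_algebra \<Rightarrow> 'v tensor_algebra \<Rightarrow> 'v tensor_algebra"
  where "tensor_mult x y = tensor_lift (\<lambda>vs. tensor_lift (\<lambda>ws. tensor (vs @ ws)) y) x"

definition tensor_component :: "nat \<Rightarrow> 'v::complex_vector tensor_algebra \<Rightarrow> 'v tensor_algebra"
  where "tensor_component n = tensor_lift (\<lambda>vs. if length vs = n then tensor vs else 0)"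

definition tensor_pair_relations :: "('a::complex_vector \<times> 'b::complex_vector \<Rightarrow>\<^sub>0 complex) set"
  where "tensor_pair_relations =
    {Poly_Mapping.single (a + a', b) 1 - Poly_Mapping.single (a, b) 1
       - Poly_Mapping.single (a', b) 1 | a a' b. True} \<union>
    {Poly_Mapping.single (a, b + b') 1 - Poly_Mapping.single (a, b) 1
       - Poly_Mapping.single (a, b') 1 | a b b'. True} \<union>
    {Poly_Mapping.single (c *\<^sub>C a, b) 1 - c *\<^sub>C Poly_Mapping.single (a, b) 1 | c a b. True} \<union>
    {Poly_Mapping.single (a, c *\<^sub>C b) 1 - c *\<^sub>C Poly_Mapping.single (a, b) 1 | c a b. True}"

quotient_type (overloaded) ('a, 'b) tensor_pair =
    "'a::complex_vector \<times> 'b::complex_vector \<Rightarrow>\<^sub>0 complex" / "\<lambda>x y. x - y \<in> cspan tensor_pair_relations"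
  by (rule equivp_mod_span)

instantiation tensor_pair :: (complex_vector, complex_vector) complex_vector
begin
lift_definition zero_tensor_pair :: "('a, 'b) tensor_pair" is 0 .
lift_definition plus_tensor_pair :: "('a, 'b) tensor_pair \<Rightarrow> ('a, 'b) tensor_pair \<Rightarrow> ('a, 'b) tensor_pair"
  is "(+)" by (rule mod_span_add)
lift_definition minus_tensor_pair :: "('a, 'b) tensor_pair \<Rightarrow> ('a, 'b) tensor_pair \<Rightarrow> ('a, 'b) tensor_pair"
  is "(-)" by (rule mod_span_diff)
lift_definition uminus_tensor_pair :: "('a, 'b) tensor_pair \<Rightarrow> ('a, 'b) tensor_pair"
  is uminus by (rule mod_span_minus)
lift_definition scaleC_tensor_pair :: "complex \<Rightarrow> ('a, 'b) tensor_pair \<Rightarrow> ('a, 'b) tensor_pair"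
  is scaleC by (rule mod_span_scaleC)
instance
  by standard
    (transfer, simp add: algebra_simps complex_vector.span_zero scaleC_add_right scaleC_add_left
      scaleC_scaleC scaleC_one)+
end

lift_definition tensor_of :: "'a::complex_vector \<Rightarrow> 'b::complex_vector \<Rightarrow> ('a, 'b) tensor_pair"
    (infixr \<open>\<otimes>\<^sub>C\<close> 72)
  is "\<lambda>a b. Poly_Mapping.single (a, b) 1" .

section \<open>The symmetric algebra\<close>

definition koszul_sign :: "(nat \<Rightarrow> nat) \<Rightarrow> bool list \<Rightarrow> complex"
  where "koszul_sign \<sigma> es =
    (-1) ^ card {(i, j). i < j \<and> j < length es \<and> \<sigma> j < \<sigma> i \<and> es ! \<sigma> i \<and> es ! \<sigma> j}"

text \<open>\<open>(v\<^sub>1 \<otimes> \<cdots> \<otimes> v\<^sub>n) \<triangleleft> \<sigma>\<close> for arbitrary vectors, by splitting each of them into its even and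
  its odd part; \<open>permuted_tensor_homogeneous\<close> is the formula for homogeneous vectors.\<close>

definition permuted_tensor ::
    "(nat \<Rightarrow> nat) \<Rightarrow> 'v::graded_complex_vector list \<Rightarrow> 'v tensor_algebra"
  where "permuted_tensor \<sigma> vs =
    (\<Sum>es | length es = length vs. koszul_sign \<sigma> es *\<^sub>C
      tensor (map (\<lambda>i. parity_part (es ! \<sigma> i) (vs ! \<sigma> i)) [0..<length vs]))"

definition symmetrizer :: "'v::graded_complex_vector tensor_algebra \<Rightarrow> 'v tensor_algebra"
  where "symmetrizer = tensor_lift (\<lambda>vs. (1 / fact (length vs)) *\<^sub>C
    (\<Sum>\<sigma> | \<sigma> permutes {..<length vs}. permuted_tensor \<sigma> vs))"

lemma multilinear_tensor: "multilinear tensor"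
  unfolding multilinear_def
proof (intro allI impI clinearI)
  fix vs :: "'a list" and j u v and c :: complex
  assume j: "j < length vs"
  have "Poly_Mapping.single (vs[j := u + v]) 1 - Poly_Mapping.single (vs[j := u]) 1 -
      Poly_Mapping.single (vs[j := v]) 1 \<in> (tensor_algebra_relations :: ('a list \<Rightarrow>\<^sub>0 complex) set)"
    unfolding tensor_algebra_relations_def using j by blast
  then have "Poly_Mapping.single (vs[j := u + v]) 1 -
      (Poly_Mapping.single (vs[j := u]) 1 + Poly_Mapping.single (vs[j := v]) 1)
      \<in> cspan (tensor_algebra_relations :: ('a list \<Rightarrow>\<^sub>0 complex) set)"
    unfolding diff_diff_eq by (rule complex_vector.span_base)
  then show "tensor (vs[j := u + v]) = tensor (vs[j := u]) + tensor (vs[j := v])"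
    unfolding tensor.abs_eq plus_tensor_algebra.abs_eq tensor_algebra.abs_eq_iff .
  have "Poly_Mapping.single (vs[j := c *\<^sub>C v]) 1 - c *\<^sub>C Poly_Mapping.single (vs[j := v]) 1
      \<in> (tensor_algebra_relations :: ('a list \<Rightarrow>\<^sub>0 complex) set)"
    unfolding tensor_algebra_relations_def using j by blast
  then have "Poly_Mapping.single (vs[j := c *\<^sub>C v]) 1 - c *\<^sub>C Poly_Mapping.single (vs[j := v]) 1
      \<in> cspan (tensor_algebra_relations :: ('a list \<Rightarrow>\<^sub>0 complex) set)"
    by (rule complex_vector.span_base)
  then show "tensor (vs[j := c *\<^sub>C v]) = c *\<^sub>C tensor (vs[j := v])"
    unfolding tensor.abs_eq scaleC_tensor_algebra.abs_eq tensor_algebra.abs_eq_iff .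
qed

lemma parity_part_add: "parity_part e (x + y) = parity_part e x + parity_part e (y :: 'v::graded_ab_group)"
  by (simp add: parity_part_def even_part_add)

lemma parity_part_scaleC: "parity_part e (c *\<^sub>C x) = c *\<^sub>C parity_part e (x :: 'v::graded_complex_vector)"
  by (simp add: parity_part_def even_part_scaleC complex_vector.scale_right_diff_distrib)

lemma map_permuted_update:
  fixes f :: "nat \<Rightarrow> 'a \<Rightarrow> 'b"
  assumes "\<sigma> permutes {..<length vs}" "j < length vs"
  shows "map (\<lambda>i. f (\<sigma> i) (vs[j := v] ! \<sigma> i)) [0..<length vs] =
    (map (\<lambda>i. f (\<sigma> i) (vs ! \<sigma> i)) [0..<length vs])[inv \<sigma> j := f j v]"
proof (rule nth_equalityI)
  fix i assume "i < length (map (\<lambda>i. f (\<sigma> i) (vs[j := v] ! \<sigma> i)) [0..<length vs])"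
  then have i: "i < length vs" by simp
  have "\<sigma> i < length vs"
    using permutes_in_image[OF assms(1), of i] i by simp
  moreover have "\<sigma> i = j \<longleftrightarrow> i = inv \<sigma> j"
    using permutes_inverses[OF assms(1)] by metis
  ultimately show "map (\<lambda>i. f (\<sigma> i) (vs[j := v] ! \<sigma> i)) [0..<length vs] ! i =
    (map (\<lambda>i. f (\<sigma> i) (vs ! \<sigma> i)) [0..<length vs])[inv \<sigma> j := f j v] ! i"
    using i assms(2) by (auto simp: nth_list_update)
qed simp

lemma clinear_permuted_tensor:
  fixes vs :: "'v::graded_complex_vector list"
  assumes "\<sigma> permutes {..<length vs}" "j < length vs"
  shows "clinear (\<lambda>v. permuted_tensor \<sigma> (vs[j := v]))"
proof -
  have inv: "inv \<sigma> j < length vs"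
    using permutes_in_image[OF permutes_inv[OF assms(1)], of j] assms(2) by simp
  define L where "L es = map (\<lambda>i. parity_part (es ! \<sigma> i) (vs ! \<sigma> i)) [0..<length vs]" for es
  have lin: "clinear (\<lambda>v. tensor ((L es)[inv \<sigma> j := v]))" for es
    by (rule multilinearD[OF multilinear_tensor]) (simp add: L_def inv)
  have eq: "permuted_tensor \<sigma> (vs[j := v]) =
      (\<Sum>es | length es = length vs. koszul_sign \<sigma> es *\<^sub>C tensor ((L es)[inv \<sigma> j := parity_part (es ! j) v]))"
    for v
    using map_permuted_update[OF assms, of "\<lambda>k. parity_part (_ ! k)" v]
    by (simp add: permuted_tensor_def L_def)
  show ?thesis
    unfolding eq
    by (rule clinearI)
      (simp_all add: parity_part_add parity_part_scaleC clinear_add[OF lin] clinear_scale[OF lin] scaleC_add_right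
        sum.distrib complex_vector.scale_sum_right mult.commute)
qed

lemma clinear_sum:
  "(\<And>i. i \<in> I \<Longrightarrow> clinear (f i)) \<Longrightarrow> clinear (\<lambda>x. \<Sum>i\<in>I. f i x)"
  by (rule clinearI)
    (auto simp: clinear_add clinear_scale sum.distrib complex_vector.scale_sum_right)

lemma clinear_scaled: "clinear f \<Longrightarrow> clinear (\<lambda>x. c *\<^sub>C f x)"
  by (rule clinearI)
    (auto simp: clinear_add clinear_scale scaleC_add_right complex_vector.scale_left_commute)

lemma multilinear_symmetrizer:
  "multilinear (\<lambda>vs :: 'v::graded_complex_vector list. (1 / fact (length vs)) *\<^sub>C
    (\<Sum>\<sigma> | \<sigma> permutes {..<length vs}. permuted_tensor \<sigma> vs))"
  unfolding multilinear_def
proof (intro allI impI)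
  fix vs :: "'v list" and j
  assume "j < length vs"
  then show "clinear (\<lambda>v. (1 / fact (length (vs[j := v]))) *\<^sub>C
      (\<Sum>\<sigma> | \<sigma> permutes {..<length (vs[j := v])}. permuted_tensor \<sigma> (vs[j := v])))"
    unfolding length_list_update
    by (intro clinear_scaled clinear_sum clinear_permuted_tensor) simp_all
qed

lemma symmetrizer_tensor:
  "symmetrizer (tensor vs) = (1 / fact (length vs)) *\<^sub>C
    (\<Sum>\<sigma> | \<sigma> permutes {..<length vs}. permuted_tensor \<sigma> vs)"
  by (simp add: symmetrizer_def tensor_lift_tensor multilinear_symmetrizer)

lemma clinear_symmetrizer: "clinear symmetrizer"
  unfolding symmetrizer_def by (rule clinear_tensor_lift[OF multilinear_symmetrizer])

lemma tensor_zero: "j < length vs \<Longrightarrow> vs ! j = 0 \<Longrightarrow> tensor vs = 0"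
  using clinear_scale[OF multilinearD[OF multilinear_tensor], of j vs 0 0]
  by (metis complex_vector.scale_zero_left list_update_id)

lemma permuted_tensor_homogeneous:
  fixes vs :: "'v::graded_complex_vector list"
  assumes "homogeneous_list es vs" and \<sigma>: "\<sigma> permutes {..<length vs}"
  shows "permuted_tensor \<sigma> vs =
    koszul_sign \<sigma> es *\<^sub>C tensor (map (\<lambda>i. vs ! \<sigma> i) [0..<length vs])"
proof -
  have hom: "parity_part (es ! i) (vs ! i) = vs ! i" if "i < length vs" for i
    using assms(1) that
    by (simp_all add: homogeneous_list_def homogeneous_def list_all2_conv_all_nth)
  have len: "length es = length vs"
    using assms(1) by (simp add: homogeneous_list_def list_all2_lengthD)
  have bound: "\<sigma> i < length vs" if "i < length vs" for i
    using permutes_in_image[OF \<sigma>, of i] that by simp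
  have fin: "finite {es :: bool list. length es = length vs}"
    using finite_lists_length_eq[of "UNIV :: bool set"] by simp
  have zero: "tensor (map (\<lambda>i. parity_part (fs ! \<sigma> i) (vs ! \<sigma> i)) [0..<length vs]) = 0"
    if fs: "length fs = length vs" "fs \<noteq> es" for fs
  proof -
    obtain k where k: "k < length vs" "fs ! k \<noteq> es ! k"
      using fs len by (auto simp: list_eq_iff_nth_eq)
    have inv: "inv \<sigma> k < length vs" "\<sigma> (inv \<sigma> k) = k"
      using permutes_in_image[OF permutes_inv[OF \<sigma>], of k] k(1) permutes_inverses(1)[OF \<sigma>, of k]
      by simp_all
    have "parity_part (fs ! k) (vs ! k) = 0"
      using hom[OF k(1)] k(2) by (auto simp: parity_part_def split: if_splits)
    then show ?thesis
      by (intro tensor_zero[of "inv \<sigma> k"]) (simp_all add: inv)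
  qed
  have "permuted_tensor \<sigma> vs =
      koszul_sign \<sigma> es *\<^sub>C tensor (map (\<lambda>i. parity_part (es ! \<sigma> i) (vs ! \<sigma> i)) [0..<length vs])"
    unfolding permuted_tensor_def
    by (rule sum.remove[OF fin, of es, THEN trans]) (simp_all add: len zero sum.neutral)
  also have "map (\<lambda>i. parity_part (es ! \<sigma> i) (vs ! \<sigma> i)) [0..<length vs] = map (\<lambda>i. vs ! \<sigma> i) [0..<length vs]"
    by (simp add: hom bound)
  finally show ?thesis .
qed

typedef (overloaded) 'v symmetric_algebra =
    "range (symmetrizer :: 'v::graded_complex_vector tensor_algebra \<Rightarrow> 'v tensor_algebra)"
  by blast

setup_lifting type_definition_symmetric_algebra

lemma range_symmetrizer:
  fixes x y :: "'v::graded_complex_vector tensor_algebra"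
  shows "0 \<in> range (symmetrizer :: 'v tensor_algebra \<Rightarrow> _)"
    and "x \<in> range symmetrizer \<Longrightarrow> y \<in> range symmetrizer \<Longrightarrow> x + y \<in> range symmetrizer"
    and "x \<in> range symmetrizer \<Longrightarrow> y \<in> range symmetrizer \<Longrightarrow> x - y \<in> range symmetrizer"
    and "x \<in> range symmetrizer \<Longrightarrow> - x \<in> range symmetrizer"
    and "x \<in> range symmetrizer \<Longrightarrow> c *\<^sub>C x \<in> range symmetrizer"
proof -
  have scale: "c *\<^sub>C x \<in> range symmetrizer"
    if "x \<in> range symmetrizer" for c and x :: "'v tensor_algebra"
    using that clinear_scale[OF clinear_symmetrizer, symmetric] by auto
  have add: "x + y \<in> range symmetrizer"
    if "x \<in> range symmetrizer" "y \<in> range symmetrizer" for x y :: "'v tensor_algebra"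
    using that clinear_add[OF clinear_symmetrizer, symmetric] by auto
  have neg: "- x = (-1) *\<^sub>C x" for x :: "'v tensor_algebra"
    by simp
  show "0 \<in> range (symmetrizer :: 'v tensor_algebra \<Rightarrow> _)"
    using scale[of "symmetrizer 0" 0] by simp
  show "x \<in> range symmetrizer \<Longrightarrow> y \<in> range symmetrizer \<Longrightarrow> x + y \<in> range symmetrizer"
    by (rule add)
  show "x \<in> range symmetrizer \<Longrightarrow> - x \<in> range symmetrizer"
    unfolding neg by (rule scale)
  show "x \<in> range symmetrizer \<Longrightarrow> y \<in> range symmetrizer \<Longrightarrow> x - y \<in> range symmetrizer"
    unfolding diff_conv_add_uminus neg by (intro add scale)
  show "x \<in> range symmetrizer \<Longrightarrow> c *\<^sub>C x \<in> range symmetrizer"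
    by (rule scale)
qed

instantiation symmetric_algebra :: (graded_complex_vector) complex_vector
begin

lift_definition zero_symmetric_algebra :: "'a symmetric_algebra" is 0
  by (rule range_symmetrizer)
lift_definition plus_symmetric_algebra ::
    "'a symmetric_algebra \<Rightarrow> 'a symmetric_algebra \<Rightarrow> 'a symmetric_algebra"
  is "(+)" by (rule range_symmetrizer)
lift_definition minus_symmetric_algebra ::
    "'a symmetric_algebra \<Rightarrow> 'a symmetric_algebra \<Rightarrow> 'a symmetric_algebra"
  is "(-)" by (rule range_symmetrizer)
lift_definition uminus_symmetric_algebra :: "'a symmetric_algebra \<Rightarrow> 'a symmetric_algebra"
  is uminus by (rule range_symmetrizer)
lift_definition scaleC_symmetric_algebra :: "complex \<Rightarrow> 'a symmetric_algebra \<Rightarrow> 'a symmetric_algebra"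
  is scaleC by (rule range_symmetrizer)
instance
  by standard (transfer, simp add: scaleC_add_right scaleC_add_left scaleC_scaleC scaleC_one)+
end

text \<open>\<open>v\<^sub>1 \<cdots> v\<^sub>n = \<S> (v\<^sub>1 \<otimes> \<cdots> \<otimes> v\<^sub>n)\<close>.\<close>

lift_definition sym_prod :: "'v::graded_complex_vector list \<Rightarrow> 'v symmetric_algebra"
  is "\<lambda>vs. symmetrizer (tensor vs)" by simp

lift_definition sym_mult ::
    "'v::graded_complex_vector symmetric_algebra \<Rightarrow> 'v symmetric_algebra \<Rightarrow> 'v symmetric_algebra"
  is "\<lambda>a b. symmetrizer (tensor_mult a b)" by simp

definition sym_mu :: "('v::graded_complex_vector symmetric_algebra, 'v symmetric_algebra) tensor_pair
    \<Rightarrow> 'v symmetric_algebra"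
  where "sym_mu = (THE f. clinear f \<and> (\<forall>a b. f (a \<otimes>\<^sub>C b) = sym_mult a b))"

definition sym_conj :: "'v::graded_lcs complexified symmetric_algebra \<Rightarrow> 'v complexified symmetric_algebra"
  where "sym_conj = (THE f. (\<forall>a b. f (a + b) = f a + f b) \<and> (\<forall>c a. f (c *\<^sub>C a) = cnj c *\<^sub>C f a) \<and>
    (\<forall>vs. f (sym_prod vs) = sym_prod (map conj_vec vs)))"

definition sym_parity :: "bool \<Rightarrow> 'v::graded_complex_vector symmetric_algebra set"
  where "sym_parity e =
    cspan {sym_prod vs | vs es. homogeneous_list es vs \<and> odd (length (filter id es)) = e}"

section \<open>Star product and Poisson bracket\<close>

definition even_form :: "('v::graded_complex_vector \<Rightarrow> 'v \<Rightarrow> complex) \<Rightarrow> bool"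
  where "even_form \<Lambda> \<longleftrightarrow>
    (\<forall>d e v w. homogeneous d v \<longrightarrow> homogeneous e w \<longrightarrow> d \<noteq> e \<longrightarrow> \<Lambda> v w = 0)"

text \<open>\<open>(-1)\<^bsup>de\<^esup>\<close> for parities \<open>d\<close> and \<open>e\<close>.\<close>

definition parity_sign :: "bool \<Rightarrow> bool \<Rightarrow> complex"
  where "parity_sign d e = (if d \<and> e then -1 else 1)"

text \<open>\<open>\<Lambda> \<circ> \<tau>\<close>, extended from homogeneous vectors.\<close>

definition flip_form :: "('v::graded_complex_vector \<Rightarrow> 'v \<Rightarrow> complex) \<Rightarrow> 'v \<Rightarrow> 'v \<Rightarrow> complex"
  where "flip_form \<Lambda> v w =
    (\<Sum>d\<in>UNIV. \<Sum>e\<in>UNIV. parity_sign d e * \<Lambda> (parity_part e w) (parity_part d v))"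

definition form_plus :: "('v::graded_complex_vector \<Rightarrow> 'v \<Rightarrow> complex) \<Rightarrow> 'v \<Rightarrow> 'v \<Rightarrow> complex"
  where "form_plus \<Lambda> v w = (\<Lambda> v w + flip_form \<Lambda> v w) / 2"

definition form_minus :: "('v::graded_complex_vector \<Rightarrow> 'v \<Rightarrow> complex) \<Rightarrow> 'v \<Rightarrow> 'v \<Rightarrow> complex"
  where "form_minus \<Lambda> v w = (\<Lambda> v w - flip_form \<Lambda> v w) / 2"

definition conj_form ::
    "('v::ab_group_add complexified \<Rightarrow> 'v complexified \<Rightarrow> complex)
      \<Rightarrow> 'v complexified \<Rightarrow> 'v complexified \<Rightarrow> complex"
  where "conj_form \<Lambda> v w = cnj (\<Lambda> (conj_vec v) (conj_vec w))"

definition omit :: "nat \<Rightarrow> 'a list \<Rightarrow> 'a list"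
  where "omit k xs = take k xs @ drop (Suc k) xs"

text \<open>The sign in \<open>P\<^sub>\<Lambda>\<close>, with entries numbered from \<open>0\<close>; \<open>ds\<close> and \<open>es\<close> are the parities of the left
  and the right factor.\<close>

definition contraction_sign :: "bool list \<Rightarrow> bool list \<Rightarrow> nat \<Rightarrow> nat \<Rightarrow> complex"
  where "contraction_sign ds es k l =
    (-1) ^ (of_bool (ds ! k) * length (filter id (drop (Suc k) ds)) +
            of_bool (es ! l) * length (filter id (take l es)))"

text \<open>The right-hand side below extends to all vectors multilinearly and picks up the Koszul sign when
  adjacent entries of \<open>vs\<close> or of \<open>ws\<close> are exchanged, so the linear extension exists; it is unique as
  the elements \<open>sym_prod vs\<close> with homogeneous entries span.\<close>

definition P_op :: "('v::graded_complex_vector \<Rightarrow> 'v \<Rightarrow> complex)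
    \<Rightarrow> ('v symmetric_algebra, 'v symmetric_algebra) tensor_pair
    \<Rightarrow> ('v symmetric_algebra, 'v symmetric_algebra) tensor_pair"
  where "P_op \<Lambda> = (THE P. clinear P \<and>
    (\<forall>ds vs es ws. homogeneous_list ds vs \<longrightarrow> homogeneous_list es ws \<longrightarrow>
      P (sym_prod vs \<otimes>\<^sub>C sym_prod ws) =
        (\<Sum>k<length vs. \<Sum>l<length ws.
          (contraction_sign ds es k l * \<Lambda> (vs ! k) (ws ! l)) *\<^sub>C
            (sym_prod (omit k vs) \<otimes>\<^sub>C sym_prod (omit l ws)))))"

text \<open>Only finitely many summands are nonzero, which is what \<^const>\<open>Sum_any\<close> presupposes.\<close>

definition star_product :: "complex \<Rightarrow> ('v::graded_complex_vector \<Rightarrow> 'v \<Rightarrow> complex)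
    \<Rightarrow> 'v symmetric_algebra \<Rightarrow> 'v symmetric_algebra \<Rightarrow> 'v symmetric_algebra"
  where "star_product z \<Lambda> a b =
    Sum_any (\<lambda>k. (z ^ k / fact k) *\<^sub>C sym_mu ((P_op \<Lambda> ^^ k) (a \<otimes>\<^sub>C b)))"

definition poisson_bracket :: "('v::graded_complex_vector \<Rightarrow> 'v \<Rightarrow> complex)
    \<Rightarrow> 'v symmetric_algebra \<Rightarrow> 'v symmetric_algebra \<Rightarrow> 'v symmetric_algebra"
  where "poisson_bracket \<Lambda> a b = 2 *\<^sub>C sym_mu (P_op (form_minus \<Lambda>) (a \<otimes>\<^sub>C b))"

section \<open>The topology and its completion\<close>

definition continuous_seminorm :: "('v::{complex_vector, topological_space} \<Rightarrow> real) \<Rightarrow> bool"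
  where "continuous_seminorm p \<longleftrightarrow>
    (\<forall>x y. p (x + y) \<le> p x + p y) \<and> (\<forall>c x. p (c *\<^sub>C x) = cmod c * p x) \<and> continuous_on UNIV p"

text \<open>The coefficients \<open>c\<close> matter only for \<open>n = 0\<close>, where they yield the absolute value on \<open>\<complex>\<close>.\<close>

definition tensor_seminorm ::
    "('v::complex_vector \<Rightarrow> real) \<Rightarrow> nat \<Rightarrow> 'v tensor_algebra \<Rightarrow> real"
  where "tensor_seminorm p n x =
    Inf {\<Sum>(c, vs)\<leftarrow>L. cmod c * prod_list (map p vs) | L.
      (\<forall>(c, vs)\<in>set L. length vs = n) \<and> x = (\<Sum>(c, vs)\<leftarrow>L. c *\<^sub>C tensor vs)}"

definition weyl_seminorm ::
    "('v::graded_complex_vector \<Rightarrow> real) \<Rightarrow> real \<Rightarrow> 'v symmetric_algebra \<Rightarrow> real"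
  where "weyl_seminorm p R a =
    Sum_any (\<lambda>n. tensor_seminorm p n (tensor_component n (Rep_symmetric_algebra a)) * fact n powr R)"

definition weyl_topology ::
    "real \<Rightarrow> 'v::{graded_complex_vector, topological_space} symmetric_algebra topology"
  where "weyl_topology R = topology_generated_by
    {{b. weyl_seminorm p R (b - a) < r} | p a r. continuous_seminorm p}"

class complete_complex_tvs =
  complex_vector + uniform_topological_group_add + complete_uniform_space + t2_space +
  assumes tendsto_scaleC_Pair:
    "LIM z (nhds c \<times>\<^sub>F nhds x). fst z *\<^sub>C snd z :> nhds (c *\<^sub>C x)"

text \<open>\<open>\<iota>\<close> exhibits \<open>'w\<close> as the completion, unique up to isomorphism, of the symmetric algebra with
  the topology \<open>weyl_topology R\<close>.\<close>

definition weyl_completion ::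
    "real \<Rightarrow> ('v::{graded_complex_vector, topological_space} symmetric_algebra
      \<Rightarrow> 'w::complete_complex_tvs) \<Rightarrow> bool"
  where "weyl_completion R \<iota> \<longleftrightarrow>
    clinear \<iota> \<and> embedding_map (weyl_topology R) euclidean \<iota> \<and> closure (range \<iota>) = UNIV"

text \<open>The extensions by continuity of a unary and of a binary operation along the dense embedding
  \<open>\<iota>\<close>.\<close>

definition extend1 :: "('a \<Rightarrow> 'w::topological_space) \<Rightarrow> ('a \<Rightarrow> 'a) \<Rightarrow> 'w \<Rightarrow> 'w"
  where "extend1 \<iota> f = (THE g. continuous_on UNIV g \<and> (\<forall>a. g (\<iota> a) = \<iota> (f a)))"

definition extend2 :: "('a \<Rightarrow> 'w::topological_space) \<Rightarrow> ('a \<Rightarrow> 'a \<Rightarrow> 'a) \<Rightarrow> 'w \<Rightarrow> 'w \<Rightarrow> 'w"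
  where "extend2 \<iota> f = (THE g. continuous_on UNIV (\<lambda>(x, y). g x y) \<and>
    (\<forall>a b. g (\<iota> a) (\<iota> b) = \<iota> (f a b)))"

definition weyl_star ::
    "('v::graded_complex_vector symmetric_algebra \<Rightarrow> 'w::topological_space)
      \<Rightarrow> complex \<Rightarrow> ('v \<Rightarrow> 'v \<Rightarrow> complex) \<Rightarrow> 'w \<Rightarrow> 'w \<Rightarrow> 'w"
  where "weyl_star \<iota> z \<Lambda> = extend2 \<iota> (star_product z \<Lambda>)"

definition weyl_poisson ::
    "('v::graded_complex_vector symmetric_algebra \<Rightarrow> 'w::topological_space)
      \<Rightarrow> ('v \<Rightarrow> 'v \<Rightarrow> complex) \<Rightarrow> 'w \<Rightarrow> 'w \<Rightarrow> 'w"
  where "weyl_poisson \<iota> \<Lambda> = extend2 \<iota> (poisson_bracket \<Lambda>)"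

definition weyl_conj ::
    "('v::graded_lcs complexified symmetric_algebra \<Rightarrow> 'w::topological_space) \<Rightarrow> 'w \<Rightarrow> 'w"
  where "weyl_conj \<iota> = extend1 \<iota> sym_conj"

text \<open>The elements of parity \<open>e\<close>: the closure is the image of the continuous extension of the
  projection onto the part of parity \<open>e\<close>.\<close>

definition weyl_parity ::
    "('v::graded_complex_vector symmetric_algebra \<Rightarrow> 'w::topological_space) \<Rightarrow> bool \<Rightarrow> 'w set"
  where "weyl_parity \<iota> e = closure (\<iota> ` sym_parity e)"

end

theory Submission
  imports Defs
begin

text \<open>
  Complex conjugation intertwines contraction with \<open>\<Lambda>\<close> and contraction with \<open>\<Lambda>\<close>-bar, and the graded flip
  of the two tensor factors intertwines contraction with an even form \<open>\<Lambda>\<close> and contraction with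
  \<open>\<Lambda> \<circ> \<tau>\<close>. As the product is graded commutative and \<open>z = \<i>\<hbar>/2\<close> is imaginary, the conjugation is a
  star-involution as soon as the conjugate form is \<open>- \<Lambda> \<circ> \<tau>\<close>, which is a reformulation of (ii).
  Conversely, the constant terms of \<open>v \<star> w\<close> and of \<open>{v, w}\<close> for homogeneous vectors \<open>v\<close>, \<open>w\<close> give back
  the conditions on the form.

  The operations extend to the completion by the estimate \<open>p\<^sub>R (a \<star> b) \<le> q\<^sub>R a \<cdot> q\<^sub>R b\<close>. It rests on counting
  the contractions: \<open>k\<close> of them between \<open>n\<close> and \<open>m\<close> vectors can be chosen in \<open>A = n! m! / ((n-k)! (m-k)!)\<close>
  ordered ways, \<open>A \<ge> 1\<close> and \<open>A \<le> (k! 2\<^bsup>n+m\<^esup>)\<^sup>2\<close>, so \<open>A / k! \<le> 2\<^bsup>n+m\<^esup> A\<^sup>R\<close> if \<open>R \<ge> 1/2\<close>.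
\<close>

section \<open>Universal properties\<close>

text \<open>The map \<open>sym_mu\<close>, the conjugation, \<open>P_op\<close> and the operations
  on the completion are definite descriptions, so nothing can be computed before existence and
  uniqueness are shown. Uniqueness follows from spanning by products of homogeneous vectors, or from
  density. Existence is the obstacle: a map on the symmetric algebra has to respect symmetrization,
  while its defining formula may carry signs that depend on chosen parities. Such formulas become
  multilinear by splitting every argument into its even and odd part, and the right sign under
  exchange of neighbours then yields factorization through the symmetrizer. The same splitting
  shapes the estimates: they are computed on products of homogeneous vectors and reach all elements
  through the decompositions in the projective seminorm. Every factor that is exponential in the
  number of vectors is absorbed by rescaling the seminorm on \<open>V\<close>. Bilinear operations
  are not uniformly continuous, so the extension relies on a local oscillation condition along the
  dense subspace.\<close>

lemma tensor_induct [case_names tensor add scale]: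
  assumes "\<And>vs. P (tensor vs)" "\<And>x y. P x \<Longrightarrow> P y \<Longrightarrow> P (x + y)" "\<And>c x. P x \<Longrightarrow> P (c *\<^sub>C x)"
  shows "P x"
proof -
  obtain y where x: "x = abs_tensor_algebra y"
    by (rule abs_tensor_algebra_cases)
  have "P (abs_tensor_algebra y)"
  proof (induction y rule: update_induct)
    case const
    have "P (0 *\<^sub>C tensor [])" by (intro assms)
    then show ?case by (simp add: zero_tensor_algebra_def)
  next
    case (update y vs c)
    have "Poly_Mapping.update vs c y = c *\<^sub>C Poly_Mapping.single vs 1 + y"
      using update(1)
      by (intro poly_mapping_eqI)
        (auto simp: lookup_update lookup_add lookup_scaleC lookup_single when_def scaleC_complex_def in_keys_iff)
    then have "abs_tensor_algebra (Poly_Mapping.update vs c y) = c *\<^sub>C tensor vs + abs_tensor_algebra y"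
      by (simp add: plus_tensor_algebra.abs_eq scaleC_tensor_algebra.abs_eq tensor.abs_eq)
    then show ?case using update assms by simp
  qed
  then show ?thesis by (simp add: x)
qed

lemma abs_tensor_pair_cases: obtains y where "x = abs_tensor_pair y"
  by (metis Quotient3_abs_rep[OF Quotient3_tensor_pair])

lemma tensor_pair_induct [case_names tensor add scale]:
  assumes "\<And>a b. P (a \<otimes>\<^sub>C b)" "\<And>x y. P x \<Longrightarrow> P y \<Longrightarrow> P (x + y)" "\<And>c x. P x \<Longrightarrow> P (c *\<^sub>C x)"
  shows "P x"
proof -
  obtain y where x: "x = abs_tensor_pair y"
    by (rule abs_tensor_pair_cases)
  have "P (abs_tensor_pair y)"
  proof (induction y rule: update_induct)
    case const
    have "P (0 *\<^sub>C (0 \<otimes>\<^sub>C 0))" by (intro assms)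
    then show ?case by (simp add: zero_tensor_pair_def)
  next
    case (update y ab c)
    obtain a b where [simp]: "ab = (a, b)" by (cases ab)
    have "Poly_Mapping.update ab c y = c *\<^sub>C Poly_Mapping.single ab 1 + y"
      using update(1)
      by (intro poly_mapping_eqI)
        (auto simp: lookup_update lookup_add lookup_scaleC lookup_single when_def scaleC_complex_def in_keys_iff)
    then have "abs_tensor_pair (Poly_Mapping.update ab c y) = c *\<^sub>C (a \<otimes>\<^sub>C b) + abs_tensor_pair y"
      by (simp add: plus_tensor_pair.abs_eq scaleC_tensor_pair.abs_eq tensor_of.abs_eq)
    then show ?case using update assms by simp
  qed
  then show ?thesis by (simp add: x)
qed

lemma cbilinearI:
  assumes "\<And>x x' y. f (x + x') y = f x y + f x' y" "\<And>c x y. f (c *\<^sub>C x) y = c *\<^sub>C f x y"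
    and "\<And>x y y'. f x (y + y') = f x y + f x y'" "\<And>c x y. f x (c *\<^sub>C y) = c *\<^sub>C f x y"
  shows "cbilinear f"
  unfolding cbilinear_def using assms by (auto intro!: clinearI)

lemma cbilinearD:
  assumes "cbilinear f"
  shows "f (x + x') y = f x y + f x' y" "f (c *\<^sub>C x) y = c *\<^sub>C f x y"
    and "f x (y + y') = f x y + f x y'" "f x (c *\<^sub>C y) = c *\<^sub>C f x y"
  using assms clinear_add clinear_scale unfolding cbilinear_def by blast+

lemma clinear_zero: "clinear f \<Longrightarrow> f 0 = 0"
  using clinear_scale[of f 0 0] by simp

lemma clinear_diff: "clinear f \<Longrightarrow> f (x - y) = f x - f y"
  by (metis add_diff_cancel diff_add_cancel clinear_add)

lemmas clinear_simps = clinear_add clinear_scale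

lemma clinear_sum_distrib: "clinear f \<Longrightarrow> f (sum g I) = (\<Sum>i\<in>I. f (g i))"
  by (induction I rule: infinite_finite_induct) (simp_all add: clinear_zero clinear_add)

lemma cbilinear_clinear:
  assumes "cbilinear f"
  shows "clinear (f x)" "clinear (\<lambda>x. f x y)"
  using assms by (simp_all add: cbilinear_def)

lemma cbilinear_zero: "cbilinear f \<Longrightarrow> f 0 y = 0" "cbilinear f \<Longrightarrow> f x 0 = 0"
  using clinear_zero[OF cbilinear_clinear(2), of f] clinear_zero[OF cbilinear_clinear(1), of f]
  by blast+

lemma cbilinear_tensor_of: "cbilinear (\<otimes>\<^sub>C)"
proof -
  have eq: "abs_tensor_pair x = abs_tensor_pair y"
    if "x - y \<in> tensor_pair_relations" for x y :: "'a \<times> 'b \<Rightarrow>\<^sub>0 complex"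
    using complex_vector.span_base[OF that] by (simp add: tensor_pair.abs_eq_iff)
  show ?thesis
    by (rule cbilinearI; unfold tensor_of.abs_eq plus_tensor_pair.abs_eq scaleC_tensor_pair.abs_eq;
        rule eq; unfold tensor_pair_relations_def diff_diff_eq[symmetric]; blast)
qed

lemmas tensor_of_linear = cbilinearD[OF cbilinear_tensor_of] cbilinear_zero[OF cbilinear_tensor_of]

definition pair_lift :: "('a::complex_vector \<Rightarrow> 'b::complex_vector \<Rightarrow> 'c::complex_vector)
    \<Rightarrow> ('a, 'b) tensor_pair \<Rightarrow> 'c"
  where "pair_lift f x = free_lift (\<lambda>(a, b). f a b) (rep_tensor_pair x)"

context
  fixes f :: "'a::complex_vector \<Rightarrow> 'b::complex_vector \<Rightarrow> 'c::complex_vector"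
  assumes f: "cbilinear f"
begin

text \<open>\<open>pair_lift\<close> evaluates an arbitrary representative. The linear extension of
  \<open>f\<close> kills the span of the relations by bilinearity, so every representative gives the
  same value.\<close>

lemma pair_lift_abs: "pair_lift f (abs_tensor_pair x) = free_lift (\<lambda>(a, b). f a b) x"
proof -
  interpret L: Vector_Spaces.linear scaleC scaleC "free_lift (\<lambda>(a, b). f a b)"
    by (rule clinear_free_lift)
  have *: "free_lift (\<lambda>(a, b). f a b) z = 0" if "z \<in> cspan tensor_pair_relations" for z
    using that
  proof (induction rule: complex_vector.span_induct_alt)
    case base
    show ?case by (rule L.zero)
  next
    case (step c r z)
    have "free_lift (\<lambda>(a, b). f a b) r = 0"
      using step(1) unfolding tensor_pair_relations_def
      by (auto simp: L.diff L.scale free_lift_single cbilinearD[OF f])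
    with step show ?case by (simp add: L.add L.scale)
  qed
  have "rep_tensor_pair (abs_tensor_pair x) - x \<in> cspan tensor_pair_relations"
    using Quotient3_rep_abs[OF Quotient3_tensor_pair, of x]
    by (simp add: complex_vector.span_zero)
  from *[OF this] show ?thesis by (simp add: pair_lift_def L.diff)
qed

lemma pair_lift_tensor_of: "pair_lift f (a \<otimes>\<^sub>C b) = f a b"
  by (simp add: tensor_of.abs_eq pair_lift_abs free_lift_single)

lemma clinear_pair_lift: "clinear (pair_lift f)"
proof (rule clinearI)
  interpret L: Vector_Spaces.linear scaleC scaleC "free_lift (\<lambda>(a, b). f a b)"
    by (rule clinear_free_lift)
  fix x y :: "('a, 'b) tensor_pair" and c
  obtain x' y' where [simp]: "x = abs_tensor_pair x'" "y = abs_tensor_pair y'"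
    by (metis abs_tensor_pair_cases)
  show "pair_lift f (x + y) = pair_lift f x + pair_lift f y"
    by (simp add: plus_tensor_pair.abs_eq pair_lift_abs L.add)
  show "pair_lift f (c *\<^sub>C x) = c *\<^sub>C pair_lift f x"
    by (simp add: scaleC_tensor_pair.abs_eq pair_lift_abs L.scale)
qed

end

section \<open>Splitting into homogeneous parts\<close>

lemma parity_part_parity_part:
  "parity_part d (parity_part e (v :: 'v::graded_ab_group)) = (if d = e then parity_part e v else 0)"
proof -
  have z: "even_part (0::'v) = 0"
    using even_part_add[of "0::'v" 0] by simp
  have d: "even_part (x - y) = even_part x - even_part y" for x y :: 'v
    by (metis add_diff_cancel diff_add_cancel even_part_add)
  show ?thesis
    by (auto simp: parity_part_def d even_part_idem z)
qed

lemma homogeneous_parity_part: "homogeneous e (parity_part e (v :: 'v::graded_ab_group))"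
  by (simp add: homogeneous_def parity_part_parity_part)

lemma parity_part_homogeneous:
  "homogeneous e v \<Longrightarrow> parity_part d v = (if d = e then v else (0 :: 'v::graded_ab_group))"
  unfolding homogeneous_def by (metis parity_part_parity_part)

lemma sum_parity_part: "(\<Sum>e\<in>UNIV. parity_part e v) = (v :: 'v::graded_ab_group)"
  by (simp add: UNIV_bool parity_part_def)

abbreviation parity_parts :: "bool list \<Rightarrow> 'v::graded_ab_group list \<Rightarrow> 'v list"
  where "parity_parts es vs \<equiv> map2 parity_part es vs"

lemma homogeneous_list_parity_parts:
  "length es = length vs \<Longrightarrow> homogeneous_list es (parity_parts es vs)"
  by (simp add: homogeneous_list_def list_all2_conv_all_nth homogeneous_parity_part)

lemma homogeneous_list_Nil: "homogeneous_list [] []"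
  by (simp add: homogeneous_list_def)

lemma homogeneous_list_Cons:
  "homogeneous_list (e # es) (v # vs) \<longleftrightarrow> homogeneous e v \<and> homogeneous_list es vs"
  by (simp add: homogeneous_list_def)

lemma homogeneous_list_append:
  "length es = length vs \<Longrightarrow>
    homogeneous_list (es @ es') (vs @ vs') \<longleftrightarrow> homogeneous_list es vs \<and> homogeneous_list es' vs'"
  by (simp add: homogeneous_list_def list_all2_append)

lemma homogeneous_list_length: "homogeneous_list es vs \<Longrightarrow> length es = length vs"
  by (simp add: homogeneous_list_def list_all2_lengthD)

lemma homogeneous_list_nth: "homogeneous_list es vs \<Longrightarrow> i < length vs \<Longrightarrow> homogeneous (es ! i) (vs ! i)"
  by (simp add: homogeneous_list_def list_all2_conv_all_nth)

lemma sum_lists_Suc: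
  "(\<Sum>es | length es = Suc n. f es) = (\<Sum>e\<in>UNIV. \<Sum>es | length es = n. f (e # es))"
  for f :: "bool list \<Rightarrow> 'a::comm_monoid_add"
proof -
  have "(\<Sum>e\<in>UNIV. \<Sum>es | length es = n. f (e # es)) =
      (\<Sum>(e, es)\<in>UNIV \<times> {es. length es = n}. f (e # es))"
    using finite_lists_length_eq[of "UNIV :: bool set" n] by (subst sum.cartesian_product) auto
  also have "\<dots> = (\<Sum>es | length es = Suc n. f es)"
    by (rule sum.reindex_bij_witness[of _ "\<lambda>es. (hd es, tl es)" "\<lambda>(e, es). e # es"])
      (auto simp: length_Suc_conv)
  finally show ?thesis by simp
qed

lemma multilinear_Cons: "multilinear f \<Longrightarrow> multilinear (\<lambda>vs. f (v # vs))"
  unfolding multilinear_def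
proof (intro allI impI)
  fix vs :: "'a list" and j
  assume f: "\<forall>vs j. j < length vs \<longrightarrow> clinear (\<lambda>v. f (vs[j := v]))" and "j < length vs"
  then show "clinear (\<lambda>x. f (v # vs[j := x]))"
    using f[rule_format, of "Suc j" "v # vs"] by simp
qed

text \<open>Each argument is the sum of its even and its odd part. Later reductions to homogeneous
  vectors, algebraic and analytic, go through these \<open>2 ^ length vs\<close> summands.\<close>

lemma multilinear_expand:
  fixes f :: "'v::graded_complex_vector list \<Rightarrow> 'w::complex_vector"
  shows "multilinear f \<Longrightarrow> f vs = (\<Sum>es | length es = length vs. f (parity_parts es vs))"
proof (induction vs arbitrary: f)
  case (Cons v vs)
  have "f (v # vs) = (\<Sum>e\<in>UNIV. f (parity_part e v # vs))"
    using clinear_sum_distrib[OF multilinearD[OF Cons.prems, of 0 "v # vs"], of "\<lambda>e. parity_part e v" UNIV]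
    by (simp add: sum_parity_part)
  also have "\<dots> = (\<Sum>e\<in>UNIV. \<Sum>es | length es = length vs. f (parity_part e v # parity_parts es vs))"
    using Cons.IH[OF multilinear_Cons[OF Cons.prems]] by simp
  finally show ?case by (simp add: sum_lists_Suc)
qed simp

lemma clinear_sum_cong: "clinear f \<Longrightarrow> clinear g \<Longrightarrow> clinear (\<lambda>x. f x + g x)"
  by (rule clinearI) (simp_all add: clinear_add clinear_scale scaleC_add_right algebra_simps)

lemma clinear_const_zero: "clinear (\<lambda>x. 0)"
  by (rule clinearI) simp_all

lemma clinear_compose: "clinear f \<Longrightarrow> clinear g \<Longrightarrow> clinear (\<lambda>x. f (g x))"
  by (rule clinearI) (simp_all add: clinear_add clinear_scale)

lemma clinear_parity_part: "clinear (parity_part e :: 'v::graded_complex_vector \<Rightarrow> 'v)"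
  by (rule clinearI) (simp_all add: parity_part_add parity_part_scaleC)

lemma multilinear_zero: "multilinear f \<Longrightarrow> j < length vs \<Longrightarrow> vs ! j = 0 \<Longrightarrow> f vs = 0"
  using clinear_zero[OF multilinearD, of f j vs] by (metis list_update_id)

lemma multilinear_compose: "clinear F \<Longrightarrow> multilinear f \<Longrightarrow> multilinear (\<lambda>vs. F (f vs))"
  by (simp add: multilinear_def clinear_compose[of F])

lemma multilinear_sum: "(\<And>i. i \<in> I \<Longrightarrow> multilinear (f i)) \<Longrightarrow> multilinear (\<lambda>vs. \<Sum>i\<in>I. f i vs)"
  unfolding multilinear_def by (intro allI impI clinear_sum) simp

lemma homogeneous_tensor_induct [case_names tensor add scale]:
  fixes x :: "'v::graded_complex_vector tensor_algebra"
  assumes t: "\<And>es vs. homogeneous_list es vs \<Longrightarrow> P (tensor vs)"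
    and "\<And>x y. P x \<Longrightarrow> P y \<Longrightarrow> P (x + y)" "\<And>c x. P x \<Longrightarrow> P (c *\<^sub>C x)"
  shows "P x"
proof (induction x rule: tensor_induct)
  case (tensor vs)
  have "P (0 *\<^sub>C tensor [])"
    by (intro assms t[of "[]"]) (simp add: homogeneous_list_Nil)
  then have zero: "P 0" by simp
  have "P (\<Sum>es\<in>A. tensor (parity_parts es vs))"
    if "A \<subseteq> {es. length es = length vs}" for A
    using that
    by (induction A rule: infinite_finite_induct)
      (use zero assms t[OF homogeneous_list_parity_parts] in auto)
  from this[of "{es. length es = length vs}"] show ?case
    by (simp flip: multilinear_expand[OF multilinear_tensor])
qed (use assms in auto)

text \<open>Extends formulas given on homogeneous lists, with signs that depend on the parities, to all lists.\<close>

definition hom_extend :: "(bool list \<Rightarrow> 'v::graded_complex_vector list \<Rightarrow> 'w::complex_vector) \<Rightarrow> 'v list \<Rightarrow> 'w"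
  where "hom_extend g vs = (\<Sum>es | length es = length vs. g es (parity_parts es vs))"

text \<open>Updating entry \<open>j\<close> commutes with the splitting, and each summand is a
  multilinear map composed with a parity projection in that entry.\<close>

lemma multilinear_hom_extend:
  assumes "\<And>es. multilinear (g es)"
  shows "multilinear (hom_extend g)"
  unfolding multilinear_def
proof (intro allI impI)
  fix vs :: "'a list" and j
  assume j: "j < length vs"
  have upd: "parity_parts es (vs[j := v]) = (parity_parts es vs)[j := parity_part (es ! j) v]"
    if "length es = length vs" for es v
    using that j by (intro nth_equalityI) (auto simp: nth_list_update)
  have eq: "hom_extend g (vs[j := v]) =
      (\<Sum>es | length es = length vs. g es ((parity_parts es vs)[j := parity_part (es ! j) v]))" for v
    unfolding hom_extend_def by (auto intro!: sum.cong simp: upd)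
  show "clinear (\<lambda>v. hom_extend g (vs[j := v]))"
    unfolding eq
  proof (rule clinear_sum)
    fix es :: "bool list" assume "es \<in> {es. length es = length vs}"
    then have "clinear (\<lambda>v. g es ((parity_parts es vs)[j := v]))"
      using j by (intro multilinearD assms) auto
    from clinear_compose[OF this clinear_parity_part]
    show "clinear (\<lambda>v. g es ((parity_parts es vs)[j := parity_part (es ! j) v]))" .
  qed
qed

text \<open>A list of parities that differs from \<open>es\<close> at some \<open>k\<close> projects
  the homogeneous entry \<open>k\<close> to \<open>0\<close>, so only the summand of
  \<open>es\<close> survives. In particular the value does not depend on the parity ascribed to a
  zero entry.\<close>

lemma hom_extend_homogeneous:
  assumes g: "\<And>es. multilinear (g es)" and h: "homogeneous_list es vs"
  shows "hom_extend g vs = g es vs"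
proof -
  note len = homogeneous_list_length[OF h]
  have fin: "finite {es :: bool list. length es = length vs}"
    using finite_lists_length_eq[of "UNIV :: bool set"] by simp
  have zero: "g fs (parity_parts fs vs) = 0" if fs: "length fs = length vs" "fs \<noteq> es" for fs
  proof -
    obtain k where k: "k < length vs" "fs ! k \<noteq> es ! k"
      using fs len by (auto simp: list_eq_iff_nth_eq)
    show ?thesis
      by (rule multilinear_zero[OF g, of k])
        (use k fs parity_part_homogeneous[OF homogeneous_list_nth[OF h k(1)]] in auto)
  qed
  have "hom_extend g vs = g es (parity_parts es vs)"
    unfolding hom_extend_def
    by (rule sum.remove[OF fin, of es, THEN trans]) (simp_all add: len zero sum.neutral)
  also have "parity_parts es vs = vs"
    using parity_part_homogeneous[OF homogeneous_list_nth[OF h]] len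
    by (intro nth_equalityI) auto
  finally show ?thesis .
qed

section \<open>Graded symmetric multilinear maps\<close>

text \<open>Only adjacent exchanges are tested, and only between homogeneous vectors, where the sign
  is defined. Adjacent transpositions generate the symmetric group, which
  \<open>graded_symmetric_permute\<close> exploits through insertion sort.\<close>

definition graded_symmetric :: "('v::graded_complex_vector list \<Rightarrow> 'w::complex_vector) \<Rightarrow> bool"
  where "graded_symmetric f \<longleftrightarrow> (\<forall>ds es xs ys d e u v.
    homogeneous_list ds xs \<longrightarrow> homogeneous_list es ys \<longrightarrow> homogeneous d u \<longrightarrow> homogeneous e v \<longrightarrow>
      f (xs @ u # v # ys) = parity_sign d e *\<^sub>C f (xs @ v # u # ys))"

lemma graded_symmetricI:
  assumes "\<And>ds es xs ys d e u v. homogeneous_list ds xs \<Longrightarrow> homogeneous_list es ys \<Longrightarrow>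
    homogeneous d u \<Longrightarrow> homogeneous e v \<Longrightarrow> f (xs @ u # v # ys) = parity_sign d e *\<^sub>C f (xs @ v # u # ys)"
  shows "graded_symmetric f"
  using assms unfolding graded_symmetric_def by blast

lemma graded_symmetricD:
  assumes "graded_symmetric f" "homogeneous_list ds xs" "homogeneous_list es ys"
    "homogeneous d u" "homogeneous e v"
  shows "f (xs @ u # v # ys) = parity_sign d e *\<^sub>C f (xs @ v # u # ys)"
  using assms unfolding graded_symmetric_def by blast

lemma parity_sign_commute: "parity_sign d e = parity_sign e d"
  by (simp add: parity_sign_def)

lemma parity_sign_square: "parity_sign d e * parity_sign d e = 1"
  by (simp add: parity_sign_def)

lemma graded_symmetric_hom_extend:
  assumes g: "\<And>es. multilinear (g es)"
    and swap: "\<And>ds es xs ys d e u v. homogeneous_list ds xs \<Longrightarrow> homogeneous_list es ys \<Longrightarrow>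
      homogeneous d u \<Longrightarrow> homogeneous e v \<Longrightarrow>
      g (ds @ d # e # es) (xs @ u # v # ys) = parity_sign d e *\<^sub>C g (ds @ e # d # es) (xs @ v # u # ys)"
  shows "graded_symmetric (hom_extend g)"
proof (rule graded_symmetricI)
  fix ds es d e and xs ys :: "'a list" and u v :: 'a
  assume h: "homogeneous_list ds xs" "homogeneous_list es ys" "homogeneous d u" "homogeneous e v"
  have "homogeneous_list (ds @ d # e # es) (xs @ u # v # ys)"
    "homogeneous_list (ds @ e # d # es) (xs @ v # u # ys)"
    using h by (simp_all add: homogeneous_list_append homogeneous_list_length homogeneous_list_Cons)
  from this[THEN hom_extend_homogeneous[OF g, rotated]] swap[OF h]
  show "hom_extend g (xs @ u # v # ys) = parity_sign d e *\<^sub>C hom_extend g (xs @ v # u # ys)"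
    by simp
qed

section \<open>Koszul signs through sorting\<close>

text \<open>The Koszul sign of sorting the list \<open>L\<close> of indices, where index \<open>i\<close> has parity \<open>es ! i\<close>.\<close>

fun sorting_sign :: "bool list \<Rightarrow> nat list \<Rightarrow> complex"
  where
    "sorting_sign es [] = 1"
  | "sorting_sign es (i # L) =
      (-1) ^ length (filter (\<lambda>j. j < i \<and> es ! i \<and> es ! j) L) * sorting_sign es L"

text \<open>Exchanging adjacent distinct indices changes the order of this one pair only; an index
  further left counts the same indices to its right as before.\<close>

lemma sorting_sign_swap:
  "i \<noteq> j \<Longrightarrow> sorting_sign es (L @ i # j # M) = parity_sign (es ! i) (es ! j) * sorting_sign es (L @ j # i # M)"
proof (induction L)
  case Nil
  then show ?case by (cases "i < j") (auto simp: parity_sign_def)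
next
  case (Cons k L)
  have len: "length (filter P (L @ i # j # M)) = length (filter P (L @ j # i # M))" for P
    by simp
  have "sorting_sign es (L @ i # j # M) = parity_sign (es ! i) (es ! j) * sorting_sign es (L @ j # i # M)"
    by (rule Cons.IH[OF Cons.prems])
  then show ?case
    by (simp only: append_Cons sorting_sign.simps len[of "\<lambda>l. l < k \<and> es ! k \<and> es ! l"] mult.left_commute)
qed

lemma sorting_sign_sorted: "sorted L \<Longrightarrow> sorting_sign es L = 1"
proof (induction L)
  case (Cons i L)
  then have "filter (\<lambda>j. j < i \<and> es ! i \<and> es ! j) L = []"
    by (auto simp: filter_empty_conv)
  with Cons show ?case by simp
qed simp

text \<open>Inversions are split by whether their first position is the head of the list or lies in
  the tail; the former are what the recursion of \<open>sorting_sign\<close> counts.\<close>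

lemma sorting_sign_card:
  "sorting_sign es L = (-1) ^ card {(a, b). a < b \<and> b < length L \<and> L ! b < L ! a \<and> es ! (L ! a) \<and> es ! (L ! b)}"
proof (induction L)
  case (Cons i L)
  let ?A = "\<lambda>L. {(a, b). a < b \<and> b < length L \<and> L ! b < L ! a \<and> es ! (L ! a) \<and> es ! (L ! b)}"
  let ?B = "{b. b < length L \<and> L ! b < i \<and> es ! i \<and> es ! (L ! b)}"
  have fin: "finite (?A L)" for L
    by (rule finite_subset[of _ "{..<length L} \<times> {..<length L}"]) auto
  have eq: "?A (i # L) = (\<lambda>b. (0, Suc b)) ` ?B \<union> map_prod Suc Suc ` ?A L"
  proof (intro equalityI subsetI)
    fix x assume x: "x \<in> ?A (i # L)"
    then obtain a b where [simp]: "x = (a, b)" by (cases x)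
    obtain b' where [simp]: "b = Suc b'" using x by (cases b) auto
    show "x \<in> (\<lambda>b. (0, Suc b)) ` ?B \<union> map_prod Suc Suc ` ?A L"
      using x by (cases a) auto
  qed auto
  have "card (?A (i # L)) = card ((\<lambda>b. (0::nat, Suc b)) ` ?B) + card (map_prod Suc Suc ` ?A L)"
    unfolding eq by (rule card_Un_disjoint) (use fin in auto)
  also have "\<dots> = card ?B + card (?A L)"
    by (intro arg_cong2[where f="(+)"] card_image) (auto simp: inj_on_def)
  also have "card ?B = length (filter (\<lambda>j. j < i \<and> es ! i \<and> es ! j) L)"
    by (simp add: length_filter_conv_card)
  finally show ?case by (simp add: power_add Cons.IH)
qed simp

lemma koszul_sign_eq_sorting_sign: "koszul_sign \<sigma> es = sorting_sign es (map \<sigma> [0..<length es])"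
proof -
  have "{(i, j). i < j \<and> j < length es \<and> \<sigma> j < \<sigma> i \<and> es ! \<sigma> i \<and> es ! \<sigma> j} =
    {(a, b). a < b \<and> b < length (map \<sigma> [0..<length es]) \<and>
      map \<sigma> [0..<length es] ! b < map \<sigma> [0..<length es] ! a \<and>
      es ! (map \<sigma> [0..<length es] ! a) \<and> es ! (map \<sigma> [0..<length es] ! b)}"
    by auto
  then show ?thesis unfolding koszul_sign_def sorting_sign_card by simp
qed

context
  fixes f :: "'v::graded_complex_vector list \<Rightarrow> 'w::complex_vector" and es and vs :: "'v list"
  assumes sym: "graded_symmetric f" and hom: "homogeneous_list es vs"
begin

abbreviation (input) select :: "nat list \<Rightarrow> 'w"
  where "select L \<equiv> sorting_sign es L *\<^sub>C f (map ((!) vs) L)"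

text \<open>The sign from \<open>sorting_sign_swap\<close> and the sign from graded symmetry are
  equal and cancel, so the signed value \<open>select\<close> does not notice an exchange of
  neighbours.\<close>

lemma select_swap:
  assumes L: "set (L @ i # j # M) \<subseteq> {..<length vs}" "i \<noteq> j"
  shows "select (L @ i # j # M) = select (L @ j # i # M)"
proof -
  have h: "homogeneous_list (map ((!) es) K) (map ((!) vs) K)" if "set K \<subseteq> {..<length vs}" for K
    using that homogeneous_list_nth[OF hom]
    by (auto simp: homogeneous_list_def list_all2_conv_all_nth subset_iff)
  have "f (map ((!) vs) (L @ i # j # M)) = parity_sign (es ! i) (es ! j) *\<^sub>C f (map ((!) vs) (L @ j # i # M))"
    using graded_symmetricD[OF sym h h homogeneous_list_nth[OF hom] homogeneous_list_nth[OF hom], of L M i j] L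
    by auto
  moreover note sorting_sign_swap[OF L(2), of es L M]
  moreover have "(s * c) *\<^sub>C (s *\<^sub>C x) = c *\<^sub>C x" if "s * s = 1" for s c and x :: 'w
    using that by (simp add: scaleC_scaleC mult.commute mult.left_commute)
  ultimately show ?thesis
    by (simp only: parity_sign_square)
qed

lemma select_insort:
  "set (L @ i # M) \<subseteq> {..<length vs} \<Longrightarrow> select (L @ i # M) = select (L @ insort i M)"
proof (induction M arbitrary: L)
  case (Cons j M)
  show ?case
  proof (cases "i \<le> j")
    case False
    then have "select (L @ i # j # M) = select ((L @ [j]) @ i # M)"
      using select_swap[OF Cons.prems] by simp
    also have "\<dots> = select ((L @ [j]) @ insort i M)"
      by (rule Cons.IH) (use Cons.prems in auto)
    finally show ?thesis using False by simp
  qed simp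
qed simp

lemma select_sort_append:
  "set (L @ M) \<subseteq> {..<length vs} \<Longrightarrow> select (L @ M) = select (L @ sort M)"
proof (induction M arbitrary: L)
  case (Cons i M)
  have "select ((L @ [i]) @ M) = select ((L @ [i]) @ sort M)"
    by (rule Cons.IH) (use Cons.prems in auto)
  also have "\<dots> = select (L @ insort i (sort M))"
    using select_insort[of L i "sort M"] Cons.prems by simp
  finally show ?case by simp
qed simp

text \<open>Insertion sort uses adjacent exchanges only, so \<open>select\<close> takes the same
  value on the list of values of \<open>\<sigma>\<close> and on its sorted form
  \<open>[0..<length vs]\<close>, whose sign is \<open>1\<close>.\<close>

lemma graded_symmetric_permute:
  assumes "\<sigma> permutes {..<length vs}"
  shows "koszul_sign \<sigma> es *\<^sub>C f (map (\<lambda>i. vs ! \<sigma> i) [0..<length vs]) = f vs"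
proof -
  let ?L = "map \<sigma> [0..<length vs]"
  have L: "set ?L = {..<length vs}"
    using permutes_image[OF assms] by (simp add: atLeast0LessThan)
  have "distinct ?L"
    using permutes_inj_on[OF assms] by (simp add: distinct_map)
  then have "sort ?L = [0..<length vs]"
    using L by (intro sorted_distinct_set_unique) (auto simp: atLeast0LessThan)
  then have "select ?L = f vs"
    using select_sort_append[of "[]" ?L] L sorting_sign_sorted[of "[0..<length vs]" es]
    by (simp add: map_nth scaleC_one)
  then show ?thesis
    by (simp add: koszul_sign_eq_sorting_sign homogeneous_list_length[OF hom] comp_def)
qed

end

text \<open>All summands of the symmetrization contribute \<open>f vs\<close>, and the factor in
  front divides by their number. This is the universal property behind the maps on the symmetric
  algebra constructed below.\<close>

lemma tensor_lift_symmetrizer: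
  assumes "multilinear f" "graded_symmetric f"
  shows "tensor_lift f (symmetrizer x) = tensor_lift f x"
proof (induction x rule: homogeneous_tensor_induct)
  case (tensor es vs)
  note lin = clinear_tensor_lift[OF assms(1)]
  let ?P = "{\<sigma>. \<sigma> permutes {..<length vs}}"
  have "tensor_lift f (symmetrizer (tensor vs)) =
      (1 / fact (length vs)) *\<^sub>C (\<Sum>\<sigma>\<in>?P. koszul_sign \<sigma> es *\<^sub>C f (map (\<lambda>i. vs ! \<sigma> i) [0..<length vs]))"
    by (simp add: symmetrizer_tensor clinear_scale[OF lin] clinear_sum_distrib[OF lin]
        permuted_tensor_homogeneous[OF tensor] tensor_lift_tensor assms)
  also have "\<dots> = (1 / fact (length vs)) *\<^sub>C (\<Sum>\<sigma>\<in>?P. f vs)"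
    by (simp add: graded_symmetric_permute[OF assms(2) tensor])
  also have "(\<Sum>\<sigma>\<in>?P. f vs) = (fact (length vs) :: complex) *\<^sub>C f vs"
    using card_permutations[of "{..<length vs}" "length vs"]
    by (simp add: complex_vector.scale_sum_left[of "\<lambda>_. 1", symmetric] complex_vector.sum_constant_scale)
  finally show ?case by (simp add: scaleC_scaleC scaleC_one tensor_lift_tensor assms)
next
  case (add x y)
  then show ?case
    by (simp add: clinear_add[OF clinear_symmetrizer] clinear_add[OF clinear_tensor_lift[OF assms(1)]])
next
  case (scale c x)
  then show ?case
    by (simp add: clinear_scale[OF clinear_symmetrizer] clinear_scale[OF clinear_tensor_lift[OF assms(1)]])
qed

text \<open>Both sides lead to the same tensor, so only signs matter. The inversions of odd vectors
  agree except at the pair \<open>p\<close> of positions that receive \<open>u\<close> and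
  \<open>v\<close>; it is inverted on exactly one side, and counts only if both vectors are
  odd.\<close>

lemma permuted_tensor_swap:
  fixes xs ys :: "'v::graded_complex_vector list"
  assumes h: "homogeneous_list ds xs" "homogeneous_list es ys" "homogeneous d u" "homogeneous e v"
    and \<sigma>: "\<sigma> permutes {..<length (xs @ u # v # ys)}"
  defines "t \<equiv> Transposition.transpose (length xs) (Suc (length xs))"
  shows "permuted_tensor (t \<circ> \<sigma>) (xs @ u # v # ys) = parity_sign d e *\<^sub>C permuted_tensor \<sigma> (xs @ v # u # ys)"
proof -
  let ?n = "length (xs @ u # v # ys)" and ?j = "length xs"
  let ?es = "ds @ d # e # es" and ?fs = "ds @ e # d # es"
  have len: "length ds = length xs" "length es = length ys"
    using h by (simp_all add: homogeneous_list_length)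
  have hom: "homogeneous_list ?es (xs @ u # v # ys)" "homogeneous_list ?fs (xs @ v # u # ys)"
    using h by (simp_all add: homogeneous_list_append homogeneous_list_length homogeneous_list_Cons)
  have t: "t permutes {..<?n}"
    unfolding t_def by (rule permutes_swap_id) auto
  have nth: "(xs @ u # v # ys) ! t i = (xs @ v # u # ys) ! i" "?es ! t i = ?fs ! i" for i
    using len by (auto simp: t_def Transposition.transpose_def nth_append nth_Cons split: nat.splits)
  have \<sigma>': "\<sigma> permutes {..<length (xs @ v # u # ys)}" using \<sigma> by simp
  define A where "A \<sigma> es = {(i, j). i < j \<and> j < ?n \<and> \<sigma> j < \<sigma> i \<and> es ! \<sigma> i \<and> es ! \<sigma> j}"
    for \<sigma> :: "nat \<Rightarrow> nat" and es
  define a where "a = inv \<sigma> ?j"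
  define b where "b = inv \<sigma> (Suc ?j)"
  have ab: "\<sigma> a = ?j" "\<sigma> b = Suc ?j" "a < ?n" "b < ?n"
    using permutes_inverses(1)[OF \<sigma>] permutes_in_image[OF permutes_inv[OF \<sigma>], of ?j]
      permutes_in_image[OF permutes_inv[OF \<sigma>], of "Suc ?j"]
    by (simp_all add: a_def b_def)
  have "a \<noteq> b" using ab(1,2) by auto
  define p where "p = (min a b, max a b)"
  have fin: "finite (A \<sigma> es)" for \<sigma> es
    by (rule finite_subset[of _ "{..<?n} \<times> {..<?n}"]) (auto simp: A_def)
  have inj: "\<sigma> i = \<sigma> i' \<longleftrightarrow> i = i'" for i i'
    using permutes_inj[OF \<sigma>] by (auto simp: inj_def)
  have rest: "A (t \<circ> \<sigma>) ?es - {p} = A \<sigma> ?fs - {p}"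
  proof -
    have "(i, i') \<in> A (t \<circ> \<sigma>) ?es \<longleftrightarrow> (i, i') \<in> A \<sigma> ?fs" if ne: "(i, i') \<noteq> p" "i < i'" for i i'
    proof -
      have "\<not> (\<sigma> i = ?j \<and> \<sigma> i' = Suc ?j)" "\<not> (\<sigma> i = Suc ?j \<and> \<sigma> i' = ?j)"
        using ne inj ab(1,2) by (metis max.absorb2 min.absorb1 max.absorb1 min.absorb2 less_imp_le p_def)+
      moreover have "\<sigma> i \<noteq> \<sigma> i'" using inj ne by auto
      \<comment> \<open>Distinct indices other than the exchanged pair keep their order, since
        \<open>t\<close> moves an index at most to its neighbour.\<close>
      ultimately have "t (\<sigma> i') < t (\<sigma> i) \<longleftrightarrow> \<sigma> i' < \<sigma> i"
        by (auto simp: t_def Transposition.transpose_def)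
      then show ?thesis by (auto simp: A_def nth)
    qed
    then show ?thesis by (auto simp: A_def)
  qed
  have p: "p \<in> A (t \<circ> \<sigma>) ?es \<longleftrightarrow> a < b \<and> d \<and> e" "p \<in> A \<sigma> ?fs \<longleftrightarrow> b < a \<and> d \<and> e"
    using \<open>a \<noteq> b\<close> ab len
    by (cases "a < b"; auto simp: A_def p_def nth min_def max_def t_def nth_append)+
  have card: "card B = card (B - {p}) + of_bool (p \<in> B)" if "finite B" for B
    using card_Suc_Diff1[OF that, of p] by (cases "p \<in> B") simp_all
  have "(-1) ^ card (A (t \<circ> \<sigma>) ?es) = parity_sign d e * (-1) ^ card (A \<sigma> ?fs)"
    unfolding card[OF fin, of "t \<circ> \<sigma>"] card[OF fin, of \<sigma>] rest p
    using \<open>a \<noteq> b\<close> by (cases "a < b") (auto simp: parity_sign_def)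
  then have "koszul_sign (t \<circ> \<sigma>) ?es = parity_sign d e * koszul_sign \<sigma> ?fs"
    using len by (simp add: koszul_sign_def A_def)
  then show ?thesis
    unfolding permuted_tensor_homogeneous[OF hom(1) permutes_compose[OF \<sigma> t]]
      permuted_tensor_homogeneous[OF hom(2) \<sigma>']
    by (simp add: nth scaleC_scaleC)
qed

text \<open>The sum over all permutations is reindexed by composition with the involution
  \<open>t\<close>; each summand then yields the same sign.\<close>

lemma graded_symmetric_symmetrizer: "graded_symmetric (\<lambda>vs. symmetrizer (tensor vs))"
proof (rule graded_symmetricI)
  fix ds es d e and xs ys :: "'a list" and u v :: 'a
  assume h: "homogeneous_list ds xs" "homogeneous_list es ys" "homogeneous d u" "homogeneous e v"
  let ?P = "{\<sigma>. \<sigma> permutes {..<length (xs @ u # v # ys)}}"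
  define t where "t = Transposition.transpose (length xs) (Suc (length xs))"
  have t: "t permutes {..<length (xs @ u # v # ys)}"
    unfolding t_def by (rule permutes_swap_id) auto
  have tt: "t \<circ> t = id"
    by (simp add: t_def)
  have "(\<Sum>\<sigma>\<in>?P. permuted_tensor \<sigma> (xs @ u # v # ys)) =
      (\<Sum>\<sigma>\<in>?P. permuted_tensor (t \<circ> \<sigma>) (xs @ u # v # ys))"
    by (rule sum.reindex_bij_witness[of _ "\<lambda>\<sigma>. t \<circ> \<sigma>" "\<lambda>\<sigma>. t \<circ> \<sigma>"])
      (simp_all add: permutes_compose[OF _ t] o_assoc tt del: length_append)
  also have "\<dots> = parity_sign d e *\<^sub>C (\<Sum>\<sigma>\<in>?P. permuted_tensor \<sigma> (xs @ v # u # ys))"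
    unfolding complex_vector.scale_sum_right t_def
    by (intro sum.cong refl permuted_tensor_swap[OF h]) simp
  finally show "symmetrizer (tensor (xs @ u # v # ys)) =
      parity_sign d e *\<^sub>C symmetrizer (tensor (xs @ v # u # ys))"
    by (simp add: symmetrizer_tensor complex_vector.scale_left_commute)
qed

section \<open>The symmetric algebra\<close>

lemma clinear_Rep_symmetric_algebra: "clinear Rep_symmetric_algebra"
  by (rule clinearI) (simp_all add: plus_symmetric_algebra.rep_eq scaleC_symmetric_algebra.rep_eq)

lemma multilinear_sym_prod: "multilinear sym_prod"
proof -
  have lin: "multilinear (\<lambda>vs. symmetrizer (tensor vs))"
    by (rule multilinear_compose[OF clinear_symmetrizer multilinear_tensor])
  show ?thesis
    unfolding multilinear_def
  proof (intro allI impI clinearI)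
    fix vs :: "'a list" and j u v and c :: complex
    assume j: "j < length vs"
    show "sym_prod (vs[j := u + v]) = sym_prod (vs[j := u]) + sym_prod (vs[j := v])"
      using clinear_add[OF multilinearD[OF lin j]]
      by (simp add: Rep_symmetric_algebra_inject[symmetric] sym_prod.rep_eq plus_symmetric_algebra.rep_eq)
    show "sym_prod (vs[j := c *\<^sub>C v]) = c *\<^sub>C sym_prod (vs[j := v])"
      using clinear_scale[OF multilinearD[OF lin j]]
      by (simp add: Rep_symmetric_algebra_inject[symmetric] sym_prod.rep_eq scaleC_symmetric_algebra.rep_eq)
  qed
qed

lemma graded_symmetric_sym_prod: "graded_symmetric sym_prod"
proof (rule graded_symmetricI)
  fix ds es d e and xs ys :: "'a list" and u v :: 'a
  assume h: "homogeneous_list ds xs" "homogeneous_list es ys" "homogeneous d u" "homogeneous e v"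
  show "sym_prod (xs @ u # v # ys) = parity_sign d e *\<^sub>C sym_prod (xs @ v # u # ys)"
    using graded_symmetricD[OF graded_symmetric_symmetrizer h]
    by (simp add: Rep_symmetric_algebra_inject[symmetric] sym_prod.rep_eq scaleC_symmetric_algebra.rep_eq)
qed

lemma Rep_tensor_lift_sym_prod: "Rep_symmetric_algebra (tensor_lift sym_prod x) = symmetrizer x"
proof (induction x rule: tensor_induct)
  case (tensor vs)
  then show ?case by (simp add: tensor_lift_tensor multilinear_sym_prod sym_prod.rep_eq)
qed (simp_all add: clinear_simps[OF clinear_tensor_lift[OF multilinear_sym_prod]] clinear_simps[OF clinear_symmetrizer] plus_symmetric_algebra.rep_eq scaleC_symmetric_algebra.rep_eq)

lemma symmetric_algebra_cases: obtains x where "a = tensor_lift sym_prod x"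
proof -
  obtain x where "Rep_symmetric_algebra a = symmetrizer x"
    using Rep_symmetric_algebra[of a] by auto
  then have "a = tensor_lift sym_prod x"
    by (simp add: Rep_symmetric_algebra_inject[symmetric] Rep_tensor_lift_sym_prod)
  then show thesis by (rule that)
qed

text \<open>The symmetrizer maps onto the symmetric algebra, so products of homogeneous vectors span
  it. Uniqueness arguments and algebraic identities below are checked on these.\<close>

lemma sym_induct [case_names sym_prod add scale]:
  fixes a :: "'v::graded_complex_vector symmetric_algebra"
  assumes t: "\<And>es vs. homogeneous_list es vs \<Longrightarrow> P (sym_prod vs)"
    and a: "\<And>x y. P x \<Longrightarrow> P y \<Longrightarrow> P (x + y)" "\<And>c x. P x \<Longrightarrow> P (c *\<^sub>C x)"
  shows "P a"
proof -
  obtain x where x: "a = tensor_lift sym_prod x" by (rule symmetric_algebra_cases)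
  note lin = clinear_tensor_lift[OF multilinear_sym_prod]
  have "P (tensor_lift sym_prod x)"
    by (induction x rule: homogeneous_tensor_induct)
      (use assms in \<open>auto simp: tensor_lift_tensor multilinear_sym_prod clinear_simps[OF lin]\<close>)
  then show ?thesis by (simp add: x)
qed

lemma sym_pair_induct [case_names sym_prod add scale]:
  fixes x :: "('v::graded_complex_vector symmetric_algebra, 'u::graded_complex_vector symmetric_algebra) tensor_pair"
  assumes t: "\<And>ds es vs ws. homogeneous_list ds vs \<Longrightarrow> homogeneous_list es ws \<Longrightarrow> P (sym_prod vs \<otimes>\<^sub>C sym_prod ws)"
    and a: "\<And>x y. P x \<Longrightarrow> P y \<Longrightarrow> P (x + y)" "\<And>c x. P x \<Longrightarrow> P (c *\<^sub>C x)"
  shows "P x"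
proof (induction x rule: tensor_pair_induct)
  case (tensor a b)
  have "P (sym_prod vs \<otimes>\<^sub>C b)" if "homogeneous_list ds vs" for ds vs
    by (induction b rule: sym_induct) (use t a that in \<open>auto simp: tensor_of_linear\<close>)
  then show ?case
    by (induction a rule: sym_induct) (use a in \<open>auto simp: tensor_of_linear\<close>)
qed (use a in auto)

text \<open>An element is already a symmetric tensor, so a multilinear \<open>f\<close> can be
  evaluated on it directly. For graded symmetric \<open>f\<close> this is the factorization of
  \<open>f\<close> through the symmetrizer.\<close>

definition sym_lift :: "('v::graded_complex_vector list \<Rightarrow> 'w::complex_vector) \<Rightarrow> 'v symmetric_algebra \<Rightarrow> 'w"
  where "sym_lift f a = tensor_lift f (Rep_symmetric_algebra a)"

lemma clinear_sym_lift: "multilinear f \<Longrightarrow> clinear (sym_lift f)"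
  using clinear_compose[OF clinear_tensor_lift clinear_Rep_symmetric_algebra, of f]
  by (simp add: sym_lift_def[abs_def])

lemma sym_lift_sym_prod:
  "multilinear f \<Longrightarrow> graded_symmetric f \<Longrightarrow> sym_lift f (sym_prod vs) = f vs"
  by (simp add: sym_lift_def sym_prod.rep_eq tensor_lift_symmetrizer tensor_lift_tensor)

text \<open>This is idempotence of the symmetrizer in disguise, obtained from graded symmetry of
  \<open>sym_prod\<close> rather than from composing permutations.\<close>

lemma tensor_lift_sym_prod_Rep: "tensor_lift sym_prod (Rep_symmetric_algebra a) = a"
  unfolding sym_lift_def[symmetric]
  by (induction a rule: sym_induct)
    (simp_all add: sym_lift_sym_prod multilinear_sym_prod graded_symmetric_sym_prod
      clinear_simps[OF clinear_sym_lift])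

lemma multilinear_add: "multilinear f \<Longrightarrow> multilinear g \<Longrightarrow> multilinear (\<lambda>vs. f vs + g vs)"
  by (simp add: multilinear_def clinear_sum_cong)

lemma multilinear_scale: "multilinear f \<Longrightarrow> multilinear (\<lambda>vs. c *\<^sub>C f vs)"
  by (simp add: multilinear_def clinear_scaled)

lemma graded_symmetric_add:
  assumes "graded_symmetric f" "graded_symmetric g"
  shows "graded_symmetric (\<lambda>vs. f vs + g vs)"
proof (rule graded_symmetricI)
  fix ds es d e and xs ys :: "'a list" and u v :: 'a
  assume "homogeneous_list ds xs" "homogeneous_list es ys" "homogeneous d u" "homogeneous e v"
  from assms[THEN graded_symmetricD, OF this]
  show "f (xs @ u # v # ys) + g (xs @ u # v # ys) =
      parity_sign d e *\<^sub>C (f (xs @ v # u # ys) + g (xs @ v # u # ys))"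
    by (simp only: scaleC_add_right)
qed

lemma graded_symmetric_scale:
  assumes "graded_symmetric f"
  shows "graded_symmetric (\<lambda>vs. c *\<^sub>C f vs)"
proof (rule graded_symmetricI)
  fix ds es d e and xs ys :: "'a list" and u v :: 'a
  assume "homogeneous_list ds xs" "homogeneous_list es ys" "homogeneous d u" "homogeneous e v"
  from graded_symmetricD[OF assms this]
  show "c *\<^sub>C f (xs @ u # v # ys) = parity_sign d e *\<^sub>C c *\<^sub>C f (xs @ v # u # ys)"
    by (simp only: complex_vector.scale_left_commute)
qed

lemma graded_symmetric_sum:
  "(\<And>i. i \<in> I \<Longrightarrow> graded_symmetric (f i)) \<Longrightarrow> graded_symmetric (\<lambda>vs. \<Sum>i\<in>I. f i vs)"
  by (rule graded_symmetricI)
    (auto simp: complex_vector.scale_sum_right intro!: sum.cong graded_symmetricD)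

text \<open>One argument is lifted at a time. Multilinearity and graded symmetry of the inner lift
  in \<open>ws\<close> are stable under sums and scalars, so induction on \<open>a\<close> reduces
  them to a product, where they are hypotheses.\<close>

lemma sym_bilinear_lift:
  fixes f :: "'v::graded_complex_vector list \<Rightarrow> 'u::graded_complex_vector list \<Rightarrow> 'w::complex_vector"
  assumes l: "\<And>ws. multilinear (\<lambda>vs. f vs ws)" "\<And>ws. graded_symmetric (\<lambda>vs. f vs ws)"
    and r: "\<And>vs. multilinear (f vs)" "\<And>vs. graded_symmetric (f vs)"
  defines "F \<equiv> \<lambda>a b. sym_lift (\<lambda>ws. sym_lift (\<lambda>vs. f vs ws) a) b"
  shows "cbilinear F" "F (sym_prod vs) (sym_prod ws) = f vs ws"
proof -
  note lin = clinear_simps[OF clinear_sym_lift[OF l(1)]]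
  have m: "multilinear (\<lambda>ws. sym_lift (\<lambda>vs. f vs ws) a)" for a
    by (induction a rule: sym_induct)
      (simp_all add: sym_lift_sym_prod l r lin multilinear_add multilinear_scale)
  have g: "graded_symmetric (\<lambda>ws. sym_lift (\<lambda>vs. f vs ws) a)" for a
    by (induction a rule: sym_induct)
      (simp_all add: sym_lift_sym_prod l r lin graded_symmetric_add graded_symmetric_scale)
  have F: "F a (sym_prod ws) = sym_lift (\<lambda>vs. f vs ws) a" for a ws
    by (simp add: F_def sym_lift_sym_prod m g)
  show "F (sym_prod vs) (sym_prod ws) = f vs ws"
    by (simp add: F sym_lift_sym_prod l)
  have r: "clinear (F a)" for a
    unfolding F_def by (rule clinear_sym_lift[OF m])
  show "cbilinear F"
  proof (rule cbilinearI)
    fix a a' b c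
    show "F (a + a') b = F a b + F a' b"
      by (induction b rule: sym_induct)
        (simp_all add: F lin clinear_simps[OF r] scaleC_add_right algebra_simps)
    show "F (c *\<^sub>C a) b = c *\<^sub>C F a b"
      by (induction b rule: sym_induct)
        (simp_all add: F lin clinear_simps[OF r] scaleC_add_right complex_vector.scale_left_commute)
  qed (simp_all add: clinear_simps[OF r])
qed

text \<open>Existence for operators whose formula has signs depending on the parities, such as
  \<open>P_op\<close> and \<open>pair_flip\<close>. Splitting both lists into homogeneous parts
  gives a map with a bilinear lift, which inherits the exchange laws of \<open>g\<close>.\<close>

lemma homogeneous_sym_pair_lift:
  fixes g :: "bool list \<Rightarrow> bool list \<Rightarrow> 'v::graded_complex_vector list \<Rightarrow> 'u::graded_complex_vector list \<Rightarrow> 'w::complex_vector"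
  assumes l: "\<And>ds es ws. multilinear (\<lambda>vs. g ds es vs ws)"
    and r: "\<And>ds es vs. multilinear (g ds es vs)"
    and swap_l: "\<And>ds es xs ys d e u v fs ws. homogeneous_list ds xs \<Longrightarrow> homogeneous_list es ys \<Longrightarrow>
      homogeneous d u \<Longrightarrow> homogeneous e v \<Longrightarrow>
      g (ds @ d # e # es) fs (xs @ u # v # ys) ws = parity_sign d e *\<^sub>C g (ds @ e # d # es) fs (xs @ v # u # ys) ws"
    and swap_r: "\<And>ds es xs ys d e u v fs vs. homogeneous_list ds xs \<Longrightarrow> homogeneous_list es ys \<Longrightarrow>
      homogeneous d u \<Longrightarrow> homogeneous e v \<Longrightarrow>
      g fs (ds @ d # e # es) vs (xs @ u # v # ys) = parity_sign d e *\<^sub>C g fs (ds @ e # d # es) vs (xs @ v # u # ys)"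
  shows "\<exists>F. clinear F \<and> (\<forall>ds vs es ws. homogeneous_list ds vs \<longrightarrow> homogeneous_list es ws \<longrightarrow>
    F (sym_prod vs \<otimes>\<^sub>C sym_prod ws) = g ds es vs ws)"
proof -
  define h where "h vs ws = hom_extend (\<lambda>ds vs. hom_extend (\<lambda>es. g ds es vs) ws) vs" for vs ws
  have m1: "multilinear (\<lambda>vs. hom_extend (\<lambda>es. g ds es vs) ws)" for ds ws
    unfolding hom_extend_def by (intro multilinear_sum l)
  have m2: "multilinear (hom_extend (\<lambda>es. g ds es vs))" for ds vs
    by (rule multilinear_hom_extend) (rule r)
  have m3: "multilinear (\<lambda>vs. h vs ws)" for ws
    unfolding h_def by (rule multilinear_hom_extend) (rule m1)
  have m4: "multilinear (h vs)" for vs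
    unfolding h_def hom_extend_def[of _ vs] by (intro multilinear_sum m2)
  have g1: "graded_symmetric (\<lambda>vs. h vs ws)" for ws
    unfolding h_def
  proof (rule graded_symmetric_hom_extend[OF m1])
    fix ds es d e and xs ys :: "'v list" and u v :: 'v
    assume "homogeneous_list ds xs" "homogeneous_list es ys" "homogeneous d u" "homogeneous e v"
    from swap_l[OF this] show "hom_extend (\<lambda>fs. g (ds @ d # e # es) fs (xs @ u # v # ys)) ws =
        parity_sign d e *\<^sub>C hom_extend (\<lambda>fs. g (ds @ e # d # es) fs (xs @ v # u # ys)) ws"
      by (simp add: hom_extend_def complex_vector.scale_sum_right)
  qed
  have g2: "graded_symmetric (h vs)" for vs
    unfolding h_def hom_extend_def[of _ vs]
    by (intro graded_symmetric_sum graded_symmetric_hom_extend r swap_r)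
  note F = sym_bilinear_lift[OF m3 g1 m4 g2]
  show ?thesis
  proof (intro exI conjI allI impI, rule clinear_pair_lift[OF F(1)])
    fix ds es and vs :: "'v list" and ws :: "'u list"
    assume hom: "homogeneous_list ds vs" "homogeneous_list es ws"
    have "h vs ws = g ds es vs ws"
      using hom_extend_homogeneous[where g="\<lambda>ds vs. hom_extend (\<lambda>es. g ds es vs) ws", OF m1 hom(1)]
        hom_extend_homogeneous[where g="\<lambda>es. g ds es vs", OF r hom(2)]
      by (simp add: h_def)
    then show "pair_lift (\<lambda>a b. sym_lift (\<lambda>ws. sym_lift (\<lambda>vs. h vs ws) a) b)
        (sym_prod vs \<otimes>\<^sub>C sym_prod ws) = g ds es vs ws"
      by (simp add: pair_lift_tensor_of[OF F(1)] F(2))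
  qed
qed

section \<open>The product\<close>

lemma multilinear_append: "multilinear f \<Longrightarrow> multilinear (\<lambda>vs. f (vs @ ws))"
  unfolding multilinear_def
proof (intro allI impI)
  fix vs :: "'a list" and j
  assume f: "\<forall>vs j. j < length vs \<longrightarrow> clinear (\<lambda>v. f (vs[j := v]))" and "j < length vs"
  then show "clinear (\<lambda>x. f (vs[j := x] @ ws))"
    using f[rule_format, of j "vs @ ws"] by (simp add: list_update_append)
qed

lemma multilinear_prepend: "multilinear f \<Longrightarrow> multilinear (\<lambda>ws. f (vs @ ws))"
proof (induction vs arbitrary: f)
  case (Cons v vs)
  then show ?case using Cons.IH[OF multilinear_Cons] by fastforce
qed simp

text \<open>Graded symmetry speaks of homogeneous entries only, while \<open>ws\<close> is
  arbitrary; it is first expanded into its parity parts.\<close>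

lemma graded_symmetric_append:
  assumes "multilinear f" "graded_symmetric f"
  shows "graded_symmetric (\<lambda>vs. f (vs @ ws))"
proof -
  have eq: "f (vs @ ws) = (\<Sum>es | length es = length ws. f (vs @ parity_parts es ws))" for vs
    by (rule multilinear_expand[OF multilinear_prepend[OF assms(1)]])
  have "graded_symmetric (\<lambda>vs. f (vs @ parity_parts es ws))" if "length es = length ws" for es
  proof (rule graded_symmetricI)
    fix ds fs d e and xs ys :: "'a list" and u v :: 'a
    assume h: "homogeneous_list ds xs" "homogeneous_list fs ys" "homogeneous d u" "homogeneous e v"
    have "homogeneous_list (fs @ es) (ys @ parity_parts es ws)"
      using h homogeneous_list_parity_parts[OF that]
      by (simp add: homogeneous_list_append homogeneous_list_length)
    from graded_symmetricD[OF assms(2) h(1) this h(3,4)]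
    show "f ((xs @ u # v # ys) @ parity_parts es ws) =
        parity_sign d e *\<^sub>C f ((xs @ v # u # ys) @ parity_parts es ws)"
      by (simp only: append_assoc append_Cons)
  qed
  then show ?thesis
    unfolding eq by (intro graded_symmetric_sum) simp
qed

lemma graded_symmetric_prepend:
  assumes "multilinear f" "graded_symmetric f"
  shows "graded_symmetric (\<lambda>ws. f (vs @ ws))"
proof -
  have eq: "f (vs @ ws) = (\<Sum>es | length es = length vs. f (parity_parts es vs @ ws))" for ws
    by (rule multilinear_expand[OF multilinear_append[OF assms(1)]])
  have "graded_symmetric (\<lambda>ws. f (parity_parts es vs @ ws))" if "length es = length vs" for es
  proof (rule graded_symmetricI)
    fix ds fs d e and xs ys :: "'a list" and u v :: 'a
    assume h: "homogeneous_list ds xs" "homogeneous_list fs ys" "homogeneous d u" "homogeneous e v"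
    have "homogeneous_list (es @ ds) (parity_parts es vs @ xs)"
      using h homogeneous_list_parity_parts[OF that] that by (simp add: homogeneous_list_append)
    from graded_symmetricD[OF assms(2) this h(2-4)]
    show "f (parity_parts es vs @ xs @ u # v # ys) =
        parity_sign d e *\<^sub>C f (parity_parts es vs @ xs @ v # u # ys)"
      by (simp only: append_assoc)
  qed
  then show ?thesis
    unfolding eq by (intro graded_symmetric_sum) simp
qed

text \<open>The product is the bilinear lift of concatenation. Once this is known, the equality of
  \<open>\<S> (\<S> x \<otimes> \<S> y)\<close> and \<open>\<S> (x \<otimes> y)\<close> follows from
  multilinearity and graded symmetry of \<open>sym_prod\<close>.\<close>

lemma sym_mult_eq:
  fixes a b :: "'v::graded_complex_vector symmetric_algebra"
  shows "sym_mult a b = sym_lift (\<lambda>ws. sym_lift (\<lambda>vs. sym_prod (vs @ ws)) a) b"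
proof -
  note l = clinear_tensor_lift[OF multilinear_append[OF multilinear_sym_prod]]
  have m: "multilinear (\<lambda>ws. tensor_lift (\<lambda>vs. sym_prod (vs @ ws)) x)"
    for x :: "'v tensor_algebra"
    by (induction x rule: tensor_induct)
      (simp_all add: tensor_lift_tensor[OF multilinear_append[OF multilinear_sym_prod]]
        multilinear_prepend multilinear_sym_prod clinear_simps[OF l]
        multilinear_add multilinear_scale)
  note l' = clinear_tensor_lift[OF multilinear_prepend[OF multilinear_tensor]]
  have m': "multilinear (\<lambda>vs. tensor_lift (\<lambda>ws. tensor (vs @ ws)) y)"
    for y :: "'v tensor_algebra"
    by (induction y rule: tensor_induct)
      (simp_all add: tensor_lift_tensor[OF multilinear_prepend[OF multilinear_tensor]]
        multilinear_append multilinear_tensor clinear_simps[OF l']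
        multilinear_add multilinear_scale)
  have lin_l: "tensor_mult (x + x') y = tensor_mult x y + tensor_mult x' y"
      "tensor_mult (c *\<^sub>C x) y = c *\<^sub>C tensor_mult x y" for x x' y :: "'v tensor_algebra" and c
    unfolding tensor_mult_def
    by (simp_all add: clinear_simps[OF clinear_tensor_lift[OF m']])
  have t1: "tensor_mult (tensor vs) y = tensor_lift (\<lambda>ws. tensor (vs @ ws)) y"
    for vs and y :: "'v tensor_algebra"
    unfolding tensor_mult_def by (rule tensor_lift_tensor[OF m'])
  define G where "G x ws = tensor_lift (\<lambda>vs. sym_prod (vs @ ws)) x" for x :: "'v tensor_algebra" and ws
  have G: "multilinear (G x)" "G (tensor vs) ws = sym_prod (vs @ ws)"
      "G (x + x') ws = G x ws + G x' ws" "G (c *\<^sub>C x) ws = c *\<^sub>C G x ws" for x x' c vs ws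
    using m[of x]
    by (simp_all add: G_def[abs_def] tensor_lift_tensor[OF multilinear_append[OF multilinear_sym_prod]]
        clinear_simps[OF l])
  note lin = clinear_simps[OF clinear_tensor_lift[OF G(1)]]
    tensor_lift_tensor[OF G(1)] clinear_simps[OF clinear_symmetrizer]
    plus_symmetric_algebra.rep_eq scaleC_symmetric_algebra.rep_eq
  have *: "Rep_symmetric_algebra (tensor_lift (G (tensor vs)) y) = symmetrizer (tensor_mult (tensor vs) y)"
    for vs y
    by (induction y rule: tensor_induct)
      (simp_all only: t1 lin, simp_all add: G(2) tensor_lift_tensor[OF multilinear_prepend[OF multilinear_tensor]]
        sym_prod.rep_eq clinear_simps[OF l'] lin)
  have add: "tensor_lift (G (x + x')) y = tensor_lift (G x) y + tensor_lift (G x') y" for x x' y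
    by (induction y rule: tensor_induct) (simp_all only: lin, simp_all add: G(3) scaleC_add_right algebra_simps)
  have scale: "tensor_lift (G (c *\<^sub>C x)) y = c *\<^sub>C tensor_lift (G x) y" for c x y
    by (induction y rule: tensor_induct)
      (simp_all only: lin, simp_all add: G(4) scaleC_add_right complex_vector.scale_left_commute)
  have "Rep_symmetric_algebra (tensor_lift (G x) y) = symmetrizer (tensor_mult x y)" for x y
    by (induction x rule: tensor_induct) (simp_all add: * add scale lin_l lin)
  then show ?thesis
    by (simp add: Rep_symmetric_algebra_inject[symmetric] sym_mult.rep_eq sym_lift_def G_def[abs_def])
qed

lemma cbilinear_sym_mult: "cbilinear sym_mult"
  and sym_mult_sym_prod: "sym_mult (sym_prod vs) (sym_prod ws) = sym_prod (vs @ ws)"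
  using sym_bilinear_lift[of "\<lambda>vs ws. sym_prod (vs @ ws)"]
  by (simp_all add: multilinear_append multilinear_prepend graded_symmetric_append
      graded_symmetric_prepend multilinear_sym_prod graded_symmetric_sym_prod flip: sym_mult_eq)

lemma sym_mu_eq: "sym_mu = pair_lift sym_mult"
  unfolding sym_mu_def
proof (rule the_equality)
  show "clinear (pair_lift sym_mult) \<and> (\<forall>a b. pair_lift sym_mult (a \<otimes>\<^sub>C b) = sym_mult a b)"
    by (simp add: clinear_pair_lift pair_lift_tensor_of cbilinear_sym_mult)
  fix f :: "('a symmetric_algebra, 'a symmetric_algebra) tensor_pair \<Rightarrow> 'a symmetric_algebra"
  assume f: "clinear f \<and> (\<forall>a b. f (a \<otimes>\<^sub>C b) = sym_mult a b)"
  show "f = pair_lift sym_mult"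
  proof
    fix x show "f x = pair_lift sym_mult x"
      by (induction x rule: tensor_pair_induct)
        (use f in \<open>simp_all add: pair_lift_tensor_of cbilinear_sym_mult clinear_add clinear_scale clinear_pair_lift\<close>)
  qed
qed

lemma clinear_sym_mu: "clinear sym_mu"
  by (simp add: sym_mu_eq clinear_pair_lift cbilinear_sym_mult)

lemma sym_mu_sym_prod: "sym_mu (sym_prod vs \<otimes>\<^sub>C sym_prod ws) = sym_prod (vs @ ws)"
  by (simp add: sym_mu_eq pair_lift_tensor_of cbilinear_sym_mult sym_mult_sym_prod)

section \<open>Complex conjugation\<close>

text \<open>Antilinear maps are linear maps to the complex conjugate space.\<close>

datatype 'a conjugated = Conjugated (unconjugated: 'a)

instantiation conjugated :: (complex_vector) complex_vector
begin
definition "0 = Conjugated 0"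
definition "x + y = Conjugated (unconjugated x + unconjugated y)"
definition "- x = Conjugated (- unconjugated x)"
definition "x - y = Conjugated (unconjugated x - unconjugated y)"
definition "c *\<^sub>C x = Conjugated (cnj c *\<^sub>C unconjugated x)"
instance
  by standard
    (simp_all add: zero_conjugated_def plus_conjugated_def uminus_conjugated_def minus_conjugated_def
      scaleC_conjugated_def algebra_simps scaleC_add_right scaleC_add_left scaleC_scaleC scaleC_one)
end

lemmas conjugated_defs = plus_conjugated_def scaleC_conjugated_def

lemma conj_vec_add: "conj_vec (x + y) = conj_vec x + conj_vec y"
  by (simp add: conj_vec_def plus_complexified_def)

lemma conj_vec_scaleC: "conj_vec (c *\<^sub>C x) = cnj c *\<^sub>C conj_vec x"
  by (simp add: conj_vec_def scaleC_complexified_def)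

lemma conj_vec_conj_vec: "conj_vec (conj_vec x) = x"
  by (simp add: conj_vec_def)

lemma parity_part_conj_vec: "parity_part e (conj_vec x) = conj_vec (parity_part e (x :: 'v::graded_lcs complexified))"
proof -
  have "even_part (- y) = - even_part y" for y :: 'v
    using even_part_scaleR[of "-1" y] by simp
  then show ?thesis
    by (simp add: parity_part_def conj_vec_def even_part_complexified_def minus_complexified_def)
qed

lemma homogeneous_conj_vec: "homogeneous e x \<Longrightarrow> homogeneous e (conj_vec (x :: 'v::graded_lcs complexified))"
  by (simp add: homogeneous_def parity_part_conj_vec)

lemma homogeneous_list_conj_vec:
  "homogeneous_list es vs \<Longrightarrow> homogeneous_list es (map conj_vec (vs :: 'v::graded_lcs complexified list))"
  by (auto simp: homogeneous_list_def list_all2_conv_all_nth homogeneous_conj_vec)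

lemma cnj_parity_sign: "cnj (parity_sign d e) = parity_sign d e"
  by (simp add: parity_sign_def)

text \<open>Conjugating all entries and wrapping the result in the conjugate space gives a
  multilinear map. It is graded symmetric because the Koszul signs are real.\<close>

lemma sym_conj:
  fixes a b :: "'v::graded_lcs complexified symmetric_algebra"
  shows sym_conj_add: "sym_conj (a + b) = sym_conj a + sym_conj b"
    and sym_conj_scaleC: "sym_conj (c *\<^sub>C a) = cnj c *\<^sub>C sym_conj a"
    and sym_conj_sym_prod: "sym_conj (sym_prod vs) = sym_prod (map conj_vec (vs :: 'v complexified list))"
proof -
  define f where "f vs = Conjugated (sym_prod (map conj_vec vs))" for vs :: "'v complexified list"
  have m: "multilinear f"
    unfolding multilinear_def f_def
    by (intro allI impI clinearI)
      (simp_all add: map_update conj_vec_add conj_vec_scaleC conjugated_defs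
        clinear_simps[OF multilinearD[OF multilinear_sym_prod]])
  have g: "graded_symmetric f"
    by (rule graded_symmetricI)
      (auto simp: f_def conjugated_defs cnj_parity_sign
        intro!: graded_symmetricD[OF graded_symmetric_sym_prod] homogeneous_conj_vec homogeneous_list_conj_vec)
  define F where "F a = unconjugated (sym_lift f a)" for a
  have F: "F (a + b) = F a + F b" "F (c *\<^sub>C a) = cnj c *\<^sub>C F a"
    "F (sym_prod vs) = sym_prod (map conj_vec vs)" for a b c vs
    by (simp_all add: F_def clinear_simps[OF clinear_sym_lift[OF m]]
        conjugated_defs sym_lift_sym_prod[OF m g] f_def)
  have "sym_conj = F"
    unfolding sym_conj_def
  proof (rule the_equality)
    fix G :: "'v complexified symmetric_algebra \<Rightarrow> 'v complexified symmetric_algebra"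
    assume G: "(\<forall>a b. G (a + b) = G a + G b) \<and> (\<forall>c a. G (c *\<^sub>C a) = cnj c *\<^sub>C G a) \<and>
      (\<forall>vs. G (sym_prod vs) = sym_prod (map conj_vec vs))"
    show "G = F"
    proof
      fix a show "G a = F a"
        by (induction a rule: sym_induct) (simp_all add: G F)
    qed
  qed (simp add: F)
  with F show "sym_conj (a + b) = sym_conj a + sym_conj b"
    "sym_conj (c *\<^sub>C a) = cnj c *\<^sub>C sym_conj a"
    "sym_conj (sym_prod vs) = sym_prod (map conj_vec vs)"
    by simp_all
qed

definition pair_conj ::
    "('v::graded_lcs complexified symmetric_algebra, 'v complexified symmetric_algebra) tensor_pair \<Rightarrow>
      ('v complexified symmetric_algebra, 'v complexified symmetric_algebra) tensor_pair"
  where "pair_conj x = unconjugated (pair_lift (\<lambda>a b. Conjugated (sym_conj a \<otimes>\<^sub>C sym_conj b)) x)"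

lemma pair_conj:
  shows pair_conj_add: "pair_conj (x + y) = pair_conj x + pair_conj y"
    and pair_conj_scaleC: "pair_conj (c *\<^sub>C x) = cnj c *\<^sub>C pair_conj x"
    and pair_conj_tensor_of: "pair_conj (a \<otimes>\<^sub>C b) = sym_conj a \<otimes>\<^sub>C sym_conj b"
proof -
  have b: "cbilinear (\<lambda>a b. Conjugated (sym_conj a \<otimes>\<^sub>C sym_conj b))"
    by (rule cbilinearI) (simp_all add: conjugated_defs sym_conj tensor_of_linear)
  show "pair_conj (x + y) = pair_conj x + pair_conj y" "pair_conj (c *\<^sub>C x) = cnj c *\<^sub>C pair_conj x"
    "pair_conj (a \<otimes>\<^sub>C b) = sym_conj a \<otimes>\<^sub>C sym_conj b"
    by (simp_all add: pair_conj_def clinear_simps[OF clinear_pair_lift[OF b]] pair_lift_tensor_of[OF b] conjugated_defs)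
qed

lemma pair_conj_zero: "pair_conj 0 = 0"
  using pair_conj_scaleC[of 0 0] by simp

lemma pair_conj_sum: "pair_conj (sum f I) = (\<Sum>i\<in>I. pair_conj (f i))"
  by (induction I rule: infinite_finite_induct) (simp_all add: pair_conj_add pair_conj_zero)

lemma sym_conj_zero: "sym_conj 0 = 0"
  using sym_conj_scaleC[of 0 0] by simp

lemma sym_conj_sum: "sym_conj (sum f I) = (\<Sum>i\<in>I. sym_conj (f i))"
  by (induction I rule: infinite_finite_induct) (simp_all add: sym_conj_add sym_conj_zero)

lemma sym_conj_sym_mu: "sym_conj (sym_mu x) = sym_mu (pair_conj x)"
  by (induction x rule: sym_pair_induct)
    (simp_all add: sym_mu_sym_prod sym_conj pair_conj clinear_simps[OF clinear_sym_mu])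

section \<open>The contraction operator\<close>

definition left_sign :: "bool list \<Rightarrow> nat \<Rightarrow> complex"
  where "left_sign ds k = (-1) ^ (of_bool (ds ! k) * length (filter id (drop (Suc k) ds)))"

definition right_sign :: "bool list \<Rightarrow> nat \<Rightarrow> complex"
  where "right_sign es l = (-1) ^ (of_bool (es ! l) * length (filter id (take l es)))"

text \<open>One factor of the sign sees the left list only, the other the right list only. Hence
  \<open>P_op\<close> can be examined as a contraction in either list with the other one
  fixed.\<close>

lemma contraction_sign_eq: "contraction_sign ds es k l = left_sign ds k * right_sign es l"
  by (simp add: contraction_sign_def left_sign_def right_sign_def power_add)

lemma omit_append:
  "omit k (xs @ ys) = (if k < length xs then omit k xs @ ys else xs @ omit (k - length xs) ys)"
  by (auto simp: omit_def Suc_diff_le not_less)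

lemma omit_Cons: "omit k (x # xs) = (case k of 0 \<Rightarrow> xs | Suc k \<Rightarrow> x # omit k xs)"
  by (simp add: omit_def split: nat.split)

lemma length_omit: "k < length xs \<Longrightarrow> length (omit k xs) = length xs - 1"
  by (simp add: omit_def)

lemma omit_update:
  "omit k (xs[j := x]) = (if j = k then omit k xs else (omit k xs)[if j < k then j else j - 1 := x])"
proof (induction xs arbitrary: j k)
  case (Cons y xs)
  then show ?case
    by (auto simp: omit_Cons split: nat.split)
qed (simp add: omit_def)

lemma map_omit: "map f (omit k xs) = omit k (map f xs)"
  by (simp add: omit_def take_map drop_map)

lemma homogeneous_list_omit: "homogeneous_list es vs \<Longrightarrow> homogeneous_list (omit k es) (omit k vs)"
  by (simp add: homogeneous_list_def omit_def list_all2_appendI list_all2_takeI list_all2_dropI)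

text \<open>One entry after the other is taken out and handed to \<open>H\<close> together with the
  product of the remaining ones. Both one-sided views of \<open>P_op\<close> have this shape, so the
  exchange of neighbours is treated once.\<close>

definition sym_contraction ::
    "(nat \<Rightarrow> complex) \<Rightarrow> ('v::graded_complex_vector \<Rightarrow> 'v symmetric_algebra \<Rightarrow> 'w::complex_vector) \<Rightarrow> 'v list \<Rightarrow> 'w"
  where "sym_contraction s H vs = (\<Sum>k<length vs. s k *\<^sub>C H (vs ! k) (sym_prod (omit k vs)))"

lemma multilinear_sym_contraction:
  assumes H: "cbilinear H"
  shows "multilinear (sym_contraction s H)"
  unfolding multilinear_def
proof (intro allI impI)
  fix vs :: "'a list" and j
  assume j: "j < length vs"
  have "clinear (\<lambda>v. H (vs[j := v] ! k) (sym_prod (omit k (vs[j := v]))))" if k: "k < length vs" for k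
  proof (cases "j = k")
    case True
    then show ?thesis using j by (simp add: omit_update cbilinear_clinear(2)[OF H])
  next
    case False
    then have "(if j < k then j else j - 1) < length (omit k vs)"
      using j k by (auto simp: length_omit)
    from clinear_compose[OF cbilinear_clinear(1)[OF H] multilinearD[OF multilinear_sym_prod this]]
    show ?thesis using False by (simp add: omit_update)
  qed
  then show "clinear (\<lambda>v. sym_contraction s H (vs[j := v]))"
    unfolding sym_contraction_def length_list_update by (intro clinear_sum clinear_scaled) simp
qed

text \<open>The summands of both sides correspond under the transposition of the two positions. If
  \<open>u\<close> and \<open>v\<close> both remain in the product, the sign comes from graded
  symmetry of \<open>sym_prod\<close>; if one of them is taken out, it comes from the weights
  \<open>s\<close> and \<open>s'\<close>.\<close>

lemma sym_contraction_swap: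
  fixes H :: "'v::graded_complex_vector \<Rightarrow> 'v symmetric_algebra \<Rightarrow> 'w::complex_vector"
  assumes H: "cbilinear H"
    and h: "homogeneous_list ds xs" "homogeneous_list es ys" "homogeneous d u" "homogeneous e v"
    and s: "\<And>k. k \<noteq> length ds \<Longrightarrow> k \<noteq> Suc (length ds) \<Longrightarrow> s k = s' k"
      "s (length ds) = parity_sign d e * s' (Suc (length ds))"
      "s (Suc (length ds)) = parity_sign d e * s' (length ds)"
  shows "sym_contraction s H (xs @ u # v # ys) = parity_sign d e *\<^sub>C sym_contraction s' H (xs @ v # u # ys)"
proof -
  let ?n = "length xs" and ?vs = "xs @ u # v # ys" and ?ws = "xs @ v # u # ys"
  define t where "t = Transposition.transpose ?n (Suc ?n)"
  have len: "length ds = ?n" using h by (simp add: homogeneous_list_length)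
  have *: "s k *\<^sub>C H (?vs ! k) (sym_prod (omit k ?vs)) =
      parity_sign d e *\<^sub>C s' (t k) *\<^sub>C H (?ws ! t k) (sym_prod (omit (t k) ?ws))"
    if k: "k < length ?vs" for k
  proof -
    consider "k < ?n" | "k = ?n" | "k = Suc ?n" | i where "k = Suc (Suc (?n + i))"
      by (metis add_Suc_right less_imp_Suc_add linorder_neqE_nat Suc_lessI)
    then show ?thesis
    proof cases
      case 1
      then have tk: "t k = k" by (simp add: t_def)
      have "sym_prod (omit k xs @ u # v # ys) = parity_sign d e *\<^sub>C sym_prod (omit k xs @ v # u # ys)"
        by (rule graded_symmetricD[OF graded_symmetric_sym_prod homogeneous_list_omit[OF h(1)] h(2-4)])
      then show ?thesis
        using 1 s(1)[of k] len
        by (simp add: tk nth_append omit_append cbilinearD(4)[OF H] complex_vector.scale_left_commute)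
    next
      case 2
      then show ?thesis
        using s(2) len by (simp add: t_def nth_append omit_append omit_Cons scaleC_scaleC)
    next
      case 3
      then show ?thesis
        using s(3) len by (simp add: t_def nth_append omit_append omit_Cons scaleC_scaleC)
    next
      case 4
      then have tk: "t k = k" by (simp add: t_def)
      have "sym_prod (xs @ u # v # omit i ys) = parity_sign d e *\<^sub>C sym_prod (xs @ v # u # omit i ys)"
        by (rule graded_symmetricD[OF graded_symmetric_sym_prod h(1) homogeneous_list_omit[OF h(2)] h(3,4)])
      then show ?thesis
        using 4 s(1)[of k] len
        by (simp add: tk[unfolded 4] nth_append omit_append omit_Cons cbilinearD(4)[OF H] complex_vector.scale_left_commute)
    qed
  qed
  have "sym_contraction s H ?vs =
      (\<Sum>k<length ?vs. parity_sign d e *\<^sub>C s' (t k) *\<^sub>C H (?ws ! t k) (sym_prod (omit (t k) ?ws)))"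
    unfolding sym_contraction_def by (intro sum.cong refl *) simp
  also have "\<dots> = (\<Sum>k<length ?ws. parity_sign d e *\<^sub>C s' k *\<^sub>C H (?ws ! k) (sym_prod (omit k ?ws)))"
    by (rule sum.reindex_bij_witness[of _ t t]) (auto simp: t_def Transposition.transpose_def)
  finally show ?thesis
    by (simp only: sym_contraction_def complex_vector.scale_sum_right)
qed

text \<open>An entry leaves the left list at its right end, so its sign counts the odd entries
  behind it. Only the two exchanged entries see a different count, as each gains or loses the
  other.\<close>

lemma left_sign_swap:
  "k \<noteq> length ds \<Longrightarrow> k \<noteq> Suc (length ds) \<Longrightarrow> left_sign (ds @ d # e # es) k = left_sign (ds @ e # d # es) k"
  "left_sign (ds @ d # e # es) (length ds) = parity_sign d e * left_sign (ds @ e # d # es) (Suc (length ds))"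
  "left_sign (ds @ d # e # es) (Suc (length ds)) = parity_sign d e * left_sign (ds @ e # d # es) (length ds)"
proof -
  assume k: "k \<noteq> length ds" "k \<noteq> Suc (length ds)"
  then consider "k < length ds" | i where "k = Suc (Suc (length ds + i))"
    by (metis add_Suc_right less_imp_Suc_add linorder_neqE_nat Suc_lessI)
  then show "left_sign (ds @ d # e # es) k = left_sign (ds @ e # d # es) k"
    by cases (auto simp: left_sign_def nth_append numeral_3_eq_3)
qed (auto simp: left_sign_def nth_append parity_sign_def)

lemma right_sign_swap:
  "k \<noteq> length ds \<Longrightarrow> k \<noteq> Suc (length ds) \<Longrightarrow> right_sign (ds @ d # e # es) k = right_sign (ds @ e # d # es) k"
  "right_sign (ds @ d # e # es) (length ds) = parity_sign d e * right_sign (ds @ e # d # es) (Suc (length ds))"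
  "right_sign (ds @ d # e # es) (Suc (length ds)) = parity_sign d e * right_sign (ds @ e # d # es) (length ds)"
proof -
  assume k: "k \<noteq> length ds" "k \<noteq> Suc (length ds)"
  then consider "k < length ds" | i where "k = Suc (Suc (length ds + i))"
    by (metis add_Suc_right less_imp_Suc_add linorder_neqE_nat Suc_lessI)
  then show "right_sign (ds @ d # e # es) k = right_sign (ds @ e # d # es) k"
    by cases (auto simp: right_sign_def nth_append numeral_3_eq_3)
qed (auto simp: right_sign_def nth_append parity_sign_def)

context
  fixes \<Lambda> :: "'v::graded_complex_vector \<Rightarrow> 'v \<Rightarrow> complex"
  assumes \<Lambda>: "cbilinear \<Lambda>"
begin

lemma P_op_exists:
  "\<exists>F. clinear F \<and> (\<forall>ds vs es ws. homogeneous_list ds vs \<longrightarrow> homogeneous_list es ws \<longrightarrow>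
      F (sym_prod vs \<otimes>\<^sub>C sym_prod ws) = (\<Sum>k<length vs. \<Sum>l<length ws.
          (contraction_sign ds es k l * \<Lambda> (vs ! k) (ws ! l)) *\<^sub>C
            (sym_prod (omit k vs) \<otimes>\<^sub>C sym_prod (omit l ws))))"
proof -
  define g where "g ds es vs ws = (\<Sum>k<length vs. \<Sum>l<length ws.
          (contraction_sign ds es k l * \<Lambda> (vs ! k) (ws ! l)) *\<^sub>C
            (sym_prod (omit k vs) \<otimes>\<^sub>C sym_prod (omit l ws)))" for ds es and vs ws :: "'v list"
  \<comment> \<open>\<open>H\<close> is the contraction with the right list held fixed,
    \<open>H'\<close> the one with the left list held fixed; \<open>g\<close> is a
    \<open>sym_contraction\<close> of either.\<close>
  define H where "H es ws v a = (\<Sum>l<length ws. (right_sign es l * \<Lambda> v (ws ! l)) *\<^sub>C (a \<otimes>\<^sub>C sym_prod (omit l ws)))"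
    for es and ws :: "'v list" and v and a :: "'v symmetric_algebra"
  define H' where "H' ds vs w b = (\<Sum>k<length vs. (left_sign ds k * \<Lambda> (vs ! k) w) *\<^sub>C (sym_prod (omit k vs) \<otimes>\<^sub>C b))"
    for ds and vs :: "'v list" and w and b :: "'v symmetric_algebra"
  have H: "cbilinear (H es ws)" for es ws
    unfolding H_def
    by (rule cbilinearI)
      (simp_all add: cbilinearD[OF \<Lambda>] tensor_of_linear scaleC_complex_def algebra_simps scaleC_add_left
        scaleC_add_right scaleC_scaleC sum.distrib complex_vector.scale_sum_right)
  have H': "cbilinear (H' ds vs)" for ds vs
    unfolding H'_def
    by (rule cbilinearI)
      (simp_all add: cbilinearD[OF \<Lambda>] tensor_of_linear scaleC_complex_def algebra_simps scaleC_add_left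
        scaleC_add_right scaleC_scaleC sum.distrib complex_vector.scale_sum_right)
  have g1: "g ds es vs ws = sym_contraction (left_sign ds) (H es ws) vs" for ds es vs ws
    by (simp add: g_def sym_contraction_def H_def complex_vector.scale_sum_right scaleC_scaleC
        contraction_sign_eq mult.assoc)
  have g2: "g ds es vs ws = sym_contraction (right_sign es) (H' ds vs) ws" for ds es vs ws
    unfolding g_def
    by (subst sum.swap) (simp add: sym_contraction_def H'_def complex_vector.scale_sum_right scaleC_scaleC
        contraction_sign_eq mult.assoc mult.left_commute[of "left_sign _ _"])
  show ?thesis
    unfolding g_def[symmetric]
  proof (rule homogeneous_sym_pair_lift[of g])
    show "multilinear (\<lambda>vs. g ds es vs ws)" for ds es ws
      unfolding g1 by (rule multilinear_sym_contraction[OF H])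
    show "multilinear (g ds es vs)" for ds es vs
      unfolding g2 by (rule multilinear_sym_contraction[OF H'])
    fix ds es fs d e and xs ys zs :: "'v list" and u v :: 'v
    assume h: "homogeneous_list ds xs" "homogeneous_list es ys" "homogeneous d u" "homogeneous e v"
    show "g (ds @ d # e # es) fs (xs @ u # v # ys) zs = parity_sign d e *\<^sub>C g (ds @ e # d # es) fs (xs @ v # u # ys) zs"
      unfolding g1 by (rule sym_contraction_swap[OF H h left_sign_swap])
    show "g fs (ds @ d # e # es) zs (xs @ u # v # ys) = parity_sign d e *\<^sub>C g fs (ds @ e # d # es) zs (xs @ v # u # ys)"
      unfolding g2 by (rule sym_contraction_swap[OF H' h right_sign_swap])
  qed
qed

lemma P_op:
  shows clinear_P_op: "clinear (P_op \<Lambda>)"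
    and P_op_sym_prod: "homogeneous_list ds vs \<Longrightarrow> homogeneous_list es ws \<Longrightarrow>
      P_op \<Lambda> (sym_prod vs \<otimes>\<^sub>C sym_prod ws) = (\<Sum>k<length vs. \<Sum>l<length ws.
          (contraction_sign ds es k l * \<Lambda> (vs ! k) (ws ! l)) *\<^sub>C
            (sym_prod (omit k vs) \<otimes>\<^sub>C sym_prod (omit l ws)))"
proof -
  from P_op_exists obtain F where F: "clinear F"
    "\<And>ds es vs ws. homogeneous_list ds vs \<Longrightarrow> homogeneous_list es ws \<Longrightarrow>
      F (sym_prod vs \<otimes>\<^sub>C sym_prod ws) = (\<Sum>k<length vs. \<Sum>l<length ws.
          (contraction_sign ds es k l * \<Lambda> (vs ! k) (ws ! l)) *\<^sub>C
            (sym_prod (omit k vs) \<otimes>\<^sub>C sym_prod (omit l ws)))"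
    by blast
  have "P_op \<Lambda> = F"
    unfolding P_op_def
  proof (rule the_equality)
    fix G :: "('v symmetric_algebra, 'v symmetric_algebra) tensor_pair
      \<Rightarrow> ('v symmetric_algebra, 'v symmetric_algebra) tensor_pair"
    assume G: "clinear G \<and> (\<forall>ds vs es ws. homogeneous_list ds vs \<longrightarrow> homogeneous_list es ws \<longrightarrow>
      G (sym_prod vs \<otimes>\<^sub>C sym_prod ws) = (\<Sum>k<length vs. \<Sum>l<length ws.
          (contraction_sign ds es k l * \<Lambda> (vs ! k) (ws ! l)) *\<^sub>C
            (sym_prod (omit k vs) \<otimes>\<^sub>C sym_prod (omit l ws))))"
    show "G = F"
    proof
      fix x show "G x = F x"
      proof (induction x rule: sym_pair_induct)
        case (sym_prod ds es vs ws)
        then show ?case using G[THEN conjunct2, rule_format, OF sym_prod] F(2)[OF sym_prod] by simp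
      qed (use G F(1) in \<open>simp_all add: clinear_add clinear_scale\<close>)
    qed
  qed (use F in simp)
  with F show "clinear (P_op \<Lambda>)" "homogeneous_list ds vs \<Longrightarrow> homogeneous_list es ws \<Longrightarrow>
      P_op \<Lambda> (sym_prod vs \<otimes>\<^sub>C sym_prod ws) = (\<Sum>k<length vs. \<Sum>l<length ws.
          (contraction_sign ds es k l * \<Lambda> (vs ! k) (ws ! l)) *\<^sub>C
            (sym_prod (omit k vs) \<otimes>\<^sub>C sym_prod (omit l ws)))"
    by simp_all
qed

lemma clinear_P_op_power: "clinear (P_op \<Lambda> ^^ k)"
  by (induction k) (simp_all add: clinearI clinear_compose[OF clinear_P_op] comp_def)

text \<open>Every contraction takes one entry from the left list, so after \<open>length vs\<close>
  of them nothing is left to contract.\<close>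

lemma P_op_power_sym_prod_zero:
  "homogeneous_list ds vs \<Longrightarrow> homogeneous_list es ws \<Longrightarrow> length vs < k \<Longrightarrow>
    (P_op \<Lambda> ^^ k) (sym_prod vs \<otimes>\<^sub>C sym_prod ws) = 0"
proof (induction k arbitrary: ds vs es ws)
  case (Suc k)
  have "(P_op \<Lambda> ^^ k) (sym_prod (omit i vs) \<otimes>\<^sub>C sym_prod (omit j ws)) = 0" if "i < length vs" for i j
    by (rule Suc.IH[OF homogeneous_list_omit[OF Suc.prems(1)] homogeneous_list_omit[OF Suc.prems(2)]])
      (use that Suc.prems(3) in \<open>simp add: length_omit\<close>)
  then show ?case
    unfolding funpow_Suc_right comp_def P_op_sym_prod[OF Suc.prems(1,2)]
    by (simp add: clinear_sum_distrib[OF clinear_P_op_power] clinear_scale[OF clinear_P_op_power])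
qed simp

lemma P_op_power_zero: "\<exists>N. \<forall>k\<ge>N. (P_op \<Lambda> ^^ k) x = 0"
proof (induction x rule: sym_pair_induct)
  case (sym_prod ds es vs ws)
  then show ?case
    by (intro exI[of _ "Suc (length vs)"]) (auto intro: P_op_power_sym_prod_zero)
next
  case (add x y)
  then obtain M N where "\<forall>k\<ge>M. (P_op \<Lambda> ^^ k) x = 0" "\<forall>k\<ge>N. (P_op \<Lambda> ^^ k) y = 0"
    by blast
  then show ?case
    by (intro exI[of _ "max M N"]) (simp add: clinear_add[OF clinear_P_op_power])
next
  case (scale c x)
  then show ?case by (auto simp: clinear_scale[OF clinear_P_op_power])
qed

text \<open>Any bound beyond which the powers vanish may serve as cut-off, so several star products
  can be compared over one common range.\<close>

lemma star_product_eq: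
  assumes "\<And>k. k \<ge> N \<Longrightarrow> (P_op \<Lambda> ^^ k) (a \<otimes>\<^sub>C b) = 0"
  shows "star_product z \<Lambda> a b = (\<Sum>k<N. (z ^ k / fact k) *\<^sub>C sym_mu ((P_op \<Lambda> ^^ k) (a \<otimes>\<^sub>C b)))"
proof -
  have "(z ^ k / fact k) *\<^sub>C sym_mu ((P_op \<Lambda> ^^ k) (a \<otimes>\<^sub>C b)) = 0" if "k \<ge> N" for k
    by (simp add: assms[OF that] clinear_zero[OF clinear_sym_mu])
  then have "{k. (z ^ k / fact k) *\<^sub>C sym_mu ((P_op \<Lambda> ^^ k) (a \<otimes>\<^sub>C b)) \<noteq> 0} \<subseteq> {..<N}"
    by (metis (mono_tags, lifting) lessThan_iff mem_Collect_eq not_le subsetI)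
  then show ?thesis
    unfolding star_product_def by (rule Sum_any.expand_superset[rotated]) simp
qed

lemma cbilinear_star_product: "cbilinear (star_product z \<Lambda>)"
proof (rule cbilinearI)
  fix a a' b b' :: "'v symmetric_algebra" and c
  note lin = clinear_simps[OF clinear_P_op_power]
    clinear_simps[OF clinear_sym_mu] tensor_of_linear
  obtain L where L: "\<And>k. k \<ge> L \<Longrightarrow> (P_op \<Lambda> ^^ k) (a \<otimes>\<^sub>C b) = 0" using P_op_power_zero by blast
  obtain M where M: "\<And>k. k \<ge> M \<Longrightarrow> (P_op \<Lambda> ^^ k) (a' \<otimes>\<^sub>C b) = 0" using P_op_power_zero by blast
  obtain N where N: "\<And>k. k \<ge> N \<Longrightarrow> (P_op \<Lambda> ^^ k) (a \<otimes>\<^sub>C b') = 0" using P_op_power_zero by blast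
  show "star_product z \<Lambda> (a + a') b = star_product z \<Lambda> a b + star_product z \<Lambda> a' b"
    using L M by (simp add: star_product_eq[where N="max L M"] lin scaleC_add_right sum.distrib)
  show "star_product z \<Lambda> a (b + b') = star_product z \<Lambda> a b + star_product z \<Lambda> a b'"
    using L N by (simp add: star_product_eq[where N="max L N"] lin scaleC_add_right sum.distrib)
  show "star_product z \<Lambda> (c *\<^sub>C a) b = c *\<^sub>C star_product z \<Lambda> a b"
    using L by (simp add: star_product_eq[where N=L] lin complex_vector.scale_sum_right
        complex_vector.scale_left_commute mult.commute)
  show "star_product z \<Lambda> a (c *\<^sub>C b) = c *\<^sub>C star_product z \<Lambda> a b"
    using L by (simp add: star_product_eq[where N=L] lin complex_vector.scale_sum_right
        complex_vector.scale_left_commute mult.commute)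
qed

lemma star_product_generators:
  assumes "homogeneous d v" "homogeneous e w"
  shows "star_product z \<Lambda> (sym_prod [v]) (sym_prod [w]) = sym_prod [v, w] + (z * \<Lambda> v w) *\<^sub>C sym_prod []"
proof -
  have h: "homogeneous_list [d] [v]" "homogeneous_list [e] [w]"
    using assms by (simp_all add: homogeneous_list_def)
  \<comment> \<open>Two factors of degree one allow at most one contraction, hence the cut-off
    \<open>2\<close>.\<close>
  have "star_product z \<Lambda> (sym_prod [v]) (sym_prod [w]) =
      (\<Sum>k<Suc (Suc 0). (z ^ k / fact k) *\<^sub>C sym_mu ((P_op \<Lambda> ^^ k) (sym_prod [v] \<otimes>\<^sub>C sym_prod [w])))"
    by (rule star_product_eq) (rule P_op_power_sym_prod_zero[OF h], simp)
  also have "\<dots> = sym_prod [v, w] + (z * \<Lambda> v w) *\<^sub>C sym_prod []"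
    by (simp add: P_op_sym_prod[OF h] sym_mu_sym_prod clinear_scale[OF clinear_sym_mu] omit_def scaleC_one
        scaleC_scaleC contraction_sign_def)
  finally show ?thesis .
qed

end

lemma cbilinear_scaled: "cbilinear \<Lambda> \<Longrightarrow> cbilinear (\<lambda>v w. c * \<Lambda> v w)"
  for \<Lambda> :: "'v::complex_vector \<Rightarrow> 'u::complex_vector \<Rightarrow> complex"
  by (rule cbilinearI) (simp_all add: cbilinearD[of \<Lambda>] scaleC_complex_def algebra_simps)

lemma P_op_scaled:
  assumes "cbilinear \<Lambda>"
  shows "P_op (\<lambda>v w. c * \<Lambda> v w) x = c *\<^sub>C P_op \<Lambda> x"
proof (induction x rule: sym_pair_induct)
  case (sym_prod ds es vs ws)
  show ?case
    unfolding P_op_sym_prod[OF cbilinear_scaled[OF assms] sym_prod] P_op_sym_prod[OF assms sym_prod]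
    by (simp add: complex_vector.scale_sum_right scaleC_scaleC mult.left_commute)
qed (simp_all add: clinear_simps[OF clinear_P_op[OF cbilinear_scaled[OF assms]]] clinear_simps[OF clinear_P_op[OF assms]] scaleC_add_right complex_vector.scale_left_commute)

text \<open>\<open>P_op\<close> is linear in the form, so a factor \<open>c\<close> of the form
  enters the \<open>k\<close>-th term as \<open>c ^ k\<close>, just as \<open>z\<close> does.
  Thereby the sign of the conjugated parameter can cancel the sign of the conjugated form.\<close>

lemma star_product_scaled:
  assumes "cbilinear \<Lambda>"
  shows "star_product z (\<lambda>v w. c * \<Lambda> v w) a b = star_product (z * c) \<Lambda> a b"
proof -
  have "(P_op (\<lambda>v w. c * \<Lambda> v w) ^^ k) x = c ^ k *\<^sub>C (P_op \<Lambda> ^^ k) x" for k x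
    by (induction k)
      (simp_all add: scaleC_one P_op_scaled[OF assms] clinear_scale[OF clinear_P_op[OF assms]] scaleC_scaleC)
  then show ?thesis
    by (simp add: star_product_def clinear_scale[OF clinear_sym_mu] scaleC_scaleC power_mult_distrib)
qed

section \<open>Conjugation and graded flip of contractions\<close>

lemma cbilinear_conj_form: "cbilinear \<Lambda> \<Longrightarrow> cbilinear (conj_form \<Lambda>)"
  by (rule cbilinearI)
    (simp_all add: conj_form_def cbilinearD[of \<Lambda>] conj_vec_add conj_vec_scaleC scaleC_complex_def)

text \<open>The signs are real, and \<open>conj_form \<Lambda>\<close> at conjugated vectors is the
  conjugate of \<open>\<Lambda>\<close> at the original ones.\<close>

lemma pair_conj_P_op:
  assumes "cbilinear \<Lambda>"
  shows "pair_conj (P_op \<Lambda> x) = P_op (conj_form \<Lambda>) (pair_conj x)"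
proof (induction x rule: sym_pair_induct)
  case (sym_prod ds es vs ws)
  note h = sym_prod[THEN homogeneous_list_conj_vec]
  have "cnj (contraction_sign ds es k l) = contraction_sign ds es k l" for k l
    by (simp add: contraction_sign_def)
  then show ?case
    by (simp add: P_op_sym_prod[OF assms sym_prod] P_op_sym_prod[OF cbilinear_conj_form[OF assms] h] pair_conj
        pair_conj_sum sym_conj_sym_prod map_omit) (simp add: conj_form_def conj_vec_conj_vec)
qed (simp_all add: pair_conj clinear_simps[OF clinear_P_op[OF assms]]
    clinear_simps[OF clinear_P_op[OF cbilinear_conj_form[OF assms]]])

lemma sym_conj_star_product:
  assumes "cbilinear \<Lambda>"
  shows "sym_conj (star_product z \<Lambda> a b) = star_product (cnj z) (conj_form \<Lambda>) (sym_conj a) (sym_conj b)"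
proof -
  have P: "pair_conj ((P_op \<Lambda> ^^ k) x) = (P_op (conj_form \<Lambda>) ^^ k) (pair_conj x)" for k x
    by (induction k) (simp_all add: pair_conj_P_op[OF assms])
  obtain N where N: "\<And>k. k \<ge> N \<Longrightarrow> (P_op \<Lambda> ^^ k) (a \<otimes>\<^sub>C b) = 0"
    using P_op_power_zero[OF assms] by blast
  have N': "(P_op (conj_form \<Lambda>) ^^ k) (sym_conj a \<otimes>\<^sub>C sym_conj b) = 0" if "k \<ge> N" for k
    using N[OF that] P[of k "a \<otimes>\<^sub>C b"] by (simp add: pair_conj_tensor_of pair_conj_zero)
  show ?thesis
    by (simp add: star_product_eq[OF assms N] star_product_eq[OF cbilinear_conj_form[OF assms] N']
        sym_conj_sum sym_conj_scaleC sym_conj_sym_mu P pair_conj_tensor_of)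
qed

section \<open>The graded flip\<close>

lemma parity_part_False_True: "parity_part False v + parity_part True v = (v :: 'v::graded_ab_group)"
  by (simp add: parity_part_def)

lemma cbilinear_flip_form: "cbilinear \<Lambda> \<Longrightarrow> cbilinear (flip_form \<Lambda>)"
  by (rule cbilinearI)
    (simp_all add: flip_form_def cbilinearD[of \<Lambda>] parity_part_add parity_part_scaleC scaleC_complex_def
      UNIV_bool algebra_simps)

lemma flip_form_homogeneous:
  assumes "cbilinear \<Lambda>" "homogeneous d v" "homogeneous e w"
  shows "flip_form \<Lambda> v w = parity_sign d e * \<Lambda> w v"
  using assms(2,3)
  by (cases d; cases e)
    (simp_all add: flip_form_def UNIV_bool parity_part_homogeneous[of _ v] parity_part_homogeneous[of _ w]
      cbilinear_zero[OF assms(1)])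

definition list_parity :: "bool list \<Rightarrow> bool"
  where "list_parity es = odd (length (filter id es))"

lemma list_parity_simps:
  "\<not> list_parity []" "list_parity (e # es) \<longleftrightarrow> e \<noteq> list_parity es"
  "list_parity (ds @ es) \<longleftrightarrow> list_parity ds \<noteq> list_parity es"
  by (auto simp: list_parity_def)

lemma minus_one_power_list_parity:
  "(-1) ^ (of_bool d * length (filter id es)) = parity_sign d (list_parity es)"
  by (cases d) (auto simp: parity_sign_def list_parity_def)

text \<open>The flip is prescribed on products of homogeneous vectors only. That a linear map
  realizes the prescription is shown next; since these products span, the choice is in fact
  unique.\<close>

definition pair_flip ::
    "('v::graded_complex_vector symmetric_algebra, 'v symmetric_algebra) tensor_pair \<Rightarrow>
      ('v symmetric_algebra, 'v symmetric_algebra) tensor_pair"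
  where "pair_flip = (SOME F. clinear F \<and> (\<forall>ds vs es ws. homogeneous_list ds vs \<longrightarrow> homogeneous_list es ws \<longrightarrow>
    F (sym_prod vs \<otimes>\<^sub>C sym_prod ws) =
      parity_sign (list_parity ds) (list_parity es) *\<^sub>C (sym_prod ws \<otimes>\<^sub>C sym_prod vs)))"

lemma pair_flip:
  fixes vs ws :: "'v::graded_complex_vector list"
  shows clinear_pair_flip: "clinear (pair_flip :: ('v symmetric_algebra, 'v symmetric_algebra) tensor_pair \<Rightarrow> _)"
    and pair_flip_sym_prod: "homogeneous_list ds vs \<Longrightarrow> homogeneous_list es ws \<Longrightarrow>
      pair_flip (sym_prod vs \<otimes>\<^sub>C sym_prod ws) =
        parity_sign (list_parity ds) (list_parity es) *\<^sub>C (sym_prod ws \<otimes>\<^sub>C sym_prod vs)"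
proof -
  define g where "g ds es vs ws = parity_sign (list_parity ds) (list_parity es) *\<^sub>C (sym_prod ws \<otimes>\<^sub>C sym_prod vs)"
    for ds es and vs ws :: "'v list"
  have swap: "list_parity (ds @ d # e # es) = list_parity (ds @ e # d # es)" for ds es d e
    by (auto simp: list_parity_simps)
  have "\<exists>F. clinear F \<and> (\<forall>ds vs es ws. homogeneous_list ds vs \<longrightarrow> homogeneous_list es ws \<longrightarrow>
    F (sym_prod vs \<otimes>\<^sub>C sym_prod ws) = g ds es vs ws)"
  proof (rule homogeneous_sym_pair_lift[of g])
    show "multilinear (\<lambda>vs. g ds es vs ws)" "multilinear (g ds es vs)" for ds es vs ws
      unfolding g_def
      by (intro multilinear_scale multilinear_compose[OF _ multilinear_sym_prod]
          cbilinear_clinear[OF cbilinear_tensor_of])+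
    fix ds es fs d e and xs ys zs :: "'v list" and u v :: 'v
    assume "homogeneous_list ds xs" "homogeneous_list es ys" "homogeneous d u" "homogeneous e v"
    note h = graded_symmetricD[OF graded_symmetric_sym_prod this]
    show "g (ds @ d # e # es) fs (xs @ u # v # ys) zs = parity_sign d e *\<^sub>C g (ds @ e # d # es) fs (xs @ v # u # ys) zs"
      "g fs (ds @ d # e # es) zs (xs @ u # v # ys) = parity_sign d e *\<^sub>C g fs (ds @ e # d # es) zs (xs @ v # u # ys)"
      by (simp_all only: g_def h swap[of ds d e es] tensor_of_linear complex_vector.scale_left_commute)
  qed
  from someI_ex[OF this, unfolded g_def] show "clinear (pair_flip :: ('v symmetric_algebra, _) tensor_pair \<Rightarrow> _)"
    "homogeneous_list ds vs \<Longrightarrow> homogeneous_list es ws \<Longrightarrow>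
      pair_flip (sym_prod vs \<otimes>\<^sub>C sym_prod ws) =
        parity_sign (list_parity ds) (list_parity es) *\<^sub>C (sym_prod ws \<otimes>\<^sub>C sym_prod (vs :: 'v list))"
    unfolding pair_flip_def by blast+
qed

lemma list_parity_omit: "k < length es \<Longrightarrow> list_parity (omit k es) \<longleftrightarrow> list_parity es \<noteq> es ! k"
  using id_take_nth_drop[of k es]
  by (metis list_parity_simps(2,3) omit_def)

lemma list_parity_split:
  "k < length es \<Longrightarrow> list_parity es \<longleftrightarrow> (list_parity (take k es) \<noteq> (es ! k \<noteq> list_parity (drop (Suc k) es)))"
  using id_take_nth_drop[of k es]
  by (metis list_parity_simps(2,3))

text \<open>Contracted entries of different parity contribute \<open>0\<close> on both sides since
  \<open>\<Lambda>\<close> is even. For odd contracted entries the sign exponents differ by the odd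
  entries around them plus all odd entries of both lists; in each list the total exceeds the
  surroundings by one, so the difference is even.\<close>

lemma pair_flip_P_op:
  assumes b: "cbilinear \<Lambda>" and ev: "even_form \<Lambda>"
  shows "P_op \<Lambda> (pair_flip x) = pair_flip (P_op (flip_form \<Lambda>) x)"
proof (induction x rule: sym_pair_induct)
  case (sym_prod ds es vs ws)
  note hds = sym_prod(1) and hes = sym_prod(2)
  have len: "length ds = length vs" "length es = length ws"
    using sym_prod by (simp_all add: homogeneous_list_length)
  have "(parity_sign (list_parity ds) (list_parity es) * (contraction_sign es ds l k * \<Lambda> (ws ! l) (vs ! k))) =
      (contraction_sign ds es k l * flip_form \<Lambda> (vs ! k) (ws ! l)) *
        parity_sign (list_parity (omit k ds)) (list_parity (omit l es))"
    if kl: "k < length vs" "l < length ws" for k l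
  proof -
    note h = homogeneous_list_nth[OF hds kl(1)] homogeneous_list_nth[OF hes kl(2)]
    show ?thesis
    proof (cases "ds ! k = es ! l")
      case False
      then have "\<Lambda> (ws ! l) (vs ! k) = 0"
        using ev h unfolding even_form_def by metis
      then show ?thesis by (simp add: flip_form_homogeneous[OF b h])
    next
      case True
      have k: "k < length ds" "l < length es" using kl len by simp_all
      show ?thesis
        using True
        by (simp add: flip_form_homogeneous[OF b h] contraction_sign_def power_add minus_one_power_list_parity
            list_parity_omit[OF k(1)] list_parity_omit[OF k(2)] list_parity_split[OF k(1)]
            list_parity_split[OF k(2)])
          (auto simp: parity_sign_def)
    qed
  qed
  note * = this
  have "P_op \<Lambda> (pair_flip (sym_prod vs \<otimes>\<^sub>C sym_prod ws)) =
      (\<Sum>l<length ws. \<Sum>k<length vs.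
        (parity_sign (list_parity ds) (list_parity es) * (contraction_sign es ds l k * \<Lambda> (ws ! l) (vs ! k))) *\<^sub>C
          (sym_prod (omit l ws) \<otimes>\<^sub>C sym_prod (omit k vs)))"
    by (simp add: pair_flip_sym_prod[OF sym_prod] clinear_scale[OF clinear_P_op[OF b]]
        P_op_sym_prod[OF b hes hds] complex_vector.scale_sum_right scaleC_scaleC)
  also have "\<dots> = (\<Sum>k<length vs. \<Sum>l<length ws.
        (contraction_sign ds es k l * flip_form \<Lambda> (vs ! k) (ws ! l)) *\<^sub>C
          parity_sign (list_parity (omit k ds)) (list_parity (omit l es)) *\<^sub>C
          (sym_prod (omit l ws) \<otimes>\<^sub>C sym_prod (omit k vs)))"
    by (subst sum.swap) (simp add: * scaleC_scaleC)
  also have "\<dots> = pair_flip (P_op (flip_form \<Lambda>) (sym_prod vs \<otimes>\<^sub>C sym_prod ws))"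
    by (simp add: P_op_sym_prod[OF cbilinear_flip_form[OF b] sym_prod] clinear_sum_distrib[OF clinear_pair_flip]
        clinear_scale[OF clinear_pair_flip] pair_flip_sym_prod[OF homogeneous_list_omit[OF hds] homogeneous_list_omit[OF hes]])
  finally show ?case .
qed (simp_all add: clinear_simps[OF clinear_pair_flip]
    clinear_simps[OF clinear_P_op[OF b]]
    clinear_simps[OF clinear_P_op[OF cbilinear_flip_form[OF b]]])

section \<open>Graded commutativity of the product\<close>

lemma sym_prod_move:
  assumes "homogeneous_list ds xs" "homogeneous d u"
  shows "homogeneous_list es ys \<Longrightarrow> homogeneous_list fs zs \<Longrightarrow>
    sym_prod (xs @ u # ys @ zs) = parity_sign d (list_parity es) *\<^sub>C sym_prod (xs @ ys @ u # zs)"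
  using assms(1)
proof (induction ys arbitrary: xs ds es)
  case Nil
  then show ?case
    using homogeneous_list_length[OF Nil(1)] by (simp add: parity_sign_def list_parity_simps scaleC_one)
next
  case (Cons y ys)
  obtain e es' where es: "es = e # es'"
    using homogeneous_list_length[OF Cons.prems(1)] by (cases es) auto
  have h: "homogeneous e y" "homogeneous_list es' ys"
    using Cons.prems(1) by (simp_all add: es homogeneous_list_Cons)
  have "homogeneous_list (es' @ fs) (ys @ zs)"
    using h Cons.prems by (simp add: homogeneous_list_append homogeneous_list_length)
  then have "sym_prod (xs @ u # y # (ys @ zs)) = parity_sign d e *\<^sub>C sym_prod (xs @ y # u # (ys @ zs))"
    by (rule graded_symmetricD[OF graded_symmetric_sym_prod Cons.prems(3) _ assms(2) h(1)])
  also have "sym_prod (xs @ y # u # (ys @ zs)) = parity_sign d (list_parity es') *\<^sub>C sym_prod ((xs @ [y]) @ ys @ u # zs)"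
    using Cons.IH[of es' "ds @ [e]" "xs @ [y]"] h Cons.prems
    by (simp add: homogeneous_list_append homogeneous_list_length homogeneous_list_Cons homogeneous_list_Nil)
  finally show ?case
    by (simp add: es scaleC_scaleC list_parity_simps) (simp add: parity_sign_def)
qed

text \<open>The block \<open>vs\<close> is moved past \<open>ws\<close> one vector at a time,
  beginning with its last one; \<open>us\<close> collects the vectors that have already
  passed.\<close>

lemma sym_prod_commute:
  assumes "homogeneous_list es ws"
  shows "homogeneous_list ds vs \<Longrightarrow> homogeneous_list fs us \<Longrightarrow>
    sym_prod (vs @ ws @ us) = parity_sign (list_parity ds) (list_parity es) *\<^sub>C sym_prod (ws @ vs @ us)"
proof (induction vs arbitrary: ds us fs rule: rev_induct)
  case Nil
  then show ?case
    using homogeneous_list_length[OF Nil(1)] by (simp add: parity_sign_def list_parity_simps scaleC_one)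
next
  case (snoc v vs)
  obtain d ds' where ds: "ds = ds' @ [d]"
    using homogeneous_list_length[OF snoc.prems(1)] by (cases ds rule: rev_cases) auto
  have h: "homogeneous d v" "homogeneous_list ds' vs"
    using snoc.prems(1) homogeneous_list_length[OF snoc.prems(1)]
    by (simp_all add: ds homogeneous_list_append homogeneous_list_Cons)
  have "sym_prod (vs @ v # ws @ us) = parity_sign d (list_parity es) *\<^sub>C sym_prod (vs @ ws @ v # us)"
    by (rule sym_prod_move[OF h(2,1) assms snoc.prems(2)])
  also have "sym_prod (vs @ ws @ v # us) =
      parity_sign (list_parity ds') (list_parity es) *\<^sub>C sym_prod (ws @ vs @ v # us)"
    by (rule snoc.IH[OF h(2), of "d # fs"]) (use h snoc.prems in \<open>simp add: homogeneous_list_Cons\<close>)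
  finally show ?case
    by (simp add: ds scaleC_scaleC list_parity_simps) (simp add: parity_sign_def)
qed

lemma sym_mu_pair_flip: "sym_mu (pair_flip x) = sym_mu x"
proof (induction x rule: sym_pair_induct)
  case (sym_prod ds es vs ws)
  show ?case
    using sym_prod_commute[OF sym_prod(2,1) homogeneous_list_Nil]
    by (simp add: pair_flip_sym_prod[OF sym_prod] clinear_scale[OF clinear_sym_mu] sym_mu_sym_prod)
qed (simp_all add: clinear_simps[OF clinear_pair_flip]
    clinear_simps[OF clinear_sym_mu])

lemma sym_parity_induct [consumes 1, case_names sym_prod add scale]:
  assumes "a \<in> sym_parity e"
    and t: "\<And>es vs. homogeneous_list es vs \<Longrightarrow> list_parity es = e \<Longrightarrow> P (sym_prod vs)"
    and a: "\<And>x y. P x \<Longrightarrow> P y \<Longrightarrow> P (x + y)" "\<And>c x. P x \<Longrightarrow> P (c *\<^sub>C x)"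
  shows "P a"
proof -
  \<comment> \<open>\<open>0\<close> has to be reached from a generator of parity \<open>e\<close>:
    the empty product in the even case, a single zero vector counted as odd in the odd case.\<close>
  have "P (0 *\<^sub>C sym_prod (replicate (of_bool e) 0))"
    by (intro a t[of "replicate (of_bool e) e"])
      (auto simp: homogeneous_list_def list_all2_conv_all_nth homogeneous_def parity_part_scaleC[of _ 0 0, simplified]
        list_parity_def)
  then have zero: "P 0" by simp
  show ?thesis
    using assms(1) unfolding sym_parity_def
  proof (induction rule: complex_vector.span_induct_alt)
    case (step c x y)
    then show ?case using t a unfolding list_parity_def by blast
  qed (rule zero)
qed

lemma pair_flip_parity:
  assumes "a \<in> sym_parity d" "b \<in> sym_parity e"
  shows "pair_flip (a \<otimes>\<^sub>C b) = parity_sign d e *\<^sub>C (b \<otimes>\<^sub>C a)"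
  using assms(1)
proof (induction rule: sym_parity_induct)
  case (sym_prod ds vs)
  from assms(2) show ?case
    by (induction rule: sym_parity_induct)
      (simp_all add: pair_flip_sym_prod[OF sym_prod(1)] sym_prod(2) tensor_of_linear clinear_simps[OF clinear_pair_flip] scaleC_add_right complex_vector.scale_left_commute)
qed (simp_all add: tensor_of_linear clinear_simps[OF clinear_pair_flip] scaleC_add_right complex_vector.scale_left_commute)

text \<open>The flip is pushed through each power of the contraction, which replaces
  \<open>\<Lambda>\<close> by \<open>flip_form \<Lambda>\<close>, and is then swallowed by the
  graded commutative product.\<close>

lemma star_product_flip:
  assumes b: "cbilinear \<Lambda>" and ev: "even_form \<Lambda>" and ab: "a \<in> sym_parity d" "b \<in> sym_parity e"
  shows "parity_sign d e *\<^sub>C star_product z \<Lambda> b a = star_product z (flip_form \<Lambda>) a b"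
proof -
  note b' = cbilinear_flip_form[OF b]
  have P: "(P_op \<Lambda> ^^ k) (pair_flip x) = pair_flip ((P_op (flip_form \<Lambda>) ^^ k) x)" for k x
    by (induction k) (simp_all add: pair_flip_P_op[OF b ev])
  obtain M where M: "\<And>k. k \<ge> M \<Longrightarrow> (P_op \<Lambda> ^^ k) (b \<otimes>\<^sub>C a) = 0"
    using P_op_power_zero[OF b] by blast
  obtain N where N: "\<And>k. k \<ge> N \<Longrightarrow> (P_op (flip_form \<Lambda>) ^^ k) (a \<otimes>\<^sub>C b) = 0"
    using P_op_power_zero[OF b'] by blast
  have "sym_mu ((P_op (flip_form \<Lambda>) ^^ k) (a \<otimes>\<^sub>C b)) =
      sym_mu (pair_flip ((P_op (flip_form \<Lambda>) ^^ k) (a \<otimes>\<^sub>C b)))" for k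
    by (rule sym_mu_pair_flip[symmetric])
  also have "\<dots> k = parity_sign d e *\<^sub>C sym_mu ((P_op \<Lambda> ^^ k) (b \<otimes>\<^sub>C a))" for k
    by (simp add: P[symmetric] pair_flip_parity[OF ab] clinear_scale[OF clinear_P_op_power[OF b]]
        clinear_scale[OF clinear_sym_mu])
  finally have "sym_mu ((P_op (flip_form \<Lambda>) ^^ k) (a \<otimes>\<^sub>C b)) =
      parity_sign d e *\<^sub>C sym_mu ((P_op \<Lambda> ^^ k) (b \<otimes>\<^sub>C a))" for k .
  then show ?thesis
    by (simp add: star_product_eq[OF b, of "max M N"] star_product_eq[OF b', of "max M N"] M N
        complex_vector.scale_sum_right complex_vector.scale_left_commute mult.commute)
qed

section \<open>The Poisson bracket\<close>

lemma cbilinear_form_minus: "cbilinear \<Lambda> \<Longrightarrow> cbilinear (form_minus \<Lambda>)"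
  using cbilinear_flip_form[of \<Lambda>]
  by (intro cbilinearI)
    (simp_all add: form_minus_def cbilinearD[of \<Lambda>] cbilinearD[of "flip_form \<Lambda>"] scaleC_complex_def
      diff_divide_distrib add_divide_distrib algebra_simps)

lemma cbilinear_poisson_bracket:
  assumes "cbilinear \<Lambda>"
  shows "cbilinear (poisson_bracket \<Lambda>)"
  using clinear_P_op[OF cbilinear_form_minus[OF assms]]
  by (intro cbilinearI)
    (simp_all add: poisson_bracket_def tensor_of_linear clinear_add clinear_scale clinear_sym_mu
      scaleC_add_right complex_vector.scale_left_commute)

lemma sym_conj_poisson_bracket:
  assumes "cbilinear \<Lambda>"
  shows "sym_conj (poisson_bracket \<Lambda> a b) =
    2 *\<^sub>C sym_mu (P_op (conj_form (form_minus \<Lambda>)) (sym_conj a \<otimes>\<^sub>C sym_conj b))"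
  by (simp add: poisson_bracket_def sym_conj_scaleC sym_conj_sym_mu
      pair_conj_P_op[OF cbilinear_form_minus[OF assms]] pair_conj_tensor_of)

lemma poisson_bracket_generators:
  assumes "cbilinear \<Lambda>" "homogeneous d v" "homogeneous e w"
  shows "poisson_bracket \<Lambda> (sym_prod [v]) (sym_prod [w]) = (2 * form_minus \<Lambda> v w) *\<^sub>C sym_prod []"
proof -
  have h: "homogeneous_list [d] [v]" "homogeneous_list [e] [w]"
    using assms by (simp_all add: homogeneous_list_def)
  show ?thesis
    by (simp add: poisson_bracket_def P_op_sym_prod[OF cbilinear_form_minus[OF assms(1)] h] sym_mu_sym_prod
        clinear_scale[OF clinear_sym_mu] omit_def scaleC_scaleC contraction_sign_def)
qed

text \<open>The projection onto degree zero is induced by a multilinear, graded symmetric map with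
  value \<open>1\<close> at the empty product. Multiples of \<open>sym_prod []\<close> can therefore
  be compared by their coefficients.\<close>

lemma sym_prod_Nil_nonzero: "sym_prod [] \<noteq> (0 :: 'v::graded_complex_vector symmetric_algebra)"
proof
  define f where "f vs = (if vs = [] then 1 else 0 :: complex)" for vs :: "'v list"
  have m: "multilinear f"
    unfolding multilinear_def f_def by (auto intro!: clinearI)
  have g: "graded_symmetric f"
    by (rule graded_symmetricI) (simp add: f_def)
  assume "sym_prod [] = (0 :: 'v symmetric_algebra)"
  then have "f [] = 0"
    using sym_lift_sym_prod[OF m g, of "[]"] clinear_zero[OF clinear_sym_lift[OF m]] by simp
  then show False by (simp add: f_def)
qed

section \<open>Projective tensor seminorms\<close>

text \<open>The algebraic part of \<open>continuous_seminorm\<close>, usable on the symmetric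
  algebra, whose topology is a term of type \<open>topology\<close> and not a class
  instance.\<close>

definition cseminorm :: "('v::complex_vector \<Rightarrow> real) \<Rightarrow> bool"
  where "cseminorm p \<longleftrightarrow> (\<forall>x y. p (x + y) \<le> p x + p y) \<and> (\<forall>c x. p (c *\<^sub>C x) = cmod c * p x)"

lemma cseminormD:
  assumes "cseminorm p"
  shows "p (x + y) \<le> p x + p y" "p (c *\<^sub>C x) = cmod c * p x"
  using assms by (simp_all add: cseminorm_def)

lemma cseminorm_zero: "cseminorm p \<Longrightarrow> p 0 = 0"
  using cseminormD(2)[of p 0 0] by simp

lemma cseminorm_minus: "cseminorm p \<Longrightarrow> p (- x) = p x"
  using cseminormD(2)[of p "-1" x] by simp

lemma cseminorm_nonneg: "cseminorm p \<Longrightarrow> 0 \<le> p x"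
  using cseminormD(1)[of p x "- x"] by (simp add: cseminorm_zero cseminorm_minus)

lemma cseminorm_diff: "cseminorm p \<Longrightarrow> p (x - y) \<le> p x + p y"
  using cseminormD(1)[of p x "- y"] by (simp add: cseminorm_minus)

lemma cseminorm_sum: "cseminorm p \<Longrightarrow> p (sum f I) \<le> (\<Sum>i\<in>I. p (f i))"
  by (induction I rule: infinite_finite_induct)
    (auto simp: cseminorm_zero intro: order_trans[OF cseminormD(1)])

text \<open>The opposite inequality for scalars comes from the assumed one at
  \<open>inverse c\<close>, and \<open>c = 0\<close> forces the value \<open>0\<close> at
  zero.\<close>

lemma cseminormI:
  assumes "\<And>x y. p (x + y) \<le> p x + p y" "\<And>c x. p (c *\<^sub>C x) \<le> cmod c * p x" "\<And>x. 0 \<le> p x"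
  shows "cseminorm p"
proof -
  have "p (c *\<^sub>C x) = cmod c * p x" for c x
  proof (cases "c = 0")
    case True
    then show ?thesis using assms(2)[of 0 0] assms(3)[of 0] by simp
  next
    case False
    have "p x \<le> cmod (inverse c) * p (c *\<^sub>C x)"
      using assms(2)[of "inverse c" "c *\<^sub>C x"] False by simp
    then have "cmod c * p x \<le> p (c *\<^sub>C x)"
      using False by (simp add: norm_inverse norm_divide field_simps)
    with assms(2)[of c x] show ?thesis by simp
  qed
  with assms show ?thesis by (simp add: cseminorm_def)
qed

lemma cseminorm_scaled: "cseminorm p \<Longrightarrow> 0 \<le> r \<Longrightarrow> cseminorm (\<lambda>x. r * p x)"
  using cseminormD[of p]
  by (intro cseminormI) (auto simp: cseminorm_nonneg distrib_left[symmetric] intro!: mult_left_mono)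

lemma cseminorm_compose: "cseminorm p \<Longrightarrow> clinear f \<Longrightarrow> cseminorm (\<lambda>x. p (f x))"
  by (simp add: cseminorm_def clinear_add clinear_scale)

definition tensor_sum :: "(complex \<times> 'v::complex_vector list) list \<Rightarrow> 'v tensor_algebra"
  where "tensor_sum L = (\<Sum>(c, vs)\<leftarrow>L. c *\<^sub>C tensor vs)"

definition tensor_cost :: "('v::complex_vector \<Rightarrow> real) \<Rightarrow> (complex \<times> 'v list) list \<Rightarrow> real"
  where "tensor_cost p L = (\<Sum>(c, vs)\<leftarrow>L. cmod c * prod_list (map p vs))"

definition of_degree :: "nat \<Rightarrow> (complex \<times> 'v list) list \<Rightarrow> bool"
  where "of_degree n L \<longleftrightarrow> (\<forall>(c, vs)\<in>set L. length vs = n)"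

lemma tensor_seminorm_eq:
  "tensor_seminorm p n x = Inf {tensor_cost p L | L. of_degree n L \<and> x = tensor_sum L}"
  by (simp add: tensor_seminorm_def tensor_cost_def of_degree_def tensor_sum_def)

lemma tensor_component_multilinear:
  "multilinear (\<lambda>vs. if length vs = n then tensor vs else 0)"
  unfolding multilinear_def
proof (intro allI impI)
  fix vs :: "'a list" and j
  assume "j < length vs"
  then show "clinear (\<lambda>v. if length (vs[j := v]) = n then tensor (vs[j := v]) else 0)"
    by (cases "length vs = n") (simp_all add: multilinearD[OF multilinear_tensor] clinear_const_zero)
qed

lemma clinear_tensor_component: "clinear (tensor_component n)"
  unfolding tensor_component_def by (rule clinear_tensor_lift[OF tensor_component_multilinear])

lemma tensor_component_tensor: "tensor_component n (tensor vs) = (if length vs = n then tensor vs else 0)"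
  by (simp add: tensor_component_def tensor_lift_tensor[OF tensor_component_multilinear])

lemma tensor_sum_scale: "c *\<^sub>C tensor_sum L = tensor_sum (map (\<lambda>(d, vs). (c * d, vs)) L)"
  by (induction L) (auto simp: tensor_sum_def scaleC_add_right scaleC_scaleC)

text \<open>The infimum in \<open>tensor_seminorm\<close> is over the empty set for tensors that are
  not of degree \<open>n\<close>. Components admit a decomposition of the right degree, so the
  seminorm is controlled on them.\<close>

lemma tensor_component_decomposition: "\<exists>L. of_degree n L \<and> tensor_component n x = tensor_sum L"
proof (induction x rule: tensor_induct)
  case (tensor vs)
  have "tensor_component n (tensor vs) = tensor_sum (if length vs = n then [(1, vs)] else [])"
    by (simp add: tensor_component_tensor tensor_sum_def scaleC_one)
  then show ?case by (intro exI conjI) (auto simp: of_degree_def)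
next
  case (add x y)
  then obtain L M where "of_degree n L" "tensor_component n x = tensor_sum L"
    "of_degree n M" "tensor_component n y = tensor_sum M" by blast
  then show ?case
    by (intro exI[of _ "L @ M"]) (auto simp: of_degree_def tensor_sum_def clinear_add[OF clinear_tensor_component])
next
  case (scale c x)
  then obtain L where L: "of_degree n L" "tensor_component n x = tensor_sum L" by blast
  then show ?case
    by (intro exI[of _ "map (\<lambda>(d, vs). (c * d, vs)) L"])
      (auto simp: of_degree_def clinear_scale[OF clinear_tensor_component] tensor_sum_scale)
qed

lemma tensor_component_finite: "\<exists>N. (\<forall>n\<ge>N. tensor_component n x = 0) \<and> x = (\<Sum>n<N. tensor_component n x)"
proof -
  \<comment> \<open>A bound valid for all larger \<open>M\<close> as well lets a sum use the maximum
    of the two bounds.\<close>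
  have "\<exists>N. \<forall>M\<ge>N. tensor_component M x = 0 \<and> x = (\<Sum>n<M. tensor_component n x)"
  proof (induction x rule: tensor_induct)
    case (tensor vs)
    show ?case
      by (intro exI[of _ "Suc (length vs)"]) (auto simp: tensor_component_tensor)
  next
    case (add x y)
    then obtain M N where
      "\<forall>K\<ge>M. tensor_component K x = 0 \<and> x = (\<Sum>n<K. tensor_component n x)"
      "\<forall>K\<ge>N. tensor_component K y = 0 \<and> y = (\<Sum>n<K. tensor_component n y)" by blast
    then show ?case
      by (intro exI[of _ "max M N"])
        (simp add: clinear_add[OF clinear_tensor_component] sum.distrib)
  next
    case (scale c x)
    then obtain N where "\<forall>K\<ge>N. tensor_component K x = 0 \<and> x = (\<Sum>n<K. tensor_component n x)" by blast
    then show ?case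
      by (intro exI[of _ N])
        (simp add: clinear_scale[OF clinear_tensor_component] flip: complex_vector.scale_sum_right)
  qed
  then show ?thesis by blast
qed

context
  fixes p :: "'v::complex_vector \<Rightarrow> real"
  assumes p: "cseminorm p"
begin

lemma tensor_cost_nonneg: "0 \<le> tensor_cost p L"
  by (induction L) (auto simp: tensor_cost_def cseminorm_nonneg[OF p] intro!: add_nonneg_nonneg mult_nonneg_nonneg prod_list_nonneg)

lemma tensor_seminorm_le:
  "of_degree n L \<Longrightarrow> tensor_seminorm p n (tensor_sum L) \<le> tensor_cost p L"
  unfolding tensor_seminorm_eq
  by (rule cInf_lower) (auto intro!: bdd_belowI[of _ 0] simp: tensor_cost_nonneg)

lemma tensor_seminorm_greatest:
  assumes "of_degree n L" "x = tensor_sum L"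
    and "\<And>L. of_degree n L \<Longrightarrow> x = tensor_sum L \<Longrightarrow> r \<le> tensor_cost p L"
  shows "r \<le> tensor_seminorm p n x"
  unfolding tensor_seminorm_eq by (rule cInf_greatest) (use assms in auto)

lemma tensor_seminorm_approx:
  assumes "of_degree n L" "x = tensor_sum L" "tensor_seminorm p n x < r"
  obtains M where "of_degree n M" "x = tensor_sum M" "tensor_cost p M < r"
  using tensor_seminorm_greatest[OF assms(1,2), of r] assms(3) by (meson not_le)

lemma tensor_seminorm_zero: "tensor_seminorm p n 0 = 0"
proof (rule antisym)
  have L: "of_degree n ([] :: (complex \<times> 'v list) list)" "0 = tensor_sum ([] :: (complex \<times> 'v list) list)"
    by (simp_all add: of_degree_def tensor_sum_def)
  show "tensor_seminorm p n 0 \<le> 0"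
    using tensor_seminorm_le[OF L(1)] by (simp add: tensor_sum_def tensor_cost_def)
  show "0 \<le> tensor_seminorm p n 0"
    by (rule tensor_seminorm_greatest[OF L]) (rule tensor_cost_nonneg)
qed

text \<open>Nearly optimal decompositions are concatenated for the triangle inequality, and
  decompositions are multiplied by the scalar for homogeneity.\<close>

lemma tensor_seminorm_component:
  shows "0 \<le> tensor_seminorm p n (tensor_component n x)"
    and "tensor_seminorm p n (tensor_component n (x + y)) \<le>
      tensor_seminorm p n (tensor_component n x) + tensor_seminorm p n (tensor_component n y)"
    and "tensor_seminorm p n (tensor_component n (c *\<^sub>C x)) \<le> cmod c * tensor_seminorm p n (tensor_component n x)"
proof -
  obtain L where L: "of_degree n L" "tensor_component n x = tensor_sum L"
    using tensor_component_decomposition by blast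
  obtain M where M: "of_degree n M" "tensor_component n y = tensor_sum M"
    using tensor_component_decomposition by blast
  let ?t = "\<lambda>x. tensor_seminorm p n (tensor_component n x)"
  show "0 \<le> ?t x"
    by (rule tensor_seminorm_greatest[OF L]) (rule tensor_cost_nonneg)
  show "?t (x + y) \<le> ?t x + ?t y"
  proof (rule field_le_epsilon)
    fix e :: real assume "e > 0"
    then have e: "?t x < ?t x + e / 2" "?t y < ?t y + e / 2" by simp_all
    obtain L' where L': "of_degree n L'" "tensor_component n x = tensor_sum L'" "tensor_cost p L' < ?t x + e / 2"
      using tensor_seminorm_approx[OF L e(1)] .
    obtain M' where M': "of_degree n M'" "tensor_component n y = tensor_sum M'" "tensor_cost p M' < ?t y + e / 2"
      using tensor_seminorm_approx[OF M e(2)] .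
    have "tensor_component n (x + y) = tensor_sum (L' @ M')" "of_degree n (L' @ M')"
      using L' M' by (auto simp: clinear_add[OF clinear_tensor_component] tensor_sum_def of_degree_def)
    then have "?t (x + y) \<le> tensor_cost p (L' @ M')"
      using tensor_seminorm_le[of n "L' @ M'"] by simp
    also have "\<dots> = tensor_cost p L' + tensor_cost p M'"
      by (simp add: tensor_cost_def)
    finally show "?t (x + y) \<le> ?t x + ?t y + e" using L'(3) M'(3) by simp
  qed
  show "?t (c *\<^sub>C x) \<le> cmod c * ?t x"
  proof (cases "c = 0")
    case True
    then show ?thesis by (simp add: clinear_zero[OF clinear_tensor_component] tensor_seminorm_zero)
  next
    case False
    have "?t (c *\<^sub>C x) / cmod c \<le> ?t x"
    proof (rule tensor_seminorm_greatest[OF L])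
      fix L assume L: "of_degree n L" "tensor_component n x = tensor_sum L"
      let ?L = "map (\<lambda>(d, vs). (c * d, vs)) L"
      have "tensor_component n (c *\<^sub>C x) = tensor_sum ?L" "of_degree n ?L"
        using L by (auto simp: clinear_scale[OF clinear_tensor_component] of_degree_def tensor_sum_scale)
      then have "?t (c *\<^sub>C x) \<le> tensor_cost p ?L"
        using tensor_seminorm_le[of n ?L] by simp
      also have "tensor_cost p ?L = cmod c * tensor_cost p L"
        by (induction L) (auto simp: tensor_cost_def norm_mult algebra_simps)
      finally show "?t (c *\<^sub>C x) / cmod c \<le> tensor_cost p L"
        using False by (simp add: field_simps)
    qed
    then show ?thesis using False by (simp add: field_simps)
  qed
qed

lemma tensor_seminorm_tensor:
  "tensor_seminorm p (length vs) (tensor_component (length vs) (tensor vs)) \<le> prod_list (map p vs)"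
  using tensor_seminorm_le[of "length vs" "[(1, vs)]"]
  by (simp add: of_degree_def tensor_sum_def tensor_cost_def tensor_component_tensor scaleC_one)

lemma cseminorm_tensor_seminorm: "cseminorm (\<lambda>x. tensor_seminorm p n (tensor_component n x))"
  by (intro cseminormI tensor_seminorm_component)

end

section \<open>The Weyl seminorms\<close>

lemma weyl_seminorm_eq:
  assumes p: "cseminorm p" and N: "\<forall>n\<ge>N. tensor_component n (Rep_symmetric_algebra a) = 0"
  shows "weyl_seminorm p R a =
    (\<Sum>n<N. tensor_seminorm p n (tensor_component n (Rep_symmetric_algebra a)) * fact n powr R)"
proof -
  have "tensor_seminorm p n (tensor_component n (Rep_symmetric_algebra a)) * fact n powr R = 0" if "n \<ge> N" for n
    using N that by (simp add: tensor_seminorm_zero[OF p])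
  then have "{n. tensor_seminorm p n (tensor_component n (Rep_symmetric_algebra a)) * fact n powr R \<noteq> 0} \<subseteq> {..<N}"
    by (metis (mono_tags, lifting) lessThan_iff mem_Collect_eq not_le subsetI)
  then show ?thesis
    unfolding weyl_seminorm_def by (rule Sum_any.expand_superset[rotated]) simp
qed

lemma cseminorm_weyl_seminorm:
  fixes p :: "'v::graded_complex_vector \<Rightarrow> real"
  assumes p: "cseminorm p"
  shows "cseminorm (weyl_seminorm p R)"
proof (rule cseminormI)
  fix x y :: "'v symmetric_algebra" and c
  note Rep_simps = plus_symmetric_algebra.rep_eq scaleC_symmetric_algebra.rep_eq
    clinear_simps[OF clinear_tensor_component]
  let ?t = "\<lambda>n x. tensor_seminorm p n (tensor_component n (Rep_symmetric_algebra x)) * fact n powr R"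
  have "\<exists>N. \<forall>n\<ge>N. tensor_component n (Rep_symmetric_algebra x) = 0" for x :: "'v symmetric_algebra"
    using tensor_component_finite by blast
  then obtain M N where M: "\<forall>n\<ge>M. tensor_component n (Rep_symmetric_algebra x) = 0"
    and N: "\<forall>n\<ge>N. tensor_component n (Rep_symmetric_algebra y) = 0" by metis
  have x: "weyl_seminorm p R x = (\<Sum>n<max M N. ?t n x)" "weyl_seminorm p R y = (\<Sum>n<max M N. ?t n y)"
    "weyl_seminorm p R (x + y) = (\<Sum>n<max M N. ?t n (x + y))"
    "weyl_seminorm p R (c *\<^sub>C x) = (\<Sum>n<max M N. ?t n (c *\<^sub>C x))"
    by (rule weyl_seminorm_eq[OF p], use M N in \<open>simp add: Rep_simps\<close>)+
  show "weyl_seminorm p R (x + y) \<le> weyl_seminorm p R x + weyl_seminorm p R y"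
    unfolding x sum.distrib[symmetric] distrib_right[symmetric] plus_symmetric_algebra.rep_eq
    by (intro sum_mono mult_right_mono tensor_seminorm_component p) simp
  show "weyl_seminorm p R (c *\<^sub>C x) \<le> cmod c * weyl_seminorm p R x"
    unfolding x sum_distrib_left mult.assoc[symmetric] scaleC_symmetric_algebra.rep_eq
    by (intro sum_mono mult_right_mono tensor_seminorm_component p) simp
  show "0 \<le> weyl_seminorm p R x"
    unfolding x by (intro sum_nonneg mult_nonneg_nonneg tensor_seminorm_component p) simp
qed

lemma weyl_seminorm_mono:
  fixes p q :: "'v::graded_complex_vector \<Rightarrow> real"
  assumes p: "cseminorm p" and q: "cseminorm q" and le: "\<And>v. p v \<le> q v"
  shows "weyl_seminorm p R a \<le> weyl_seminorm q R a"
proof -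
  obtain N where N: "\<forall>n\<ge>N. tensor_component n (Rep_symmetric_algebra a) = 0"
    using tensor_component_finite by blast
  have cost: "tensor_cost p L \<le> tensor_cost q L" for L
    unfolding tensor_cost_def
  proof (rule sum_list_mono, clarify)
    fix c vs
    have "prod_list (map p vs) \<le> prod_list (map q vs)"
      by (induction vs) (auto intro!: mult_mono le cseminorm_nonneg[OF p] cseminorm_nonneg[OF q] prod_list_nonneg)
    then show "cmod c * prod_list (map p vs) \<le> cmod c * prod_list (map q vs)"
      by (rule mult_left_mono) simp
  qed
  have "tensor_seminorm p n (tensor_component n x) \<le> tensor_seminorm q n (tensor_component n x)"
    for n and x :: "'v tensor_algebra"
  proof -
    obtain L where L: "of_degree n L" "tensor_component n x = tensor_sum L"
      using tensor_component_decomposition by blast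
    show ?thesis
      by (rule tensor_seminorm_greatest[OF q L]) (metis tensor_seminorm_le[OF p] cost order_trans)
  qed
  then show ?thesis
    unfolding weyl_seminorm_eq[OF p N] weyl_seminorm_eq[OF q N]
    by (intro sum_mono mult_right_mono) simp_all
qed

text \<open>Symmetrization averages tensors that differ only by a sign and by the order of their
  factors, and the product of the seminorms of the factors is the same for all of them.\<close>

lemma weyl_seminorm_sym_prod:
  assumes p: "cseminorm p" and h: "homogeneous_list es vs"
  shows "weyl_seminorm p R (sym_prod vs) \<le> fact (length vs) powr R * prod_list (map p vs)"
proof -
  let ?P = "{\<sigma>. \<sigma> permutes {..<length vs}}" and ?n = "length vs"
  let ?w = "\<lambda>\<sigma>. map (\<lambda>i. vs ! \<sigma> i) [0..<length vs]"
  have S: "symmetrizer (tensor vs) = (1 / fact ?n) *\<^sub>C (\<Sum>\<sigma>\<in>?P. koszul_sign \<sigma> es *\<^sub>C tensor (?w \<sigma>))"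
    by (simp add: symmetrizer_tensor permuted_tensor_homogeneous[OF h])
  have comp: "tensor_component m (symmetrizer (tensor vs)) = (if m = ?n then symmetrizer (tensor vs) else 0)" for m
    by (simp add: S clinear_scale[OF clinear_tensor_component] clinear_sum_distrib[OF clinear_tensor_component]
        tensor_component_tensor)
  note ts = cseminorm_tensor_seminorm[OF p, of ?n]
  have perm: "prod_list (map p (?w \<sigma>)) = prod_list (map p vs)" if "\<sigma> \<in> ?P" for \<sigma>
  proof -
    have "prod_list (map p (?w \<sigma>)) = (\<Prod>i<?n. p (vs ! \<sigma> i))"
      by (simp add: prod.list_conv_set_nth atLeast0LessThan)
    also have "\<dots> = (\<Prod>i<?n. p (vs ! i))"
      using that prod.permute[of \<sigma> "{..<?n}" "\<lambda>i. p (vs ! i)"] by (simp add: comp_def)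
    also have "\<dots> = prod_list (map p vs)"
      by (simp add: prod.list_conv_set_nth atLeast0LessThan)
    finally show ?thesis .
  qed
  have "tensor_seminorm p ?n (tensor_component ?n (symmetrizer (tensor vs))) \<le>
      cmod (1 / fact ?n) * (\<Sum>\<sigma>\<in>?P. tensor_seminorm p ?n (tensor_component ?n (koszul_sign \<sigma> es *\<^sub>C tensor (?w \<sigma>))))"
    unfolding S by (subst cseminormD(2)[OF ts], intro mult_left_mono cseminorm_sum[OF ts]) simp
  also have "\<dots> \<le> cmod (1 / fact ?n) * (\<Sum>\<sigma>\<in>?P. prod_list (map p vs))"
  proof (intro mult_left_mono sum_mono)
    fix \<sigma> assume \<sigma>: "\<sigma> \<in> ?P"
    have "cmod (koszul_sign \<sigma> es) = 1" by (simp add: koszul_sign_def norm_power)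
    then show "tensor_seminorm p ?n (tensor_component ?n (koszul_sign \<sigma> es *\<^sub>C tensor (?w \<sigma>))) \<le> prod_list (map p vs)"
      unfolding cseminormD(2)[OF ts] using tensor_seminorm_tensor[OF p, of "?w \<sigma>"] perm[OF \<sigma>] by simp
  qed simp
  also have "\<dots> = prod_list (map p vs)"
    using card_permutations[of "{..<?n}" ?n] by (simp add: norm_divide)
  finally have "tensor_seminorm p ?n (tensor_component ?n (symmetrizer (tensor vs))) * fact ?n powr R \<le>
      prod_list (map p vs) * fact ?n powr R"
    by (rule mult_right_mono) simp
  moreover have "weyl_seminorm p R (sym_prod vs) =
      tensor_seminorm p ?n (tensor_component ?n (symmetrizer (tensor vs))) * fact ?n powr R"
    by (subst weyl_seminorm_eq[OF p, of "Suc ?n"])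
      (auto simp: sym_prod.rep_eq comp tensor_seminorm_zero[OF p] intro!: sum.neutral)
  ultimately show ?thesis by (simp add: mult.commute)
qed

text \<open>Bounds are obtained for homogeneous vectors. Projections that do not increase the
  seminorm allow them to be applied to the parity parts of arbitrary vectors.\<close>

definition graded_seminorm :: "('v::graded_complex_vector \<Rightarrow> real) \<Rightarrow> bool"
  where "graded_seminorm p \<longleftrightarrow> cseminorm p \<and> (\<forall>e v. p (parity_part e v) \<le> p v)"

lemma prod_list_map_scaled: "prod_list (map (\<lambda>v. r * q v) vs) = r ^ length vs * prod_list (map q vs)"
  for r :: real
  by (induction vs) simp_all

text \<open>The seminorm \<open>2 q\<close> absorbs the \<open>2\<^sup>n\<close> parity components of \<open>n\<close> vectors.\<close>

lemma weyl_seminorm_dominates: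
  fixes F :: "'v::graded_complex_vector symmetric_algebra \<Rightarrow> real"
  assumes F: "cseminorm F" and q: "graded_seminorm q" and C: "0 \<le> C"
    and le: "\<And>es vs. homogeneous_list es vs \<Longrightarrow>
      F (sym_prod vs) \<le> C * (fact (length vs) powr R * prod_list (map q vs))"
  shows "F a \<le> C * weyl_seminorm (\<lambda>v. 2 * q v) R a"
proof -
  have q': "cseminorm q" "\<And>e v. q (parity_part e v) \<le> q v"
    using q by (simp_all add: graded_seminorm_def)
  let ?q = "\<lambda>v. 2 * q v"
  have 2: "cseminorm ?q" by (rule cseminorm_scaled[OF q'(1)]) simp
  have gen: "F (sym_prod vs) \<le> C * (fact (length vs) powr R * prod_list (map ?q vs))" for vs
  proof -
    let ?E = "{es :: bool list. length es = length vs}"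
    have card: "card ?E = 2 ^ length vs"
      using card_lists_length_eq[of "UNIV :: bool set" "length vs"] by simp
    have "F (sym_prod vs) = F (\<Sum>es\<in>?E. sym_prod (parity_parts es vs))"
      by (simp flip: multilinear_expand[OF multilinear_sym_prod])
    also have "\<dots> \<le> (\<Sum>es\<in>?E. F (sym_prod (parity_parts es vs)))"
      by (rule cseminorm_sum[OF F])
    also have "\<dots> \<le> (\<Sum>es\<in>?E. C * (fact (length vs) powr R * prod_list (map q vs)))"
    proof (rule sum_mono)
      fix es assume "es \<in> ?E"
      then have es: "length es = length vs" by simp
      have "prod_list (map q (parity_parts es vs)) \<le> prod_list (map q vs)"
        using es
        by (induction es vs rule: list_induct2)
          (auto intro!: mult_mono q'(2) cseminorm_nonneg[OF q'(1)] prod_list_nonneg)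
      then have "C * (fact (length vs) powr R * prod_list (map q (parity_parts es vs))) \<le>
          C * (fact (length vs) powr R * prod_list (map q vs))"
        by (intro mult_left_mono C) simp_all
      then show "F (sym_prod (parity_parts es vs)) \<le> C * (fact (length vs) powr R * prod_list (map q vs))"
        using le[OF homogeneous_list_parity_parts[OF es]] es by simp
    qed
    also have "\<dots> = C * (fact (length vs) powr R * prod_list (map ?q vs))"
      by (simp add: card prod_list_map_scaled)
    finally show ?thesis .
  qed
  note lin = clinear_tensor_lift[OF multilinear_sym_prod]
  \<comment> \<open>In each degree, a bound that is linear in the cost of every decomposition passes
    to the infimum, which is the projective seminorm.\<close>
  have comp: "F (tensor_lift sym_prod (tensor_component n x)) \<le>
      C * (tensor_seminorm ?q n (tensor_component n x) * fact n powr R)" for n x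
  proof -
    obtain L where L: "of_degree n L" "tensor_component n x = tensor_sum L"
      using tensor_component_decomposition by blast
    have bound: "F (tensor_lift sym_prod (tensor_sum M)) \<le> (C * fact n powr R) * tensor_cost ?q M"
      if "of_degree n M" for M
      using that
    proof (induction M)
      case Nil
      then show ?case
        by (simp add: tensor_sum_def tensor_cost_def clinear_zero[OF lin] cseminorm_zero[OF F])
    next
      case (Cons m M)
      obtain c vs where m: "m = (c, vs)" by (cases m)
      have n: "length vs = n" "of_degree n M" using Cons.prems by (simp_all add: of_degree_def m)
      have "F (tensor_lift sym_prod (tensor_sum (m # M))) =
          F (c *\<^sub>C sym_prod vs + tensor_lift sym_prod (tensor_sum M))"
        by (simp add: m tensor_sum_def clinear_simps[OF lin]
            tensor_lift_tensor multilinear_sym_prod)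
      also have "\<dots> \<le> cmod c * F (sym_prod vs) + F (tensor_lift sym_prod (tensor_sum M))"
        using cseminormD[OF F] by metis
      also have "\<dots> \<le> cmod c * (C * (fact n powr R * prod_list (map ?q vs))) + C * fact n powr R * tensor_cost ?q M"
        using gen[of vs] n by (intro add_mono mult_left_mono Cons.IH) auto
      finally show ?case by (simp add: m tensor_cost_def algebra_simps)
    qed
    show ?thesis
    proof (cases "C = 0")
      case True
      then show ?thesis using bound[OF L(1)] L(2) by simp
    next
      case False
      \<comment> \<open>The passage to the infimum divides by this factor, which is why
        \<open>C = 0\<close> is a separate case.\<close>
      then have pos: "0 < C * fact n powr R" using C by simp
      have "F (tensor_lift sym_prod (tensor_component n x)) / (C * fact n powr R) \<le>
          tensor_seminorm ?q n (tensor_component n x)"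
      proof (rule tensor_seminorm_greatest[OF 2 L])
        fix M assume M: "of_degree n M" "tensor_component n x = tensor_sum M"
        show "F (tensor_lift sym_prod (tensor_component n x)) / (C * fact n powr R) \<le> tensor_cost ?q M"
          using bound[OF M(1)] pos unfolding M(2) by (subst pos_divide_le_eq) (simp_all add: mult.commute)
      qed
      then show ?thesis using pos by (simp add: pos_divide_le_eq mult.commute mult.left_commute)
    qed
  qed
  obtain N where N: "\<forall>n\<ge>N. tensor_component n (Rep_symmetric_algebra a) = 0"
    "Rep_symmetric_algebra a = (\<Sum>n<N. tensor_component n (Rep_symmetric_algebra a))"
    using tensor_component_finite by blast
  \<comment> \<open>The components of \<open>a\<close> are given as mere tensors; symmetrizing them
    turns them into elements of the symmetric algebra without changing their sum.\<close>
  have "a = tensor_lift sym_prod (Rep_symmetric_algebra a)"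
    by (simp add: tensor_lift_sym_prod_Rep)
  also have "\<dots> = (\<Sum>n<N. tensor_lift sym_prod (tensor_component n (Rep_symmetric_algebra a)))"
    by (subst N(2)) (rule clinear_sum_distrib[OF lin])
  finally have "F a \<le> (\<Sum>n<N. F (tensor_lift sym_prod (tensor_component n (Rep_symmetric_algebra a))))"
    using cseminorm_sum[OF F] by metis
  also have "\<dots> \<le> (\<Sum>n<N. C * (tensor_seminorm ?q n (tensor_component n (Rep_symmetric_algebra a)) * fact n powr R))"
    by (intro sum_mono comp)
  also have "\<dots> = C * weyl_seminorm ?q R a"
    by (simp add: weyl_seminorm_eq[OF 2 N(1)] sum_distrib_left)
  finally show ?thesis .
qed

text \<open>The linear estimate is used twice: with \<open>ws\<close> fixed, its weight being the
  constant, and then with \<open>a\<close> fixed, its seminorm being the constant.\<close>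

lemma weyl_seminorm_dominates_bilinear:
  fixes f :: "'v::graded_complex_vector symmetric_algebra \<Rightarrow> 'v symmetric_algebra \<Rightarrow> 'v symmetric_algebra"
  assumes f: "cbilinear f" and F: "cseminorm F" and q: "graded_seminorm q"
    and le: "\<And>ds vs es ws. homogeneous_list ds vs \<Longrightarrow> homogeneous_list es ws \<Longrightarrow>
      F (f (sym_prod vs) (sym_prod ws)) \<le>
        (fact (length vs) powr R * prod_list (map q vs)) * (fact (length ws) powr R * prod_list (map q ws))"
  shows "F (f a b) \<le> weyl_seminorm (\<lambda>v. 2 * q v) R a * weyl_seminorm (\<lambda>v. 2 * q v) R b"
proof -
  have q': "cseminorm q" using q by (simp add: graded_seminorm_def)
  have nonneg: "0 \<le> fact n powr R * prod_list (map q ws)" for n ws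
    by (intro mult_nonneg_nonneg prod_list_nonneg) (auto simp: cseminorm_nonneg[OF q'])
  have "F (f a (sym_prod ws)) \<le>
      (fact (length ws) powr R * prod_list (map q ws)) * weyl_seminorm (\<lambda>v. 2 * q v) R a"
    if ws: "homogeneous_list es ws" for es ws
  proof (rule weyl_seminorm_dominates[OF _ q nonneg])
    show "cseminorm (\<lambda>a. F (f a (sym_prod ws)))"
      by (rule cseminorm_compose[OF F cbilinear_clinear(2)[OF f]])
    show "F (f (sym_prod vs) (sym_prod ws)) \<le> fact (length ws) powr R * prod_list (map q ws) *
        (fact (length vs) powr R * prod_list (map q vs))" if "homogeneous_list ds vs" for ds vs
      using le[OF that ws] by (simp add: mult.commute)
  qed
  note left = this
  show ?thesis
  proof (rule weyl_seminorm_dominates[OF cseminorm_compose[OF F cbilinear_clinear(1)[OF f]] q])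
    show "0 \<le> weyl_seminorm (\<lambda>v. 2 * q v) R a"
      by (intro cseminorm_nonneg[OF cseminorm_weyl_seminorm] cseminorm_scaled q') simp
    fix es and ws :: "'v list"
    assume "homogeneous_list es ws"
    from left[OF this] show "F (f a (sym_prod ws)) \<le>
        weyl_seminorm (\<lambda>v. 2 * q v) R a * (fact (length ws) powr R * prod_list (map q ws))"
      by (simp only: mult.commute)
  qed
qed

section \<open>Continuity estimates\<close>

text \<open>Mirrors \<open>P_op \<Lambda> ^^ Suc k\<close>: a first contraction has
  \<open>n * m\<close> terms and leaves lists shorter by one. The truncated subtraction is harmless,
  since the factor \<open>n * m\<close> vanishes if a list is empty.\<close>

fun contractions :: "nat \<Rightarrow> nat \<Rightarrow> nat \<Rightarrow> nat"
  where
    "contractions 0 n m = 1"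
  | "contractions (Suc k) n m = n * m * contractions k (n - 1) (m - 1)"

lemma contractions_fact:
  "k \<le> n \<Longrightarrow> k \<le> m \<Longrightarrow> contractions k n m * (fact (n - k) * fact (m - k)) = fact n * fact m"
proof (induction k arbitrary: n m)
  case (Suc k)
  then obtain n' m' where [simp]: "n = Suc n'" "m = Suc m'"
    by (metis Suc_le_D)
  have "contractions k n' m' * (fact (n' - k) * fact (m' - k)) = fact n' * fact m'"
    using Suc by simp
  then show ?case by (simp add: algebra_simps)
qed simp

lemma contractions_zero: "\<not> (k \<le> n \<and> k \<le> m) \<Longrightarrow> contractions k n m = 0"
proof (induction k arbitrary: n m)
  case (Suc k)
  then show ?case by (cases n; cases m) auto
qed simp

text \<open>The quotient of the factorials is a binomial coefficient, one summand of
  \<open>(1 + 1) ^ (n + m)\<close>.\<close>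

lemma fact_add_le: "fact (n + m) \<le> (2 ^ (n + m) * (fact n * fact m) :: real)"
proof -
  have "(n + m choose n) \<le> 2 ^ (n + m)" by (rule binomial_le_pow2)
  then have "real (n + m choose n) \<le> 2 ^ (n + m)"
    by (metis of_nat_le_iff of_nat_numeral of_nat_power)
  moreover have "fact (n + m) = (fact n * fact m * real (n + m choose n))"
    using binomial_fact[of n "n + m", where 'a = real] by simp
  ultimately show ?thesis by (simp add: mult.commute)
qed

lemma contractions_bound:
  fixes R :: real
  assumes R: "R \<ge> 1 / 2"
  shows "real (contractions k n m) / fact k * fact (n + m - 2 * k) powr R \<le>
    (2 * 2 powr R) ^ (n + m) * (fact n powr R * fact m powr R)"
proof (cases "k \<le> n \<and> k \<le> m")
  case False
  then show ?thesis by (simp add: contractions_zero)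
next
  case True
  define A where "A = real (contractions k n m)"
  define B :: real where "B = fact (n - k) * fact (m - k)"
  have B: "B > 0" by (simp add: B_def)
  have AB: "A * B = fact n * fact m"
    using contractions_fact[of k n m] True unfolding A_def B_def
    by (metis of_nat_fact of_nat_mult)
  have A1: "A \<ge> 1"
  proof -
    have "contractions k n m \<noteq> 0"
      using contractions_fact[of k n m] True by (metis fact_nonzero mult_eq_0_iff)
    then show ?thesis unfolding A_def by linarith
  qed
  have "fact n = fact (n - k) * (fact k * real (n choose k))" if "k \<le> n" for n
    using binomial_fact[OF that, where 'a = real] by simp
  moreover have "real (n choose k) \<le> 2 ^ n" for n
    using binomial_le_pow2[of n k] by (metis of_nat_le_iff of_nat_numeral of_nat_power)
  ultimately have fl: "fact n \<le> fact (n - k) * (fact k * (2 :: real) ^ n)" if "k \<le> n" for n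
    using that by (metis mult_left_mono fact_ge_zero)
  have "A * B \<le> (fact (n - k) * (fact k * 2 ^ n)) * (fact (m - k) * (fact k * 2 ^ m))"
    unfolding AB using True by (intro mult_mono fl) auto
  also have "\<dots> = ((fact k)\<^sup>2 * 2 ^ (n + m)) * B"
    by (simp add: B_def power2_eq_square power_add)
  finally have "A \<le> (fact k)\<^sup>2 * 2 ^ (n + m)" using B by simp
  \<comment> \<open>The exponent is doubled to make the bound a perfect square, ready for the square
    root.\<close>
  also have "\<dots> \<le> (fact k)\<^sup>2 * (2 ^ (n + m))\<^sup>2"
    by (intro mult_left_mono self_le_power) auto
  finally have "A \<le> (fact k * 2 ^ (n + m))\<^sup>2" by (simp add: power_mult_distrib)
  then have "sqrt A \<le> fact k * 2 ^ (n + m)" by (intro real_le_lsqrt) auto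
  moreover have "A = A powr R * A powr (1 - R)" using A1 by (simp flip: powr_add)
  \<comment> \<open>\<open>1 - R\<close> is at most \<open>1 / 2\<close>. The other factor
    \<open>A powr R\<close> is kept: it will combine with \<open>B powr R\<close> into a power of
    \<open>fact n * fact m\<close>.\<close>
  moreover have "A powr (1 - R) \<le> A powr (1 / 2)" using A1 R by (intro powr_mono) auto
  ultimately have "A \<le> A powr R * (fact k * 2 ^ (n + m))"
    by (smt (verit) mult_left_mono powr_ge_zero powr_half_sqrt A1)
  then have 1: "A / fact k \<le> A powr R * 2 ^ (n + m)"
    by (simp add: field_simps)
  have eq: "n + m - 2 * k = (n - k) + (m - k)" using True by simp
  have "fact (n + m - 2 * k) \<le> (2 :: real) ^ (n + m - 2 * k) * B"
    using fact_add_le[of "n - k" "m - k"] by (simp add: eq B_def)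
  also have "\<dots> \<le> 2 ^ (n + m) * B"
    using B by (intro mult_right_mono power_increasing) auto
  finally have "fact (n + m - 2 * k) powr R \<le> (2 ^ (n + m) * B) powr R"
    using R by (intro powr_mono2) auto
  also have "\<dots> = (2 powr R) ^ (n + m) * B powr R"
    using B by (simp add: powr_mult powr_powr mult.commute flip: powr_realpow)
  finally have 2: "fact (n + m - 2 * k) powr R \<le> (2 powr R) ^ (n + m) * B powr R" .
  \<comment> \<open>In the base, \<open>2\<close> stems from the bound on \<open>A / fact k\<close>
    and \<open>2 powr R\<close> from the factorial of \<open>n + m - 2 * k\<close>.\<close>
  have "A / fact k * fact (n + m - 2 * k) powr R \<le>
      (A powr R * 2 ^ (n + m)) * ((2 powr R) ^ (n + m) * B powr R)"
    using A1 by (intro mult_mono 1 2) auto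
  also have "\<dots> = (2 * 2 powr R) ^ (n + m) * (A * B) powr R"
    using A1 B by (simp add: powr_mult power_mult_distrib)
  also have "\<dots> = (2 * 2 powr R) ^ (n + m) * (fact n powr R * fact m powr R)"
    by (simp add: AB powr_mult)
  finally show ?thesis by (simp add: A_def)
qed

lemma prod_list_omit:
  fixes p :: "'a \<Rightarrow> real"
  assumes "k < length vs"
  shows "p (vs ! k) * prod_list (map p (omit k vs)) = prod_list (map p vs)"
proof -
  have "prod_list (map p vs) = prod_list (map p (take k vs @ vs ! k # drop (Suc k) vs))"
    by (simp flip: id_take_nth_drop[OF assms])
  then show ?thesis by (simp add: omit_def mult_ac)
qed

context
  fixes \<Lambda> :: "'v::graded_complex_vector \<Rightarrow> 'v \<Rightarrow> complex" and p and R :: real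
  assumes \<Lambda>: "cbilinear \<Lambda>" and p: "graded_seminorm p" and R: "R \<ge> 1 / 2"
    and bound: "\<And>v w. cmod (\<Lambda> v w) \<le> p v * p w"
begin

lemma cseminorm_p: "cseminorm p"
  using p by (simp add: graded_seminorm_def)

text \<open>All \<open>n * m\<close> summands of a contraction obey the same bound, because the
  estimate of \<open>\<Lambda>\<close> restores exactly the seminorms of the two vectors that were
  removed.\<close>

lemma weyl_seminorm_contractions:
  "homogeneous_list ds vs \<Longrightarrow> homogeneous_list es ws \<Longrightarrow>
    weyl_seminorm p R (sym_mu ((P_op \<Lambda> ^^ k) (sym_prod vs \<otimes>\<^sub>C sym_prod ws))) \<le>
      real (contractions k (length vs) (length ws)) * fact (length vs + length ws - 2 * k) powr R *
        (prod_list (map p vs) * prod_list (map p ws))"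
proof (induction k arbitrary: ds vs es ws)
  case 0
  then have "homogeneous_list (ds @ es) (vs @ ws)"
    by (simp add: homogeneous_list_append homogeneous_list_length)
  from weyl_seminorm_sym_prod[OF cseminorm_p this] show ?case
    by (simp add: sym_mu_sym_prod)
next
  case (Suc k)
  let ?N = "\<lambda>x. weyl_seminorm p R (sym_mu ((P_op \<Lambda> ^^ k) x))"
  let ?n = "length vs" and ?m = "length ws"
  let ?B = "real (contractions k (?n - 1) (?m - 1)) * fact (?n + ?m - 2 * Suc k) powr R *
    (prod_list (map p vs) * prod_list (map p ws))"
  have N: "cseminorm ?N"
    by (rule cseminorm_compose[OF cseminorm_weyl_seminorm[OF cseminorm_p]])
      (rule clinear_compose[OF clinear_sym_mu clinear_P_op_power[OF \<Lambda>]])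
  have "?N ((contraction_sign ds es i j * \<Lambda> (vs ! i) (ws ! j)) *\<^sub>C
      (sym_prod (omit i vs) \<otimes>\<^sub>C sym_prod (omit j ws))) \<le> ?B" if ij: "i < ?n" "j < ?m" for i j
  proof -
    have len: "?n - 1 + (?m - 1) - 2 * k = ?n + ?m - 2 * Suc k"
      using ij by simp
    have "?N ((contraction_sign ds es i j * \<Lambda> (vs ! i) (ws ! j)) *\<^sub>C
        (sym_prod (omit i vs) \<otimes>\<^sub>C sym_prod (omit j ws))) =
      cmod (\<Lambda> (vs ! i) (ws ! j)) * ?N (sym_prod (omit i vs) \<otimes>\<^sub>C sym_prod (omit j ws))"
      by (simp add: cseminormD(2)[OF N] norm_mult contraction_sign_def norm_power)
    also have "\<dots> \<le> (p (vs ! i) * p (ws ! j)) *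
      (real (contractions k (?n - 1) (?m - 1)) * fact (?n + ?m - 2 * Suc k) powr R *
        (prod_list (map p (omit i vs)) * prod_list (map p (omit j ws))))"
      using Suc.IH[OF homogeneous_list_omit[OF Suc.prems(1), of i] homogeneous_list_omit[OF Suc.prems(2), of j]]
      unfolding len length_omit[OF ij(1)] length_omit[OF ij(2)]
      by (intro mult_mono bound) (auto simp: cseminorm_nonneg[OF cseminorm_p] cseminorm_nonneg[OF N])
    also have "\<dots> = real (contractions k (?n - 1) (?m - 1)) * fact (?n + ?m - 2 * Suc k) powr R *
        ((p (vs ! i) * prod_list (map p (omit i vs))) * (p (ws ! j) * prod_list (map p (omit j ws))))"
      by (simp add: mult_ac)
    finally show ?thesis by (simp only: prod_list_omit ij)
  qed
  then have "?N (P_op \<Lambda> (sym_prod vs \<otimes>\<^sub>C sym_prod ws)) \<le> (\<Sum>i<?n. \<Sum>j<?m. ?B)"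
    unfolding P_op_sym_prod[OF \<Lambda> Suc.prems]
    by (intro order_trans[OF cseminorm_sum[OF N]] sum_mono) auto
  then show ?case by (simp add: funpow_Suc_right mult.assoc del: funpow.simps)
qed

lemma weyl_seminorm_P_op_power:
  assumes "homogeneous_list ds vs" "homogeneous_list es ws"
  shows "weyl_seminorm p R (sym_mu ((P_op \<Lambda> ^^ k) (sym_prod vs \<otimes>\<^sub>C sym_prod ws))) / fact k \<le>
    (2 * 2 powr R) ^ (length vs + length ws) * (fact (length vs) powr R * fact (length ws) powr R) *
      (prod_list (map p vs) * prod_list (map p ws))"
proof -
  have nonneg: "0 \<le> prod_list (map p vs) * prod_list (map p ws)"
    by (intro mult_nonneg_nonneg prod_list_nonneg) (auto simp: cseminorm_nonneg[OF cseminorm_p])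
  have "weyl_seminorm p R (sym_mu ((P_op \<Lambda> ^^ k) (sym_prod vs \<otimes>\<^sub>C sym_prod ws))) / fact k \<le>
      real (contractions k (length vs) (length ws)) * fact (length vs + length ws - 2 * k) powr R *
        (prod_list (map p vs) * prod_list (map p ws)) / fact k"
    by (intro divide_right_mono weyl_seminorm_contractions[OF assms]) simp
  also have "\<dots> = (real (contractions k (length vs) (length ws)) / fact k * fact (length vs + length ws - 2 * k) powr R) *
        (prod_list (map p vs) * prod_list (map p ws))"
    by simp
  also have "\<dots> \<le> (2 * 2 powr R) ^ (length vs + length ws) * (fact (length vs) powr R * fact (length ws) powr R) *
      (prod_list (map p vs) * prod_list (map p ws))"
    by (rule mult_right_mono[OF contractions_bound[OF R] nonneg])
  finally show ?thesis .
qed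

text \<open>Origin of \<open>K\<close>: \<open>2 * 2 powr R\<close> comes from the count of
  contractions, \<open>max 1 (cmod z)\<close> turns \<open>cmod z ^ k\<close> into a power with
  exponent \<open>n + m\<close>, the next factor \<open>2\<close> absorbs the \<open>Suc n\<close>
  summands, and the outer \<open>2\<close> the splitting into parity parts.\<close>

lemma weyl_seminorm_star_product:
  fixes z :: complex
  defines "K \<equiv> 2 * (max 1 (cmod z) * (2 * (2 * 2 powr R)))"
  shows "weyl_seminorm p R (star_product z \<Lambda> a b) \<le>
    weyl_seminorm (\<lambda>v. K * p v) R a * weyl_seminorm (\<lambda>v. K * p v) R b"
proof -
  define M where "M = max 1 (cmod z)"
  define L where "L = M * (2 * (2 * 2 powr R))"
  have M: "1 \<le> M" "cmod z \<le> M" by (simp_all add: M_def)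
  have L: "0 \<le> L" using M by (simp add: L_def)
  have q: "graded_seminorm (\<lambda>v. L * p v)"
    using p L by (auto simp: graded_seminorm_def cseminorm_scaled intro: mult_left_mono)
  note N = cseminorm_weyl_seminorm[OF cseminorm_p, of R]
  have "weyl_seminorm p R (star_product z \<Lambda> a b) \<le>
    weyl_seminorm (\<lambda>v. 2 * (L * p v)) R a * weyl_seminorm (\<lambda>v. 2 * (L * p v)) R b"
  proof (rule weyl_seminorm_dominates_bilinear[OF cbilinear_star_product[OF \<Lambda>] N q])
    fix ds es and vs ws :: "'v list"
    assume h: "homogeneous_list ds vs" "homogeneous_list es ws"
    let ?n = "length vs" and ?m = "length ws"
    let ?x = "\<lambda>k. sym_mu ((P_op \<Lambda> ^^ k) (sym_prod vs \<otimes>\<^sub>C sym_prod ws))"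
    let ?W = "(fact ?n powr R * fact ?m powr R) * (prod_list (map p vs) * prod_list (map p ws))"
    have W: "0 \<le> ?W"
      by (intro mult_nonneg_nonneg prod_list_nonneg) (auto simp: cseminorm_nonneg[OF cseminorm_p])
    have "weyl_seminorm p R (star_product z \<Lambda> (sym_prod vs) (sym_prod ws)) =
        weyl_seminorm p R (\<Sum>k<Suc ?n. (z ^ k / fact k) *\<^sub>C ?x k)"
      by (subst star_product_eq[OF \<Lambda>, of "Suc ?n"]) (simp_all add: P_op_power_sym_prod_zero[OF \<Lambda> h])
    also have "\<dots> \<le> (\<Sum>k<Suc ?n. weyl_seminorm p R ((z ^ k / fact k) *\<^sub>C ?x k))"
      by (rule cseminorm_sum[OF N])
    also have "\<dots> \<le> (\<Sum>k<Suc ?n. M ^ (?n + ?m) * ((2 * 2 powr R) ^ (?n + ?m) * ?W))"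
    proof (rule sum_mono)
      fix k assume "k \<in> {..<Suc ?n}"
      then have k: "k \<le> ?n + ?m" by simp
      have "cmod z ^ k \<le> M ^ k" using M by (intro power_mono) auto
      also have "\<dots> \<le> M ^ (?n + ?m)" using M k by (intro power_increasing) auto
      finally have "cmod z ^ k * (weyl_seminorm p R (?x k) / fact k) \<le> M ^ (?n + ?m) * ((2 * 2 powr R) ^ (?n + ?m) * ?W)"
        using weyl_seminorm_P_op_power[OF h, of k] M
        by (intro mult_mono) (auto simp: mult.assoc cseminorm_nonneg[OF N])
      then show "weyl_seminorm p R ((z ^ k / fact k) *\<^sub>C ?x k) \<le> M ^ (?n + ?m) * ((2 * 2 powr R) ^ (?n + ?m) * ?W)"
        by (simp add: cseminormD(2)[OF N] norm_divide norm_power)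
    qed
    also have "\<dots> = real (Suc ?n) * (M ^ (?n + ?m) * ((2 * 2 powr R) ^ (?n + ?m) * ?W))"
      by simp
    also have "\<dots> \<le> 2 ^ (?n + ?m) * (M ^ (?n + ?m) * ((2 * 2 powr R) ^ (?n + ?m) * ?W))"
    proof (rule mult_right_mono)
      have "Suc ?n \<le> 2 ^ ?n" by (rule Suc_leI) (rule less_exp)
      also have "(2::nat) ^ ?n \<le> 2 ^ (?n + ?m)" by (intro power_increasing) auto
      finally show "real (Suc ?n) \<le> 2 ^ (?n + ?m)"
        by (metis of_nat_le_iff of_nat_numeral of_nat_power)
      show "0 \<le> M ^ (?n + ?m) * ((2 * 2 powr R) ^ (?n + ?m) * ?W)"
        using M by (intro mult_nonneg_nonneg[OF _ mult_nonneg_nonneg[OF _ W]]) auto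
    qed
    also have "\<dots> = L ^ (?n + ?m) * ?W"
      unfolding L_def power_mult_distrib by (simp add: mult_ac)
    also have "\<dots> = (fact ?n powr R * prod_list (map (\<lambda>v. L * p v) vs)) *
        (fact ?m powr R * prod_list (map (\<lambda>v. L * p v) ws))"
      by (simp add: prod_list_map_scaled power_add mult_ac)
    finally show "weyl_seminorm p R (star_product z \<Lambda> (sym_prod vs) (sym_prod ws)) \<le>
        (fact ?n powr R * prod_list (map (\<lambda>v. L * p v) vs)) *
        (fact ?m powr R * prod_list (map (\<lambda>v. L * p v) ws))" .
  qed
  then show ?thesis by (simp add: K_def L_def M_def mult.assoc)
qed

text \<open>A single contraction is the case \<open>k = 1\<close> of
  \<open>weyl_seminorm_P_op_power\<close>. The scalar \<open>2\<close> is the one in the Poisson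
  bracket, where the form is \<open>form_minus \<Lambda>\<close>.\<close>

lemma weyl_seminorm_contraction:
  defines "K \<equiv> 2 * (2 * (2 * 2 powr R))"
  shows "weyl_seminorm p R (2 *\<^sub>C sym_mu (P_op \<Lambda> (a \<otimes>\<^sub>C b))) \<le>
    2 * (weyl_seminorm (\<lambda>v. K * p v) R a * weyl_seminorm (\<lambda>v. K * p v) R b)"
proof -
  define L where "L = 2 * (2 * 2 powr R)"
  have q: "graded_seminorm (\<lambda>v. L * p v)"
    using p by (auto simp: graded_seminorm_def cseminorm_scaled L_def intro: mult_left_mono)
  note N = cseminorm_weyl_seminorm[OF cseminorm_p, of R]
  have b: "cbilinear (\<lambda>a b. sym_mu (P_op \<Lambda> (a \<otimes>\<^sub>C b)))"
    by (rule cbilinearI)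
      (simp_all add: tensor_of_linear clinear_simps[OF clinear_P_op[OF \<Lambda>]]
        clinear_simps[OF clinear_sym_mu])
  have "weyl_seminorm p R (sym_mu (P_op \<Lambda> (a \<otimes>\<^sub>C b))) \<le>
    weyl_seminorm (\<lambda>v. 2 * (L * p v)) R a * weyl_seminorm (\<lambda>v. 2 * (L * p v)) R b"
  proof (rule weyl_seminorm_dominates_bilinear[OF b N q])
    fix ds es and vs ws :: "'v list"
    assume h: "homogeneous_list ds vs" "homogeneous_list es ws"
    let ?n = "length vs" and ?m = "length ws"
    let ?W = "(fact ?n powr R * fact ?m powr R) * (prod_list (map p vs) * prod_list (map p ws))"
    have W: "0 \<le> ?W"
      by (intro mult_nonneg_nonneg prod_list_nonneg) (auto simp: cseminorm_nonneg[OF cseminorm_p])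
    have "weyl_seminorm p R (sym_mu (P_op \<Lambda> (sym_prod vs \<otimes>\<^sub>C sym_prod ws))) \<le> (2 * 2 powr R) ^ (?n + ?m) * ?W"
      using weyl_seminorm_P_op_power[OF h, of 1] by (simp add: mult.assoc)
    also have "\<dots> \<le> L ^ (?n + ?m) * ?W"
      using W by (intro mult_right_mono power_mono) (auto simp: L_def)
    also have "\<dots> = (fact ?n powr R * prod_list (map (\<lambda>v. L * p v) vs)) *
        (fact ?m powr R * prod_list (map (\<lambda>v. L * p v) ws))"
      by (simp add: prod_list_map_scaled power_add mult_ac)
    finally show "weyl_seminorm p R (sym_mu (P_op \<Lambda> (sym_prod vs \<otimes>\<^sub>C sym_prod ws))) \<le>
        (fact ?n powr R * prod_list (map (\<lambda>v. L * p v) vs)) *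
        (fact ?m powr R * prod_list (map (\<lambda>v. L * p v) ws))" .
  qed
  then show ?thesis by (simp add: cseminormD(2)[OF N] K_def L_def mult.assoc)
qed

end

lemma weyl_seminorm_sym_conj:
  fixes p :: "'v::graded_lcs complexified \<Rightarrow> real"
  assumes "graded_seminorm p"
  shows "weyl_seminorm p R (sym_conj a) \<le> weyl_seminorm (\<lambda>v. 2 * p (conj_vec v)) R a"
proof -
  have p: "cseminorm p" "\<And>e v. p (parity_part e v) \<le> p v"
    using assms by (simp_all add: graded_seminorm_def)
  note N = cseminorm_weyl_seminorm[OF p(1), of R]
  have "weyl_seminorm p R (sym_conj a) \<le> 1 * weyl_seminorm (\<lambda>v. 2 * p (conj_vec v)) R a"
  proof (rule weyl_seminorm_dominates)
    show "cseminorm (\<lambda>a. weyl_seminorm p R (sym_conj a))"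
      by (simp add: cseminorm_def sym_conj cseminormD[OF N])
    show "graded_seminorm (\<lambda>v. p (conj_vec v))"
      by (simp add: graded_seminorm_def cseminorm_def conj_vec_add conj_vec_scaleC cseminormD[OF p(1)]
          p(2) flip: parity_part_conj_vec)
    fix es and vs :: "'v complexified list"
    assume "homogeneous_list es vs"
    from weyl_seminorm_sym_prod[OF p(1) homogeneous_list_conj_vec[OF this], of R]
    show "weyl_seminorm p R (sym_conj (sym_prod vs)) \<le>
        1 * (fact (length vs) powr R * prod_list (map (\<lambda>v. p (conj_vec v)) vs))"
      by (simp add: sym_conj_sym_prod comp_def)
  qed simp
  then show ?thesis by simp
qed

section \<open>Continuous seminorms on the complexification\<close>

text \<open>The gauge of \<open>D\<close>. Local convexity is given through convex neighbourhoods of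
  zero, so a seminorm bounding a continuous form has to be manufactured from open sets.\<close>

definition minkowski :: "'v::real_vector set \<Rightarrow> 'v \<Rightarrow> real"
  where "minkowski D v = Inf {t. 0 < t \<and> inverse t *\<^sub>R v \<in> D}"

lemma open_scaleR_vimage:
  fixes D :: "'v::graded_lcs set"
  assumes "open D"
  shows "open {v. r *\<^sub>R v \<in> D}"
proof (subst open_subopen, rule ballI)
  fix v assume "v \<in> {v. r *\<^sub>R v \<in> D}"
  then have "eventually (\<lambda>w. w \<in> D) (nhds (r *\<^sub>R v))"
    using assms by (auto simp: eventually_nhds)
  then have "eventually (\<lambda>z. fst z *\<^sub>R snd z \<in> D) (nhds r \<times>\<^sub>F nhds v)"
    using tendsto_scaleR_Pair[of r v] by (rule eventually_compose_filterlim)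
  then obtain P Q where PQ: "eventually P (nhds r)" "eventually Q (nhds v)"
    "\<And>x y. P x \<Longrightarrow> Q y \<Longrightarrow> x *\<^sub>R y \<in> D"
    by (auto simp: eventually_prod_filter)
  have "P r" using PQ(1) by (rule eventually_nhds_x_imp_x)
  then have "eventually (\<lambda>w. r *\<^sub>R w \<in> D) (nhds v)"
    using PQ(2,3) by (auto elim: eventually_mono)
  then show "\<exists>T. open T \<and> v \<in> T \<and> T \<subseteq> {v. r *\<^sub>R v \<in> D}"
    by (auto simp: eventually_nhds)
qed

definition absolutely_convex_nhd :: "'v::{real_vector, topological_space} set \<Rightarrow> bool"
  where "absolutely_convex_nhd D \<longleftrightarrow> open D \<and> 0 \<in> D \<and> convex D \<and> (\<forall>x\<in>D. - x \<in> D)"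

context
  fixes D :: "'v::graded_lcs set"
  assumes ac: "absolutely_convex_nhd D"
begin

lemma nhd_D: "open D" "0 \<in> D"
  and convex_D: "x \<in> D \<Longrightarrow> y \<in> D \<Longrightarrow> 0 \<le> u \<Longrightarrow> 0 \<le> v \<Longrightarrow> u + v = 1 \<Longrightarrow> u *\<^sub>R x + v *\<^sub>R y \<in> D"
  and symmetric_D: "x \<in> D \<Longrightarrow> - x \<in> D"
  using ac by (auto simp: absolutely_convex_nhd_def convex_def)

text \<open>Scalar multiplication is continuous at \<open>(0, v)\<close>, so small multiples of
  \<open>v\<close> lie in \<open>D\<close>: neighbourhoods of zero are absorbing.\<close>

lemma minkowski_set_nonempty: "\<exists>t>0. inverse t *\<^sub>R v \<in> D"
proof -
  have "eventually (\<lambda>w. w \<in> D) (nhds (0 *\<^sub>R v))"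
    using nhd_D by (auto simp: eventually_nhds)
  then have "eventually (\<lambda>z. fst z *\<^sub>R snd z \<in> D) (nhds 0 \<times>\<^sub>F nhds v)"
    using tendsto_scaleR_Pair[of 0 v] by (rule eventually_compose_filterlim)
  then obtain P Q where PQ: "eventually P (nhds 0)" "eventually Q (nhds v)"
    "\<And>x y. P x \<Longrightarrow> Q y \<Longrightarrow> x *\<^sub>R y \<in> D"
    by (auto simp: eventually_prod_filter)
  obtain d where d: "d > 0" "\<And>x. dist x 0 < d \<Longrightarrow> P x"
    using PQ(1) by (auto simp: eventually_nhds_metric)
  have "(d / 2) *\<^sub>R v \<in> D"
    using d eventually_nhds_x_imp_x[OF PQ(2)] by (intro PQ(3)) auto
  then show ?thesis
    using d(1) by (intro exI[of _ "inverse (d / 2)"]) auto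
qed

lemma minkowski_mono_set:
  assumes "0 < t" "t \<le> s" "inverse t *\<^sub>R v \<in> D"
  shows "inverse s *\<^sub>R v \<in> D"
proof -
  have "(t / s) *\<^sub>R inverse t *\<^sub>R v + (1 - t / s) *\<^sub>R 0 \<in> D"
    using assms nhd_D(2) by (intro convex_D) auto
  moreover have "(t / s) * inverse t = inverse s"
    using assms(1) by (simp add: field_simps)
  ultimately show ?thesis by (simp only: scaleR_scaleR scaleR_zero_right add_0_right)
qed

lemma minkowski_le: "0 < t \<Longrightarrow> inverse t *\<^sub>R v \<in> D \<Longrightarrow> minkowski D v \<le> t"
  unfolding minkowski_def by (rule cInf_lower) (auto intro!: bdd_belowI[of _ 0])

lemma minkowski_nonneg: "0 \<le> minkowski D v"
  unfolding minkowski_def using minkowski_set_nonempty[of v] by (intro cInf_greatest) auto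

lemma minkowski_less:
  assumes "minkowski D v < s"
  shows "0 < s" "inverse s *\<^sub>R v \<in> D"
proof -
  obtain t where "0 < t" "inverse t *\<^sub>R v \<in> D" "t < s"
    using assms cInf_lessD[of "{t. 0 < t \<and> inverse t *\<^sub>R v \<in> D}" s] minkowski_set_nonempty[of v]
    unfolding minkowski_def by blast
  then show "0 < s" "inverse s *\<^sub>R v \<in> D"
    using minkowski_mono_set[of t s v] by auto
qed

text \<open>If \<open>v / s\<close> and \<open>w / t\<close> lie in \<open>D\<close>, then
  \<open>(v + w) / (s + t)\<close> is their convex combination with weights
  \<open>s / (s + t)\<close> and \<open>t / (s + t)\<close>.\<close>

lemma minkowski_add: "minkowski D (v + w) \<le> minkowski D v + minkowski D w"
proof (rule field_le_epsilon)
  fix e :: real assume "e > 0"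
  define s where "s = minkowski D v + e / 2"
  define t where "t = minkowski D w + e / 2"
  have "minkowski D v < s" "minkowski D w < t" using \<open>e > 0\<close> by (simp_all add: s_def t_def)
  note st = minkowski_less[OF this(1)] minkowski_less[OF this(2)]
  have "(s / (s + t)) *\<^sub>R inverse s *\<^sub>R v + (t / (s + t)) *\<^sub>R inverse t *\<^sub>R w \<in> D"
    using st by (intro convex_D) (auto simp flip: add_divide_distrib)
  moreover have "s / (s + t) * inverse s = inverse (s + t)" "t / (s + t) * inverse t = inverse (s + t)"
    using st by (simp_all add: field_simps)
  ultimately have "inverse (s + t) *\<^sub>R (v + w) \<in> D"
    by (simp only: scaleR_scaleR scaleR_add_right)
  then have "minkowski D (v + w) \<le> s + t"
    using st by (intro minkowski_le) auto
  then show "minkowski D (v + w) \<le> minkowski D v + minkowski D w + e"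
    by (simp add: s_def t_def)
qed

lemma minkowski_scaleR_le: "minkowski D (r *\<^sub>R v) \<le> \<bar>r\<bar> * minkowski D v"
proof (cases "r = 0")
  case True
  have "minkowski D 0 \<le> t" if "t > 0" for t
    using that nhd_D by (intro minkowski_le) auto
  then have "minkowski D 0 \<le> 0"
    by (meson dense not_le)
  then show ?thesis using True by simp
next
  case False
  show ?thesis
  proof (rule field_le_epsilon)
    fix e :: real assume "e > 0"
    define s where "s = minkowski D v + e / \<bar>r\<bar>"
    have "minkowski D v < s" using \<open>e > 0\<close> False by (simp add: s_def)
    note s = minkowski_less[OF this]
    have "inverse (\<bar>r\<bar> * s) *\<^sub>R r *\<^sub>R v \<in> D"
    proof (cases "r > 0")
      case True
      then have "inverse (\<bar>r\<bar> * s) * r = inverse s" using s(1) by (simp add: field_simps)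
      then show ?thesis using s(2) by (simp only: scaleR_scaleR)
    next
      case False
      then have "inverse (\<bar>r\<bar> * s) * r = - inverse s"
        using \<open>r \<noteq> 0\<close> s(1) by (simp add: field_simps)
      then show ?thesis using symmetric_D[OF s(2)] by (simp only: scaleR_scaleR scaleR_minus_left)
    qed
    then have "minkowski D (r *\<^sub>R v) \<le> \<bar>r\<bar> * s"
      using s False by (intro minkowski_le) auto
    then show "minkowski D (r *\<^sub>R v) \<le> \<bar>r\<bar> * minkowski D v + e"
      using False by (simp add: s_def distrib_left)
  qed
qed

lemma minkowski_less_one: "minkowski D v < 1 \<Longrightarrow> v \<in> D"
  using minkowski_less(2)[of v 1] by simp

lemma tendsto_minkowski: "(minkowski D \<longlongrightarrow> 0) (nhds 0)"
proof (rule tendstoI)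
  fix e :: real assume "e > 0"
  have "eventually (\<lambda>v. v \<in> {v. inverse (e / 2) *\<^sub>R v \<in> D}) (nhds 0)"
    using nhd_D(2) by (intro eventually_nhds_in_open open_scaleR_vimage nhd_D(1)) simp
  then show "eventually (\<lambda>v. dist (minkowski D v) 0 < e) (nhds 0)"
  proof (rule eventually_mono)
    fix v assume "v \<in> {v. inverse (e / 2) *\<^sub>R v \<in> D}"
    then have "minkowski D v \<le> e / 2"
      using \<open>e > 0\<close> by (intro minkowski_le) auto
    then show "dist (minkowski D v) 0 < e"
      using \<open>e > 0\<close> minkowski_nonneg[of v] by (simp add: dist_real_def)
  qed
qed

text \<open>The gauge of the real part is homogeneous for real scalars only; the supremum over all
  multiples by scalars of the unit disc makes it homogeneous for complex ones.\<close>

definition complex_minkowski :: "'v complexified \<Rightarrow> real"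
  where "complex_minkowski x = (SUP c\<in>cball 0 1. minkowski D (Re_part (c *\<^sub>C x)))"

text \<open>This bound serves twice: it makes the supremum finite, and it reduces continuity of
  \<open>complex_minkowski\<close> to that of the gauge at zero.\<close>

lemma minkowski_Re_part_le:
  assumes "cmod c \<le> 1"
  shows "minkowski D (Re_part (c *\<^sub>C x)) \<le> minkowski D (Re_part x) + minkowski D (Im_part x)"
proof -
  have *: "minkowski D (r *\<^sub>R v) \<le> minkowski D v" if "\<bar>r\<bar> \<le> 1" for r v
    using minkowski_scaleR_le[of r v] mult_right_mono[OF that minkowski_nonneg[of v]] by simp
  have "Re_part (c *\<^sub>C x) = Re c *\<^sub>R Re_part x + (- Im c) *\<^sub>R Im_part x"
    by (simp add: scaleC_complexified_def)
  then have "minkowski D (Re_part (c *\<^sub>C x)) \<le>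
      minkowski D (Re c *\<^sub>R Re_part x) + minkowski D ((- Im c) *\<^sub>R Im_part x)"
    by (simp only: minkowski_add)
  also have "\<dots> \<le> minkowski D (Re_part x) + minkowski D (Im_part x)"
    using assms abs_Re_le_cmod[of c] abs_Im_le_cmod[of c] by (intro add_mono *) auto
  finally show ?thesis .
qed

lemma bdd_above_minkowski: "bdd_above ((\<lambda>c. minkowski D (Re_part (c *\<^sub>C x))) ` cball 0 1)"
  by (rule bdd_aboveI2[of _ _ "minkowski D (Re_part x) + minkowski D (Im_part x)"])
    (simp add: minkowski_Re_part_le)

lemma complex_minkowski_ge: "cmod c \<le> 1 \<Longrightarrow> minkowski D (Re_part (c *\<^sub>C x)) \<le> complex_minkowski x"
  unfolding complex_minkowski_def by (rule cSUP_upper[OF _ bdd_above_minkowski]) simp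

lemma complex_minkowski_le:
  "(\<And>c. cmod c \<le> 1 \<Longrightarrow> minkowski D (Re_part (c *\<^sub>C x)) \<le> M) \<Longrightarrow> complex_minkowski x \<le> M"
  unfolding complex_minkowski_def by (rule cSUP_least) (auto intro: exI[of _ 0])

lemma cseminorm_complex_minkowski: "cseminorm complex_minkowski"
proof (rule cseminormI)
  fix x y c
  show "0 \<le> complex_minkowski x"
    using complex_minkowski_ge[of 0 x] minkowski_nonneg[of "Re_part (0 *\<^sub>C x)"] by simp
  show "complex_minkowski (x + y) \<le> complex_minkowski x + complex_minkowski y"
  proof (rule complex_minkowski_le)
    fix c :: complex assume c: "cmod c \<le> 1"
    have "minkowski D (Re_part (c *\<^sub>C (x + y))) \<le> minkowski D (Re_part (c *\<^sub>C x)) + minkowski D (Re_part (c *\<^sub>C y))"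
      unfolding scaleC_add_right using minkowski_add by (simp add: plus_complexified_def)
    also have "\<dots> \<le> complex_minkowski x + complex_minkowski y"
      using c by (intro add_mono complex_minkowski_ge)
    finally show "minkowski D (Re_part (c *\<^sub>C (x + y))) \<le> complex_minkowski x + complex_minkowski y" .
  qed
  show "complex_minkowski (c *\<^sub>C x) \<le> cmod c * complex_minkowski x"
  proof (rule complex_minkowski_le)
    fix d :: complex assume d: "cmod d \<le> 1"
    have "Re_part (d *\<^sub>C c *\<^sub>C x) = cmod c *\<^sub>R Re_part ((d * sgn c) *\<^sub>C x)"
    proof -
      \<comment> \<open>The phase of \<open>c\<close> is moved into \<open>d\<close>, which stays in
        the unit disc; what remains is the real factor \<open>cmod c\<close>, for which the gauge is
        homogeneous.\<close>
      have "d * c = of_real (cmod c) * (d * sgn c)"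
        by (cases "c = 0") (simp_all add: sgn_eq)
      then have "d *\<^sub>C c *\<^sub>C x = of_real (cmod c) *\<^sub>C (d * sgn c) *\<^sub>C x"
        by (simp only: scaleC_scaleC)
      then show ?thesis by (simp only: scaleC_complexified_def[of "of_real (cmod c)"]) simp
    qed
    then have "minkowski D (Re_part (d *\<^sub>C c *\<^sub>C x)) \<le> cmod c * minkowski D (Re_part ((d * sgn c) *\<^sub>C x))"
      using minkowski_scaleR_le[of "cmod c"] by simp
    also have "\<dots> \<le> cmod c * complex_minkowski x"
      using d by (intro mult_left_mono complex_minkowski_ge) (auto simp: norm_mult norm_sgn)
    finally show "minkowski D (Re_part (d *\<^sub>C c *\<^sub>C x)) \<le> cmod c * complex_minkowski x" .
  qed
qed

lemma complex_minkowski_less_one: "complex_minkowski x < 1 \<Longrightarrow> Re_part x \<in> D \<and> Im_part x \<in> D"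
proof -
  assume "complex_minkowski x < 1"
  \<comment> \<open>The scalar \<open>1\<close> selects the real part and \<open>- \<i>\<close> the
    imaginary part.\<close>
  then have "minkowski D (Re_part (1 *\<^sub>C x)) < 1" "minkowski D (Re_part ((- \<i>) *\<^sub>C x)) < 1"
    using complex_minkowski_ge[of 1 x] complex_minkowski_ge[of "- \<i>" x] by simp_all
  then show ?thesis
    by (auto intro!: minkowski_less_one simp: scaleC_one scaleC_complexified_def)
qed

end

lemma continuous_on_complexified:
  fixes f :: "'v::topological_space complexified \<Rightarrow> 'b::topological_space"
  shows "continuous_on UNIV f \<longleftrightarrow> continuous_on UNIV (\<lambda>(v, w). f (Cplx v w))"
proof -
  have "(\<lambda>(v, w). Cplx v w) -` (f -` B) = (\<lambda>(v, w). f (Cplx v w)) -` B" for B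
    by auto
  then show ?thesis
    by (simp add: continuous_on_open_vimage open_complexified_def)
qed

lemma continuous_seminorm_iff: "continuous_seminorm p \<longleftrightarrow> cseminorm p \<and> continuous_on UNIV p"
  by (auto simp: continuous_seminorm_def cseminorm_def)

lemma continuous_seminormD: "continuous_seminorm p \<Longrightarrow> cseminorm p"
  by (simp add: continuous_seminorm_iff)

lemma continuous_seminorm_ball:
  fixes U :: "'v::graded_lcs complexified set"
  assumes "open U" "0 \<in> U"
  obtains p where "continuous_seminorm p" "\<And>x. p x < 1 \<Longrightarrow> x \<in> U"
proof -
  have "open ((\<lambda>(v, w). Cplx v w) -` U)" "(0, 0) \<in> (\<lambda>(v, w). Cplx v w) -` U"
    using assms by (simp_all add: open_complexified_def zero_complexified_def)
  then obtain A B where AB: "open A" "open B" "0 \<in> A" "0 \<in> B" "A \<times> B \<subseteq> (\<lambda>(v, w). Cplx v w) -` U"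
    by (metis mem_Sigma_iff open_prod_elim)
  obtain C where C: "open C" "0 \<in> C" "C \<subseteq> A \<inter> B"
    "\<And>x y u v. x \<in> C \<Longrightarrow> y \<in> C \<Longrightarrow> 0 \<le> u \<Longrightarrow> 0 \<le> v \<Longrightarrow> u + v = 1 \<Longrightarrow> u *\<^sub>R x + v *\<^sub>R y \<in> C"
    using locally_convex_nhds_0[of "A \<inter> B"] AB by (metis IntI open_Int)
  \<comment> \<open>Intersecting with the reflected set makes the convex neighbourhood symmetric, as
    the gauge requires for negative scalars.\<close>
  define D where "D = C \<inter> {v. (-1) *\<^sub>R v \<in> C}"
  have "u *\<^sub>R x + v *\<^sub>R y \<in> D" if "x \<in> D" "y \<in> D" "0 \<le> u" "0 \<le> v" "u + v = 1" for x y u v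
    using that C(4)[of x y u v] C(4)[of "- x" "- y" u v] by (auto simp: D_def)
  then have facts: "absolutely_convex_nhd D"
    using C open_scaleR_vimage[of C "-1"] by (auto simp: absolutely_convex_nhd_def convex_def D_def)
  let ?p = "complex_minkowski D" and ?g = "minkowski D"
  have p: "cseminorm ?p"
    by (rule cseminorm_complex_minkowski[OF facts])
  have le: "?p x \<le> ?g (Re_part x) + ?g (Im_part x)" for x
    by (rule complex_minkowski_le[OF facts]) (rule minkowski_Re_part_le[OF facts])
  \<comment> \<open>The variation of a seminorm is at most its value at the difference of the
    arguments, and the gauges of the two components tend to \<open>0\<close> there.\<close>
  have "((\<lambda>(v, w). ?p (Cplx v w)) \<longlongrightarrow> ?p (Cplx v w)) (at (v, w))" for v w
  proof (rule Lim_null[THEN iffD2], rule Lim_null_comparison)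
    show "eventually (\<lambda>z. norm ((case z of (v, w) \<Rightarrow> ?p (Cplx v w)) - ?p (Cplx v w)) \<le>
        ?g (fst z - v) + ?g (snd z - w)) (at (v, w))"
    proof (rule always_eventually, rule allI)
      fix z :: "'v \<times> 'v"
      obtain v' w' where [simp]: "z = (v', w')" by (cases z)
      have d: "Cplx v' w' - Cplx v w = Cplx (v' - v) (w' - w)"
        by (simp add: minus_complexified_def)
      have "?p (Cplx v' w') \<le> ?p (Cplx v w) + ?p (Cplx v' w' - Cplx v w)"
        using cseminormD(1)[OF p, of "Cplx v w" "Cplx v' w' - Cplx v w"] by simp
      moreover have "?p (Cplx v w) \<le> ?p (Cplx v' w') + ?p (Cplx v' w' - Cplx v w)"
        using cseminorm_diff[OF p, of "Cplx v' w'" "Cplx v' w' - Cplx v w"] by simp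
      ultimately show "norm ((case z of (v, w) \<Rightarrow> ?p (Cplx v w)) - ?p (Cplx v w)) \<le>
          ?g (fst z - v) + ?g (snd z - w)"
        using le[of "Cplx (v' - v) (w' - w)"] by (simp add: d)
    qed
    have "((\<lambda>z. fst z - v) \<longlongrightarrow> fst (v, w) - v) (at (v, w))" "((\<lambda>z. snd z - w) \<longlongrightarrow> snd (v, w) - w) (at (v, w))"
      by (intro tendsto_diff tendsto_const tendsto_fst tendsto_snd tendsto_ident_at)+
    then have "((\<lambda>z. ?g (fst z - v)) \<longlongrightarrow> 0) (at (v, w))" "((\<lambda>z. ?g (snd z - w)) \<longlongrightarrow> 0) (at (v, w))"
      by (auto intro!: filterlim_compose[OF tendsto_minkowski[OF facts]])
    then show "((\<lambda>z. ?g (fst z - v) + ?g (snd z - w)) \<longlongrightarrow> 0) (at (v, w))"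
      using tendsto_add by fastforce
  qed
  then have "continuous_on UNIV (\<lambda>(v, w). ?p (Cplx v w))"
    by (auto simp: continuous_on_def)
  then have "continuous_seminorm ?p"
    using p by (simp add: continuous_seminorm_iff continuous_on_complexified)
  moreover have "x \<in> U" if "?p x < 1" for x
  proof -
    have "(Re_part x, Im_part x) \<in> A \<times> B"
      using complex_minkowski_less_one[OF facts that] C(3) by (auto simp: D_def)
    with AB(5) have "(Re_part x, Im_part x) \<in> (\<lambda>(v, w). Cplx v w) -` U" by blast
    then show ?thesis by simp
  qed
  ultimately show thesis by (rule that)
qed

section \<open>Parity compatible seminorms and bounds for continuous forms\<close>

lemma continuous_seminorm_add:
  "continuous_seminorm p \<Longrightarrow> continuous_seminorm q \<Longrightarrow> continuous_seminorm (\<lambda>v. p v + q v)"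
  by (auto simp: continuous_seminorm_iff cseminorm_def distrib_left intro!: continuous_on_add)
    (smt (verit, best))

lemma continuous_seminorm_scaled:
  "continuous_seminorm p \<Longrightarrow> 0 \<le> r \<Longrightarrow> continuous_seminorm (\<lambda>v. r * p v)"
  by (auto simp: continuous_seminorm_iff cseminorm_scaled intro!: continuous_on_mult continuous_on_const)

lemma continuous_on_parity_part: "continuous_on UNIV (parity_part e :: 'v::graded_lcs \<Rightarrow> 'v)"
proof -
  have "continuous_on UNIV (even_part :: 'v \<Rightarrow> 'v)"
    unfolding continuous_on_def by (metis tendsto_even_part filterlim_mono at_within_le_nhds order_refl)
  then show ?thesis
    by (cases e) (auto simp: parity_part_def[abs_def] intro!: continuous_on_diff continuous_on_id)
qed

lemma parity_part_Cplx: "parity_part e (Cplx v w) = Cplx (parity_part e v) (parity_part e (w :: 'v::graded_lcs))"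
  by (simp add: parity_part_def even_part_complexified_def minus_complexified_def)

lemma continuous_seminorm_compose_Cplx:
  fixes p :: "'v::graded_lcs complexified \<Rightarrow> real"
  assumes p: "continuous_seminorm p" and f: "\<And>v w. f (Cplx v w) = Cplx (g v) (h w)"
    and "continuous_on UNIV g" "continuous_on UNIV h"
  shows "continuous_on UNIV (\<lambda>x. p (f x))"
proof -
  have "continuous_on UNIV (\<lambda>(v, w). p (Cplx v w))"
    using p by (simp add: continuous_seminorm_iff continuous_on_complexified)
  moreover have "continuous_on UNIV (\<lambda>z. (g (fst z), h (snd z)))"
    by (intro continuous_on_Pair continuous_on_compose2[OF assms(3)] continuous_on_compose2[OF assms(4)]
        continuous_on_fst continuous_on_snd continuous_on_id) auto
  ultimately have "continuous_on UNIV (\<lambda>z. case (g (fst z), h (snd z)) of (v, w) \<Rightarrow> p (Cplx v w))"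
    by (rule continuous_on_compose2) simp
  then show ?thesis
    by (simp add: continuous_on_complexified f case_prod_unfold)
qed

lemma continuous_seminorm_conj_vec:
  fixes p :: "'v::graded_lcs complexified \<Rightarrow> real"
  assumes "continuous_seminorm p"
  shows "continuous_seminorm (\<lambda>v. p (conj_vec v))"
proof -
  have "continuous_on UNIV (\<lambda>v. p (conj_vec v))"
    by (rule continuous_seminorm_compose_Cplx[OF assms, of _ "\<lambda>v. v" uminus])
      (auto simp: conj_vec_def intro!: continuous_on_minus continuous_on_id)
  with assms show ?thesis
    by (simp add: continuous_seminorm_iff cseminorm_def conj_vec_add conj_vec_scaleC)
qed

text \<open>The sum of \<open>p\<close> over the two parity parts dominates \<open>p\<close> by the
  triangle inequality, and each parity projection deletes one of its summands.\<close>

lemma graded_hull: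
  fixes p :: "'v::graded_lcs complexified \<Rightarrow> real"
  assumes "continuous_seminorm p"
  obtains q where "continuous_seminorm q" "graded_seminorm q" "\<And>v. p v \<le> q v"
proof -
  define q where "q v = p (parity_part False v) + p (parity_part True v)" for v
  note p = continuous_seminormD[OF assms]
  have "continuous_seminorm (\<lambda>v. p (parity_part e v))" for e
  proof -
    have "continuous_on UNIV (\<lambda>v. p (parity_part e v))"
      by (rule continuous_seminorm_compose_Cplx[OF assms, where f = "parity_part e",
            OF parity_part_Cplx continuous_on_parity_part continuous_on_parity_part])
    then show ?thesis
      by (simp add: continuous_seminorm_iff cseminorm_compose[OF p clinear_parity_part])
  qed
  then have q: "continuous_seminorm q"
    unfolding q_def by (intro continuous_seminorm_add)
  have "q (parity_part e v) \<le> q v" for e v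
    by (cases e) (simp_all add: q_def parity_part_parity_part cseminorm_zero[OF p] cseminorm_nonneg[OF p])
  then have "graded_seminorm q"
    using continuous_seminormD[OF q] by (simp add: graded_seminorm_def)
  moreover have "p v \<le> q v" for v
    using cseminormD(1)[OF p, of "parity_part False v" "parity_part True v"]
    by (simp add: q_def parity_part_False_True)
  ultimately show thesis using q that by blast
qed

text \<open>Continuity at the origin makes \<open>\<Lambda>\<close> smaller than \<open>1\<close> on
  a product of unit balls; rescaling both arguments gives the bound by a product of
  seminorms.\<close>

lemma continuous_form_bound:
  fixes \<Lambda> :: "'v::graded_lcs complexified \<Rightarrow> 'v complexified \<Rightarrow> complex"
  assumes b: "cbilinear \<Lambda>" and c: "continuous_on UNIV (\<lambda>(v, w). \<Lambda> v w)"
  obtains q where "continuous_seminorm q" "graded_seminorm q" "\<And>v w. cmod (\<Lambda> v w) \<le> q v * q w"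
proof -
  let ?U = "(\<lambda>(v, w). \<Lambda> v w) -` ball 0 1"
  have "open ?U"
    using c by (simp add: continuous_on_open_vimage)
  moreover have "(0, 0) \<in> ?U" by (simp add: cbilinear_zero[OF b])
  ultimately obtain A B where AB: "open A" "open B" "0 \<in> A" "0 \<in> B" "A \<times> B \<subseteq> ?U"
    by (metis mem_Sigma_iff open_prod_elim)
  obtain p where p: "continuous_seminorm p" "\<And>x. p x < 1 \<Longrightarrow> x \<in> A \<inter> B"
    using continuous_seminorm_ball[of "A \<inter> B"] AB by (metis IntI open_Int)
  note p' = continuous_seminormD[OF p(1)]
  have 1: "cmod (\<Lambda> v w) < s * t" if "p v < s" "p w < t" for v w s t
  proof -
    have st: "s > 0" "t > 0"
      using that cseminorm_nonneg[OF p'] by (meson le_less_trans)+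
    have "p (of_real (inverse s) *\<^sub>C v) < 1" "p (of_real (inverse t) *\<^sub>C w) < 1"
      using that st by (simp_all add: cseminormD(2)[OF p'] norm_inverse norm_divide field_simps)
    then have "(of_real (inverse s) *\<^sub>C v, of_real (inverse t) *\<^sub>C w) \<in> ?U"
      using p(2) AB(5) by blast
    then have "cmod (of_real (inverse s) * (of_real (inverse t) * \<Lambda> v w)) < 1"
      by (simp add: cbilinearD[OF b] scaleC_complex_def mult.left_commute)
    then show ?thesis
      using st by (simp add: norm_mult norm_inverse norm_divide field_simps)
  qed
  have le: "cmod (\<Lambda> v w) \<le> p v * p w" for v w
  proof (rule field_le_epsilon)
    fix e :: real assume e: "e > 0"
    have nn: "0 \<le> p v" "0 \<le> p w" using cseminorm_nonneg[OF p'] by auto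
    \<comment> \<open>\<open>p v\<close> or \<open>p w\<close> may vanish, so the arguments are
      scaled by \<open>p v + d\<close> and \<open>p w + d\<close>, with \<open>d\<close> so small
      that the excess is at most \<open>e\<close>.\<close>
    define d where "d = min 1 (e / (p v + p w + 1))"
    have d: "0 < d" "d \<le> 1" "d \<le> e / (p v + p w + 1)"
      using nn e by (simp_all add: d_def)
    have "cmod (\<Lambda> v w) < (p v + d) * (p w + d)"
      using d(1) by (intro 1) auto
    also have "\<dots> = p v * p w + d * (p v + p w + d)"
      by (simp add: algebra_simps)
    also have "d * (p v + p w + d) \<le> d * (p v + p w + 1)"
      using d by (intro mult_left_mono) auto
    also have "\<dots> \<le> e"
      using d(3) nn by (simp add: pos_le_divide_eq)
    finally show "cmod (\<Lambda> v w) \<le> p v * p w + e" by simp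
  qed
  obtain q where q: "continuous_seminorm q" "graded_seminorm q" "\<And>v. p v \<le> q v"
    using graded_hull[OF p(1)] by blast
  have "cmod (\<Lambda> v w) \<le> q v * q w" for v w
    using le[of v w] mult_mono[OF q(3)[of v] q(3)[of w]] cseminorm_nonneg[OF p']
      cseminorm_nonneg[OF continuous_seminormD[OF q(1)]]
    by (meson order_trans)
  with q show thesis using that by blast
qed

text \<open>The flipped form is a sum of four terms, each bounded by \<open>q v * q w\<close>, so
  \<open>form_minus\<close> is bounded by \<open>5 / 2\<close> of this product. The larger square
  \<open>9\<close> allows the same factor \<open>3\<close> in both arguments.\<close>

lemma form_minus_bound:
  assumes q: "graded_seminorm q" and le: "\<And>v w. cmod (\<Lambda> v w) \<le> q v * q w"
  shows "cmod (form_minus \<Lambda> v w) \<le> (3 * q v) * (3 * q w)"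
proof -
  have q': "cseminorm q" "\<And>e v. q (parity_part e v) \<le> q v"
    using q by (simp_all add: graded_seminorm_def)
  note nn = cseminorm_nonneg[OF q'(1)]
  have "cmod (parity_sign d e * \<Lambda> (parity_part e w) (parity_part d v)) \<le> q v * q w" for d e
  proof -
    have "cmod (parity_sign d e * \<Lambda> (parity_part e w) (parity_part d v)) = cmod (\<Lambda> (parity_part e w) (parity_part d v))"
      by (simp add: norm_mult parity_sign_def)
    also have "\<dots> \<le> q (parity_part e w) * q (parity_part d v)" by (rule le)
    also have "\<dots> \<le> q w * q v" by (intro mult_mono q'(2) nn)
    finally show ?thesis by (simp add: mult.commute)
  qed
  then have "cmod (flip_form \<Lambda> v w) \<le> (\<Sum>d\<in>(UNIV :: bool set). \<Sum>e\<in>(UNIV :: bool set). q v * q w)"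
    unfolding flip_form_def by (intro sum_norm_le)
  then have "cmod (flip_form \<Lambda> v w) \<le> 4 * (q v * q w)"
    by simp
  moreover have "cmod (form_minus \<Lambda> v w) \<le> (cmod (\<Lambda> v w) + cmod (flip_form \<Lambda> v w)) / 2"
    unfolding form_minus_def by (simp add: norm_divide norm_triangle_ineq4)
  ultimately show ?thesis
    using le[of v w] mult_nonneg_nonneg[OF nn nn, of v w] by simp
qed

section \<open>Continuity of the operations\<close>

definition weyl_bounded2 ::
    "real \<Rightarrow> ('v::{graded_complex_vector, topological_space} symmetric_algebra \<Rightarrow> 'v symmetric_algebra
      \<Rightarrow> 'v symmetric_algebra) \<Rightarrow> bool"
  where "weyl_bounded2 R f \<longleftrightarrow> cbilinear f \<and> (\<forall>p. continuous_seminorm p \<longrightarrow>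
    (\<exists>q C. continuous_seminorm q \<and> 0 < C \<and>
      (\<forall>a b. weyl_seminorm p R (f a b) \<le> C * (weyl_seminorm q R a * weyl_seminorm q R b))))"

context
  fixes \<Lambda> :: "'v::graded_lcs complexified \<Rightarrow> 'v complexified \<Rightarrow> complex" and R :: real
  assumes b: "cbilinear \<Lambda>" and c: "continuous_on UNIV (\<lambda>(v, w). \<Lambda> v w)" and R: "R \<ge> 1 / 2"
begin

lemma form_seminorm_exists:
  assumes "continuous_seminorm p"
  obtains q where "continuous_seminorm q" "graded_seminorm q" "\<And>v. p v \<le> q v"
    "\<And>v w. cmod (\<Lambda> v w) \<le> q v * q w" "\<And>v w. cmod (form_minus \<Lambda> v w) \<le> q v * q w"
proof -
  obtain s where s: "continuous_seminorm s" "graded_seminorm s" "\<And>v w. cmod (\<Lambda> v w) \<le> s v * s w"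
    using continuous_form_bound[OF b c] by blast
  obtain r where r: "continuous_seminorm r" "graded_seminorm r" "\<And>v. p v \<le> r v"
    using graded_hull[OF assms] by blast
  have nn: "0 \<le> s v" "0 \<le> r v" for v
    using s(1) r(1) by (simp_all add: cseminorm_nonneg continuous_seminormD)
  \<comment> \<open>\<open>r\<close> dominates \<open>p\<close>, and \<open>3 * s\<close> is the
    seminorm from \<open>form_minus_bound\<close>; their sum serves all bounds at once.\<close>
  define q where "q v = r v + 3 * s v" for v
  have q: "continuous_seminorm q"
    unfolding q_def by (intro continuous_seminorm_add continuous_seminorm_scaled r s) simp
  have "graded_seminorm q"
    using r(2) s(2) continuous_seminormD[OF q] unfolding graded_seminorm_def q_def
    by (auto intro!: add_mono)
  moreover have "p v \<le> q v" for v
    using r(3)[of v] nn[of v] by (simp add: q_def)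
  moreover have "cmod (\<Lambda> v w) \<le> q v * q w" for v w
  proof -
    have "s v * s w \<le> q v * q w" using nn by (intro mult_mono) (auto simp: q_def)
    then show ?thesis using s(3)[of v w] by simp
  qed
  moreover have "cmod (form_minus \<Lambda> v w) \<le> q v * q w" for v w
  proof -
    have "(3 * s v) * (3 * s w) \<le> q v * q w" using nn by (intro mult_mono) (auto simp: q_def)
    then show ?thesis using form_minus_bound[OF s(2,3), of v w] by simp
  qed
  ultimately show thesis using q that by blast
qed

lemma weyl_bounded2_star_product: "weyl_bounded2 R (star_product z \<Lambda>)"
  unfolding weyl_bounded2_def
proof (intro conjI allI impI)
  fix p :: "'v complexified \<Rightarrow> real"
  assume p: "continuous_seminorm p"
  obtain q where q: "continuous_seminorm q" "graded_seminorm q" "\<And>v. p v \<le> q v"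
    "\<And>v w. cmod (\<Lambda> v w) \<le> q v * q w" "\<And>v w. cmod (form_minus \<Lambda> v w) \<le> q v * q w"
    using form_seminorm_exists[OF p] by blast
  define K where "K = 2 * (max 1 (cmod z) * (2 * (2 * 2 powr R)))"
  have "0 \<le> K" by (simp add: K_def)
  then have "continuous_seminorm (\<lambda>v. K * q v)"
    by (rule continuous_seminorm_scaled[OF q(1)])
  moreover have "weyl_seminorm p R (star_product z \<Lambda> a b) \<le>
      1 * (weyl_seminorm (\<lambda>v. K * q v) R a * weyl_seminorm (\<lambda>v. K * q v) R b)" for a b
    using weyl_seminorm_mono[OF continuous_seminormD[OF p] continuous_seminormD[OF q(1)] q(3), of R "star_product z \<Lambda> a b"]
      weyl_seminorm_star_product[OF b q(2) R q(4), of z a b]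
    unfolding K_def by simp
  ultimately show "\<exists>q C. continuous_seminorm q \<and> 0 < C \<and>
      (\<forall>a b. weyl_seminorm p R (star_product z \<Lambda> a b) \<le> C * (weyl_seminorm q R a * weyl_seminorm q R b))"
    by (meson zero_less_one)
qed (rule cbilinear_star_product[OF b])

lemma weyl_bounded2_poisson_bracket: "weyl_bounded2 R (poisson_bracket \<Lambda>)"
  unfolding weyl_bounded2_def
proof (intro conjI allI impI)
  fix p :: "'v complexified \<Rightarrow> real"
  assume p: "continuous_seminorm p"
  obtain q where q: "continuous_seminorm q" "graded_seminorm q" "\<And>v. p v \<le> q v"
    "\<And>v w. cmod (\<Lambda> v w) \<le> q v * q w" "\<And>v w. cmod (form_minus \<Lambda> v w) \<le> q v * q w"
    using form_seminorm_exists[OF p] by blast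
  define K where "K = 2 * (2 * (2 * 2 powr R))"
  have "0 \<le> K" by (simp add: K_def)
  then have "continuous_seminorm (\<lambda>v. K * q v)"
    by (rule continuous_seminorm_scaled[OF q(1)])
  moreover have "weyl_seminorm p R (poisson_bracket \<Lambda> a b) \<le>
      2 * (weyl_seminorm (\<lambda>v. K * q v) R a * weyl_seminorm (\<lambda>v. K * q v) R b)" for a b
    using weyl_seminorm_mono[OF continuous_seminormD[OF p] continuous_seminormD[OF q(1)] q(3), of R "poisson_bracket \<Lambda> a b"]
      weyl_seminorm_contraction[OF cbilinear_form_minus[OF b] q(2) R q(5), of a b]
    unfolding K_def poisson_bracket_def by simp
  ultimately show "\<exists>q C. continuous_seminorm q \<and> 0 < C \<and>
      (\<forall>a b. weyl_seminorm p R (poisson_bracket \<Lambda> a b) \<le> C * (weyl_seminorm q R a * weyl_seminorm q R b))"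
    by (meson zero_less_numeral)
qed (rule cbilinear_poisson_bracket[OF b])

end

lemma weyl_seminorm_sym_conj_bound:
  fixes p :: "'v::graded_lcs complexified \<Rightarrow> real"
  assumes "continuous_seminorm p"
  obtains q where "continuous_seminorm q" "\<And>a. weyl_seminorm p R (sym_conj a) \<le> weyl_seminorm q R a"
proof -
  obtain r where r: "continuous_seminorm r" "graded_seminorm r" "\<And>v. p v \<le> r v"
    using graded_hull[OF assms] by blast
  have "continuous_seminorm (\<lambda>v. 2 * r (conj_vec v))"
    by (intro continuous_seminorm_scaled continuous_seminorm_conj_vec r) simp
  moreover have "weyl_seminorm p R (sym_conj a) \<le> weyl_seminorm (\<lambda>v. 2 * r (conj_vec v)) R a" for a
    using weyl_seminorm_mono[OF continuous_seminormD[OF assms] continuous_seminormD[OF r(1)] r(3), of R "sym_conj a"]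
      weyl_seminorm_sym_conj[OF r(2), of R a] by simp
  ultimately show thesis by (rule that)
qed

section \<open>The topology of the Weyl algebra\<close>

lemma topspace_weyl_topology:
  "topspace (weyl_topology R :: 'v::graded_lcs complexified symmetric_algebra topology) = UNIV"
proof -
  have p: "continuous_seminorm (\<lambda>v :: 'v complexified. 0)"
    by (simp add: continuous_seminorm_def)
  have "a \<in> {b. weyl_seminorm (\<lambda>v. 0) R (b - a) < 1}" for a :: "'v complexified symmetric_algebra"
    using cseminorm_zero[OF cseminorm_weyl_seminorm[OF continuous_seminormD[OF p]]] by simp
  then show ?thesis
    unfolding weyl_topology_def topology_generated_by_topspace using p by blast
qed

lemma openin_weyl_ball:
  "continuous_seminorm p \<Longrightarrow> openin (weyl_topology R) {b. weyl_seminorm p R (b - a) < r}"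
  unfolding weyl_topology_def by (rule topology_generated_by_Basis) blast

text \<open>The generating sets form a subbasis with arbitrary centres. Balls around the given point
  are a base there, because two seminorms are dominated by that of \<open>p + q\<close> and a ball
  can be recentred by the triangle inequality.\<close>

lemma openin_weyl_topologyD:
  fixes U :: "'v::graded_lcs complexified symmetric_algebra set"
  assumes "openin (weyl_topology R) U" "a \<in> U"
  obtains p r where "continuous_seminorm p" "r > 0" "{b. weyl_seminorm p R (b - a) < r} \<subseteq> U"
proof -
  have "generate_topology_on {{b. weyl_seminorm p R (b - a) < r} | p a r. continuous_seminorm p} U"
    using assms(1) unfolding weyl_topology_def by (rule openin_topology_generated_by)
  then have "\<exists>p r. continuous_seminorm p \<and> r > 0 \<and> {b. weyl_seminorm p R (b - a) < r} \<subseteq> U"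
    using assms(2)
  proof (induction arbitrary: a rule: generate_topology_on.induct)
    case (Int U V)
    obtain p r where p: "continuous_seminorm p" "r > 0" "{b. weyl_seminorm p R (b - a) < r} \<subseteq> U"
      using Int by blast
    obtain q s where q: "continuous_seminorm q" "s > 0" "{b. weyl_seminorm q R (b - a) < s} \<subseteq> V"
      using Int by blast
    let ?m = "\<lambda>v. p v + q v"
    note m = continuous_seminorm_add[OF p(1) q(1)]
    note nn = cseminorm_nonneg[OF continuous_seminormD[OF p(1)]] cseminorm_nonneg[OF continuous_seminormD[OF q(1)]]
    have "weyl_seminorm p R b \<le> weyl_seminorm ?m R b" "weyl_seminorm q R b \<le> weyl_seminorm ?m R b" for b
      by (rule weyl_seminorm_mono; use m p(1) q(1) nn in \<open>simp add: continuous_seminormD\<close>)+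
    then have "{b. weyl_seminorm ?m R (b - a) < min r s} \<subseteq> U \<inter> V"
      using p(3) q(3) by (fastforce intro: le_less_trans)
    then show ?case
      using m p(2) q(2) by (intro exI[of _ ?m] exI[of _ "min r s"]) auto
  next
    case (UN K)
    then show ?case by (meson Union_iff Union_upper subset_trans)
  next
    case (Basis s)
    then obtain p a' r where s: "s = {b. weyl_seminorm p R (b - a') < r}" "continuous_seminorm p" by blast
    note N = cseminorm_weyl_seminorm[OF continuous_seminormD[OF s(2)], of R]
    have "weyl_seminorm p R (b - a') < r" if "weyl_seminorm p R (b - a) < r - weyl_seminorm p R (a - a')" for b
      using that cseminormD(1)[OF N, of "b - a" "a - a'"] by simp
    then show ?case
      using s Basis(2) by (intro exI[of _ p] exI[of _ "r - weyl_seminorm p R (a - a')"]) auto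
  qed simp
  then show thesis using that by blast
qed

section \<open>Extension to the completion\<close>

lemma nhd_add:
  fixes U :: "'w::topological_group_add set"
  assumes "open U" "0 \<in> U"
  obtains V where "open V" "0 \<in> V" "\<And>x y. x \<in> V \<Longrightarrow> y \<in> V \<Longrightarrow> x + y \<in> U"
proof -
  have "open ((\<lambda>z. fst z + snd z) -` U)"
    by (intro open_vimage assms continuous_intros)
  moreover have "(0, 0) \<in> (\<lambda>z. fst z + snd z) -` U" using assms by simp
  ultimately obtain A B where "open A" "open B" "(0, 0) \<in> A \<times> B" "A \<times> B \<subseteq> (\<lambda>z. fst z + snd z) -` U"
    by (rule open_prod_elim)
  then show thesis by (intro that[of "A \<inter> B"]) auto
qed

lemma nhd_diff:
  fixes U :: "'w::topological_group_add set"
  assumes "open U" "0 \<in> U"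
  obtains V where "open V" "z \<in> V" "\<And>x y. x \<in> V \<Longrightarrow> y \<in> V \<Longrightarrow> x - y \<in> U"
proof -
  have "open ((\<lambda>z. fst z - snd z) -` U)"
    by (intro open_vimage assms continuous_intros)
  moreover have "(z, z) \<in> (\<lambda>z. fst z - snd z) -` U" using assms by simp
  ultimately obtain A B where "open A" "open B" "(z, z) \<in> A \<times> B" "A \<times> B \<subseteq> (\<lambda>z. fst z - snd z) -` U"
    by (rule open_prod_elim)
  then show thesis by (intro that[of "A \<inter> B"]) auto
qed

text \<open>The oscillation condition is local at every point, including limit points outside
  \<open>S\<close>. It makes the image of the trace of each neighbourhood filter on \<open>S\<close>
  a Cauchy filter; completeness supplies the limits.\<close>

lemma continuous_extension_dense:
  fixes h :: "'x::topological_space \<Rightarrow> 'w::complete_complex_tvs"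
  assumes dense: "closure S = UNIV"
    and osc: "\<And>z U. open U \<Longrightarrow> 0 \<in> U \<Longrightarrow> \<exists>N. open N \<and> z \<in> N \<and> (\<forall>s\<in>S \<inter> N. \<forall>t\<in>S \<inter> N. h s - h t \<in> U)"
  shows "\<exists>g. continuous_on UNIV g \<and> (\<forall>s\<in>S. g s = h s)"
proof -
  define F where "F z = inf (nhds z) (principal S)" for z
  have bot: "F z \<noteq> bot" for z
  proof
    assume "F z = bot"
    then have "eventually (\<lambda>x. x \<notin> S) (nhds z)"
      by (simp add: F_def trivial_limit_def eventually_inf_principal)
    then obtain N where "open N" "z \<in> N" "N \<inter> S = {}"
      by (auto simp: eventually_nhds)
    then have "N \<inter> closure S = {}" by (simp add: open_Int_closure_eq_empty)
    with \<open>z \<in> N\<close> show False by (simp add: dense)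
  qed
  have near: "eventually (\<lambda>s. s \<in> S \<inter> N) (F z)" if "open N" "z \<in> N" for N z
    using that by (auto simp: F_def eventually_inf_principal eventually_nhds)
  have "cauchy_filter (filtermap h (F z))" for z
  proof -
    have "filterlim (\<lambda>(x, y). y - x) (nhds 0) (filtermap h (F z) \<times>\<^sub>F filtermap h (F z))"
    proof (rule topological_tendstoI)
      fix U :: "'w set" assume U: "open U" "0 \<in> U"
      obtain N where N: "open N" "z \<in> N" "\<forall>s\<in>S \<inter> N. \<forall>t\<in>S \<inter> N. h s - h t \<in> U"
        using osc[OF U, of z] by blast
      have "eventually (\<lambda>y. y \<in> h ` (S \<inter> N)) (filtermap h (F z))"
        unfolding eventually_filtermap using near[OF N(1,2)] by (rule eventually_mono) simp
      then show "eventually (\<lambda>p. (case p of (x, y) \<Rightarrow> y - x) \<in> U) (filtermap h (F z) \<times>\<^sub>F filtermap h (F z))"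
        unfolding eventually_prod_same using N(3) by (intro exI[of _ "\<lambda>y. y \<in> h ` (S \<inter> N)"]) auto
    qed
    then show ?thesis
      unfolding cauchy_filter_def cauchy_seq_finset_iff_vanishing filterlim_def
        filtermap_le_iff_le_filtercomap .
  qed
  then have "\<exists>y. filterlim h (nhds y) (F z)" for z
    using cauchy_filter_convergent'[of "filtermap h (F z)"] bot[of z]
    by (simp add: convergent_filter_iff filterlim_def filtermap_bot_iff)
  then obtain g where g: "\<And>z. (h \<longlongrightarrow> g z) (F z)" by metis
  \<comment> \<open>At points of \<open>S\<close> the oscillation condition makes \<open>h\<close>
    continuous along the trace filter, and limits are unique.\<close>
  have "g s = h s" if "s \<in> S" for s
  proof (rule tendsto_unique[OF bot g])
    show "(h \<longlongrightarrow> h s) (F s)"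
    proof (rule topological_tendstoI)
      fix U assume U: "open U" "h s \<in> U"
      have U': "open ((\<lambda>x. x + h s) -` U)" "0 \<in> (\<lambda>x. x + h s) -` U"
        using U(2) by (auto intro!: open_vimage U continuous_intros)
      obtain N where N: "open N" "s \<in> N" "\<forall>t\<in>S \<inter> N. \<forall>u\<in>S \<inter> N. h t - h u \<in> (\<lambda>x. x + h s) -` U"
        using osc[OF U', of s] by blast
      show "eventually (\<lambda>t. h t \<in> U) (F s)"
        using near[OF N(1,2)] by (rule eventually_mono) (use N(2,3) that in force)
    qed
  qed
  moreover have "(g \<longlongrightarrow> g z) (at z)" for z
  proof (rule topological_tendstoI)
    fix U assume U: "open U" "g z \<in> U"
    have U': "open ((\<lambda>x. x + g z) -` U)" "0 \<in> (\<lambda>x. x + g z) -` U"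
      using U(2) by (auto intro!: open_vimage U continuous_intros)
    obtain V where V: "open V" "0 \<in> V" "\<And>x y. x \<in> V \<Longrightarrow> y \<in> V \<Longrightarrow> x + y \<in> (\<lambda>x. x + g z) -` U"
      using nhd_add[OF U'] by blast
    obtain W where W: "open W" "0 \<in> W" "\<And>x y. x \<in> W \<Longrightarrow> y \<in> W \<Longrightarrow> x + y \<in> V"
      using nhd_add[OF V(1,2)] by blast
    obtain N where N: "open N" "z \<in> N" "\<forall>s\<in>S \<inter> N. \<forall>t\<in>S \<inter> N. h s - h t \<in> V \<inter> W"
      using osc[of "V \<inter> W" z] V(1,2) W(1,2) by (meson IntI open_Int)
    \<comment> \<open>From \<open>g z'\<close> to \<open>g z\<close> there are three small steps,
      through values of \<open>h\<close> at a point near \<open>z'\<close> and at a point near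
      \<open>z\<close>, both inside \<open>N\<close>.\<close>
    have "g z' \<in> U" if z': "z' \<in> N" for z'
    proof -
      have ev: "eventually (\<lambda>s. h s - g y \<in> X) (F y)" if X: "open X" "0 \<in> X" for X y
      proof -
        have "((\<lambda>s. h s - g y) \<longlongrightarrow> g y - g y) (F y)" by (intro tendsto_intros g)
        then show ?thesis using X by (simp add: topological_tendstoD)
      qed
      have "open ((\<lambda>x. - x) -` W)" by (intro open_vimage W continuous_intros)
      then have "eventually (\<lambda>s. h s - g z' \<in> (\<lambda>x. - x) -` W) (F z')"
        using W by (intro ev) auto
      with near[OF N(1) z'] have "eventually (\<lambda>s. s \<in> S \<inter> N \<and> h s - g z' \<in> (\<lambda>x. - x) -` W) (F z')"
        by (rule eventually_conj)
      then obtain s' where s': "s' \<in> S \<inter> N" "h s' - g z' \<in> (\<lambda>x. - x) -` W"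
        using eventually_happens'[OF bot] by blast
      have "eventually (\<lambda>s. s \<in> S \<inter> N \<and> h s - g z \<in> V) (F z)"
        using near[OF N(1,2)] ev[OF V(1,2)] by (rule eventually_conj)
      then obtain s where s: "s \<in> S \<inter> N" "h s - g z \<in> V"
        using eventually_happens'[OF bot] by blast
      have "(g z' - h s') + (h s' - h s) \<in> V"
        using s' s N(3) by (intro W(3)) auto
      from V(3)[OF this s(2)] show ?thesis by simp
    qed
    then show "eventually (\<lambda>z'. g z' \<in> U) (at z)"
      using N(1,2) by (auto simp: eventually_at_topological)
  qed
  ultimately show ?thesis by (auto simp: continuous_on_def)
qed

lemma continuous_eq_dense:
  fixes f g :: "'x::topological_space \<Rightarrow> 'w::t2_space"
  assumes "continuous_on UNIV f" "continuous_on UNIV g" "\<And>x. x \<in> S \<Longrightarrow> f x = g x" "x \<in> closure S"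
  shows "f x = g x"
proof -
  have "closed {x. f x = g x}" using assms by (intro closed_Collect_eq)
  then have "closure S \<subseteq> {x. f x = g x}" using assms(3) by (intro closure_minimal) auto
  then show ?thesis using assms(4) by auto
qed

section \<open>The dense embedding and the extended operations\<close>

context
  fixes R :: real and \<iota> :: "'v::graded_lcs complexified symmetric_algebra \<Rightarrow> 'w::complete_complex_tvs"
  assumes \<iota>: "weyl_completion R \<iota>"
begin

lemma clinear_\<iota>: "clinear \<iota>" and dense_\<iota>: "closure (range \<iota>) = UNIV"
  using \<iota> by (simp_all add: weyl_completion_def)

lemma homeomorphic_\<iota>: "homeomorphic_map (weyl_topology R) (top_of_set (range \<iota>)) \<iota>"
  using \<iota> by (simp add: weyl_completion_def embedding_map_def topspace_weyl_topology)

lemma inj_\<iota>: "inj \<iota>"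
  using homeomorphic_imp_injective_map[OF homeomorphic_\<iota>] by (simp add: topspace_weyl_topology)

lemma \<iota>_eq: "\<iota> a = \<iota> b \<longleftrightarrow> a = b"
  using inj_\<iota> by (auto simp: inj_def)

text \<open>Continuity of the embedding in terms of seminorms; \<open>weyl_ball_contains\<close>
  expresses continuity of its inverse on the range.\<close>

lemma weyl_ball_in:
  assumes "open U" "0 \<in> U"
  obtains p r where "continuous_seminorm p" "r > 0" "\<And>b. weyl_seminorm p R b < r \<Longrightarrow> \<iota> b \<in> U"
proof -
  have "continuous_map (weyl_topology R) (top_of_set (range \<iota>)) \<iota>"
    by (rule homeomorphic_imp_continuous_map[OF homeomorphic_\<iota>])
  then have "openin (weyl_topology R) {a \<in> topspace (weyl_topology R). \<iota> a \<in> U}"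
    using assms(1) by (intro openin_continuous_map_preimage[of _ euclidean])
      (auto simp: continuous_map_in_subtopology)
  then have "openin (weyl_topology R) {a. \<iota> a \<in> U}"
    by (simp add: topspace_weyl_topology)
  moreover have "0 \<in> {a. \<iota> a \<in> U}"
    using assms(2) by (simp add: clinear_zero[OF clinear_\<iota>])
  ultimately show thesis
    by (rule openin_weyl_topologyD) (use that in auto)
qed

lemma weyl_ball_contains:
  fixes p :: "'v complexified \<Rightarrow> real"
  assumes "continuous_seminorm p" "r > 0"
  obtains U where "open U" "0 \<in> U" "\<And>a. \<iota> a \<in> U \<Longrightarrow> weyl_seminorm p R a < r"
proof -
  have "openin (top_of_set (range \<iota>)) (\<iota> ` {b. weyl_seminorm p R (b - 0) < r})"
    using homeomorphic_imp_open_map[OF homeomorphic_\<iota>] openin_weyl_ball[OF assms(1), of R 0 r]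
    by (simp only: open_map_def)
  then obtain U where U: "open U" "\<iota> ` {b. weyl_seminorm p R b < r} = range \<iota> \<inter> U"
    by (auto simp: openin_open)
  have "\<iota> 0 \<in> \<iota> ` {b. weyl_seminorm p R b < r}"
    using assms(2) by (simp add: cseminorm_zero[OF cseminorm_weyl_seminorm[OF continuous_seminormD[OF assms(1)]]])
  then have "0 \<in> U"
    using U(2) by (simp add: clinear_zero[OF clinear_\<iota>])
  moreover have "weyl_seminorm p R a < r" if "\<iota> a \<in> U" for a
  proof -
    have "\<iota> a \<in> \<iota> ` {b. weyl_seminorm p R b < r}" using that U(2) by simp
    then show ?thesis by (auto simp: \<iota>_eq)
  qed
  ultimately show thesis using that U(1) by blast
qed

text \<open>The centre \<open>z\<close> may lie outside the range, so smallness is expressed by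
  differences of elements close to \<open>z\<close>.\<close>

lemma weyl_small_nhd:
  fixes p :: "'v complexified \<Rightarrow> real"
  assumes "continuous_seminorm p" "r > 0"
  obtains N where "open N" "z \<in> N" "\<And>a b. \<iota> a \<in> N \<Longrightarrow> \<iota> b \<in> N \<Longrightarrow> weyl_seminorm p R (a - b) < r"
proof -
  obtain U where U: "open U" "0 \<in> U" "\<And>a. \<iota> a \<in> U \<Longrightarrow> weyl_seminorm p R a < r"
    using weyl_ball_contains[OF assms] by blast
  obtain N where "open N" "z \<in> N" "\<And>x y. x \<in> N \<Longrightarrow> y \<in> N \<Longrightarrow> x - y \<in> U"
    using nhd_diff[OF U(1,2)] by blast
  then show thesis
    using U(3) by (intro that[of N]) (auto simp: clinear_diff[OF clinear_\<iota>])
qed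

lemma extend1:
  assumes add: "\<And>a b. f (a - b) = f a - f b"
    and bound: "\<And>p. continuous_seminorm p \<Longrightarrow>
      \<exists>q. continuous_seminorm q \<and> (\<forall>a. weyl_seminorm p R (f a) \<le> weyl_seminorm q R a)"
  shows extend1_continuous: "continuous_on UNIV (extend1 \<iota> f)"
    and extend1_\<iota>: "extend1 \<iota> f (\<iota> a) = \<iota> (f a)"
proof -
  define h where "h x = \<iota> (f (inv \<iota> x))" for x
  have h: "h (\<iota> a) = \<iota> (f a)" for a by (simp add: h_def inj_\<iota>)
  have "\<exists>g. continuous_on UNIV g \<and> (\<forall>s\<in>range \<iota>. g s = h s)"
  proof (rule continuous_extension_dense[OF dense_\<iota>])
    fix z and U :: "'w set" assume "open U" "0 \<in> U"
    then obtain p r where p: "continuous_seminorm p" "r > 0" "\<And>b. weyl_seminorm p R b < r \<Longrightarrow> \<iota> b \<in> U"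
      using weyl_ball_in by blast
    obtain q where q: "continuous_seminorm q" "\<And>a. weyl_seminorm p R (f a) \<le> weyl_seminorm q R a"
      using bound[OF p(1)] by blast
    obtain N where N: "open N" "z \<in> N" "\<And>a b. \<iota> a \<in> N \<Longrightarrow> \<iota> b \<in> N \<Longrightarrow> weyl_seminorm q R (a - b) < r"
      using weyl_small_nhd[OF q(1) p(2)] by blast
    have "h s - h t \<in> U" if st: "s \<in> range \<iota> \<inter> N" "t \<in> range \<iota> \<inter> N" for s t
    proof -
      obtain a b where ab: "s = \<iota> a" "t = \<iota> b" using st by blast
      have "weyl_seminorm p R (f (a - b)) < r"
        using q(2)[of "a - b"] N(3)[of a b] st ab by (auto intro: le_less_trans)
      from p(3)[OF this] show ?thesis by (simp add: ab h add clinear_diff[OF clinear_\<iota>])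
    qed
    then show "\<exists>N. open N \<and> z \<in> N \<and> (\<forall>s\<in>range \<iota> \<inter> N. \<forall>t\<in>range \<iota> \<inter> N. h s - h t \<in> U)"
      by (intro exI[of _ N] conjI ballI N(1,2))
  qed
  then obtain g where g: "continuous_on UNIV g" "\<And>a. g (\<iota> a) = \<iota> (f a)"
    using h by force
  have "extend1 \<iota> f = g"
    unfolding extend1_def
  proof (rule the_equality)
    fix g' assume g': "continuous_on UNIV g' \<and> (\<forall>a. g' (\<iota> a) = \<iota> (f a))"
    show "g' = g"
    proof
      fix x
      show "g' x = g x"
        by (rule continuous_eq_dense[of _ _ "range \<iota>"]) (use g g' in \<open>auto simp: dense_\<iota>\<close>)
    qed
  qed (use g in blast)
  with g show "continuous_on UNIV (extend1 \<iota> f)" "extend1 \<iota> f (\<iota> a) = \<iota> (f a)" by simp_all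
qed

lemma extend2:
  assumes f: "weyl_bounded2 R f"
  shows extend2_continuous: "continuous_on UNIV (\<lambda>(x, y). extend2 \<iota> f x y)"
    and extend2_\<iota>: "extend2 \<iota> f (\<iota> a) (\<iota> b) = \<iota> (f a b)"
proof -
  have bil: "cbilinear f" using f by (simp add: weyl_bounded2_def)
  define h where "h z = \<iota> (f (inv \<iota> (fst z)) (inv \<iota> (snd z)))" for z
  have h: "h (\<iota> a, \<iota> b) = \<iota> (f a b)" for a b by (simp add: h_def inj_\<iota>)
  have dense: "closure (range \<iota> \<times> range \<iota>) = UNIV"
    by (simp add: closure_Times dense_\<iota>)
  have "\<exists>g. continuous_on UNIV g \<and> (\<forall>s\<in>range \<iota> \<times> range \<iota>. g s = h s)"
  proof (rule continuous_extension_dense[OF dense])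
    fix z :: "'w \<times> 'w" and U :: "'w set" assume "open U" "0 \<in> U"
    then obtain p r where p: "continuous_seminorm p" "r > 0" "\<And>b. weyl_seminorm p R b < r \<Longrightarrow> \<iota> b \<in> U"
      using weyl_ball_in by blast
    obtain q C where q: "continuous_seminorm q" "0 < C"
      "\<And>a b. weyl_seminorm p R (f a b) \<le> C * (weyl_seminorm q R a * weyl_seminorm q R b)"
      using f p(1) unfolding weyl_bounded2_def by blast
    let ?q = "weyl_seminorm q R"
    note qs = cseminorm_weyl_seminorm[OF continuous_seminormD[OF q(1)], of R]
    note ps = cseminorm_weyl_seminorm[OF continuous_seminormD[OF p(1)], of R]
    note nn = cseminorm_nonneg[OF qs]
    \<comment> \<open>Density provides some \<open>\<iota> c\<close> near \<open>y\<close>, and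
      close to \<open>y\<close> the seminorm exceeds its value at \<open>c\<close> by at most
      \<open>1\<close>.\<close>
    have bounded: "\<exists>N B. open N \<and> y \<in> N \<and> 0 < B \<and> (\<forall>a. \<iota> a \<in> N \<longrightarrow> ?q a \<le> B)" for y
    proof -
      obtain N where N: "open N" "y \<in> N" "\<And>a b. \<iota> a \<in> N \<Longrightarrow> \<iota> b \<in> N \<Longrightarrow> ?q (a - b) < 1"
        using weyl_small_nhd[OF q(1) zero_less_one] by blast
      have "N \<inter> range \<iota> \<noteq> {}"
        using open_Int_closure_eq_empty[OF N(1), of "range \<iota>"] N(2) by (auto simp: dense_\<iota>)
      then obtain c where c: "\<iota> c \<in> N" by auto
      have "?q a \<le> ?q c + 1" if "\<iota> a \<in> N" for a
        using cseminormD(1)[OF qs, of "a - c" c] N(3)[OF that c] by simp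
      moreover have "0 < ?q c + 1" using nn[of c] by simp
      ultimately show ?thesis using N(1,2) by blast
    qed
    obtain x y where z: "z = (x, y)" by (cases z)
    obtain N1 A where N1: "open N1" "x \<in> N1" "0 < A" "\<And>a. \<iota> a \<in> N1 \<Longrightarrow> ?q a \<le> A"
      using bounded[of x] by blast
    obtain M1 B where M1: "open M1" "y \<in> M1" "0 < B" "\<And>b. \<iota> b \<in> M1 \<Longrightarrow> ?q b \<le> B"
      using bounded[of y] by blast
    \<comment> \<open>The choice makes the error \<open>C * (e * B) + C * (A * e)\<close> below
      equal to \<open>r / 2\<close>.\<close>
    define e where "e = (r / 2) / (C * (A + B))"
    have e: "e > 0" using p(2) q(2) N1(3) M1(3) by (simp add: e_def)
    obtain N2 where N2: "open N2" "x \<in> N2" "\<And>a b. \<iota> a \<in> N2 \<Longrightarrow> \<iota> b \<in> N2 \<Longrightarrow> ?q (a - b) < e"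
      using weyl_small_nhd[OF q(1) e] by blast
    obtain M2 where M2: "open M2" "y \<in> M2" "\<And>a b. \<iota> a \<in> M2 \<Longrightarrow> \<iota> b \<in> M2 \<Longrightarrow> ?q (a - b) < e"
      using weyl_small_nhd[OF q(1) e] by blast
    let ?N = "(N1 \<inter> N2) \<times> (M1 \<inter> M2)"
    have "h s - h t \<in> U" if st: "s \<in> (range \<iota> \<times> range \<iota>) \<inter> ?N" "t \<in> (range \<iota> \<times> range \<iota>) \<inter> ?N" for s t
    proof -
      obtain a b a' b' where ab: "s = (\<iota> a, \<iota> b)" "t = (\<iota> a', \<iota> b')" using st by blast
      have mem: "\<iota> a \<in> N1" "\<iota> a \<in> N2" "\<iota> a' \<in> N1" "\<iota> a' \<in> N2" "\<iota> b \<in> M1" "\<iota> b \<in> M2" "\<iota> b' \<in> M1" "\<iota> b' \<in> M2"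
        using st by (simp_all add: ab)
      \<comment> \<open>In each summand one argument is a small difference while the other is
        bounded.\<close>
      have split: "f a b - f a' b' = f (a - a') b + f a' (b - b')"
        by (simp add: clinear_diff[OF cbilinear_clinear(1)[OF bil]] clinear_diff[OF cbilinear_clinear(2)[OF bil]])
      have "weyl_seminorm p R (f a b - f a' b') \<le> C * (?q (a - a') * ?q b) + C * (?q a' * ?q (b - b'))"
        unfolding split using cseminormD(1)[OF ps, of "f (a - a') b" "f a' (b - b')"] q(3)[of "a - a'" b] q(3)[of a' "b - b'"]
        by simp
      also have "\<dots> \<le> C * (e * B) + C * (A * e)"
        using mem N1 M1 N2(3)[of a a'] M2(3)[of b b'] q(2) e nn
        by (intro add_mono mult_left_mono mult_mono) auto
      also have "\<dots> = C * (A + B) * e" by (simp add: algebra_simps)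
      also have "\<dots> = r / 2"
      proof -
        have "C * (A + B) \<noteq> 0" using q(2) N1(3) M1(3) by simp
        moreover have "x * (y / x) = y" if "x \<noteq> 0" for x y :: real
          using that by simp
        ultimately show ?thesis unfolding e_def by blast
      qed
      also have "\<dots> < r" using p(2) by simp
      finally have "\<iota> (f a b - f a' b') \<in> U" by (rule p(3))
      then show ?thesis by (simp add: ab h clinear_diff[OF clinear_\<iota>])
    qed
    moreover have "open ?N" "z \<in> ?N"
      using N1 N2 M1 M2 by (auto simp: z intro!: open_Times)
    ultimately show "\<exists>N. open N \<and> z \<in> N \<and> (\<forall>s\<in>(range \<iota> \<times> range \<iota>) \<inter> N. \<forall>t\<in>(range \<iota> \<times> range \<iota>) \<inter> N. h s - h t \<in> U)"
      by (intro exI[of _ ?N] conjI ballI)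
  qed
  then obtain g0 where g0: "continuous_on UNIV g0" "\<And>s. s \<in> range \<iota> \<times> range \<iota> \<Longrightarrow> g0 s = h s"
    by blast
  define g where "g x y = g0 (x, y)" for x y
  have g: "continuous_on UNIV (\<lambda>(x, y). g x y)" "g (\<iota> a) (\<iota> b) = \<iota> (f a b)" for a b
    using g0 h by (simp_all add: g_def)
  have "extend2 \<iota> f = g"
    unfolding extend2_def
  proof (rule the_equality)
    fix g' assume g': "continuous_on UNIV (\<lambda>(x, y). g' x y) \<and> (\<forall>a b. g' (\<iota> a) (\<iota> b) = \<iota> (f a b))"
    have "(case z of (x, y) \<Rightarrow> g' x y) = (case z of (x, y) \<Rightarrow> g x y)" for z
      by (rule continuous_eq_dense[of _ _ "range \<iota> \<times> range \<iota>"]) (use g g' in \<open>auto simp: dense\<close>)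
    from this[of "(_, _)"] show "g' = g" by (intro ext) simp
  qed (use g in blast)
  with g show "continuous_on UNIV (\<lambda>(x, y). extend2 \<iota> f x y)" "extend2 \<iota> f (\<iota> a) (\<iota> b) = \<iota> (f a b)"
    by simp_all
qed

lemma weyl_conj:
  shows weyl_conj_continuous: "continuous_on UNIV (weyl_conj \<iota>)"
    and weyl_conj_\<iota>: "weyl_conj \<iota> (\<iota> a) = \<iota> (sym_conj a)"
proof -
  have diff: "sym_conj (a - b) = sym_conj a - sym_conj b" for a b :: "'v complexified symmetric_algebra"
    by (metis add_diff_cancel diff_add_cancel sym_conj_add)
  have bound: "\<exists>q. continuous_seminorm q \<and> (\<forall>a. weyl_seminorm p R (sym_conj a) \<le> weyl_seminorm q R a)"
    if "continuous_seminorm p" for p :: "'v complexified \<Rightarrow> real"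
    using weyl_seminorm_sym_conj_bound[OF that, of R] by blast
  show "continuous_on UNIV (weyl_conj \<iota>)" "weyl_conj \<iota> (\<iota> a) = \<iota> (sym_conj a)"
    unfolding weyl_conj_def using extend1[OF diff bound] by blast+
qed

end

section \<open>Hermitian forms\<close>

lemma form_eqI:
  fixes A B :: "'v::graded_complex_vector \<Rightarrow> 'v \<Rightarrow> complex"
  assumes A: "cbilinear A" and B: "cbilinear B"
    and eq: "\<And>d e v w. homogeneous d v \<Longrightarrow> homogeneous e w \<Longrightarrow> A v w = B v w"
  shows "A v w = B v w"
proof -
  have "A (parity_part False v + parity_part True v) (parity_part False w + parity_part True w) =
    B (parity_part False v + parity_part True v) (parity_part False w + parity_part True w)"
    unfolding cbilinearD(1,3)[OF A] cbilinearD(1,3)[OF B]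
    by (simp add: eq[OF homogeneous_parity_part homogeneous_parity_part])
  then show ?thesis by (simp add: parity_part_False_True)
qed

lemma flip_form_flip_form:
  fixes \<Lambda> :: "'v::graded_complex_vector \<Rightarrow> 'v \<Rightarrow> complex"
  assumes b: "cbilinear \<Lambda>"
  shows "flip_form (flip_form \<Lambda>) v w = \<Lambda> v w"
proof (rule form_eqI)
  fix d e and v w :: 'v
  assume h: "homogeneous d v" "homogeneous e w"
  show "flip_form (flip_form \<Lambda>) v w = \<Lambda> v w"
    using parity_sign_square[of d e]
    by (simp add: flip_form_homogeneous[OF cbilinear_flip_form[OF b] h] flip_form_homogeneous[OF b h(2,1)]
        parity_sign_commute[of e d] flip: mult.assoc)
qed (simp_all add: cbilinear_flip_form b)

lemma flip_form_conj_form: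
  "flip_form (conj_form \<Lambda>) v w = conj_form (flip_form \<Lambda>) v (w :: 'v::graded_lcs complexified)"
  by (simp add: flip_form_def conj_form_def UNIV_bool parity_part_conj_vec cnj_parity_sign)

lemma conj_form_form_minus:
  "conj_form (form_minus \<Lambda>) v w = form_minus (conj_form \<Lambda>) v (w :: 'v::graded_lcs complexified)"
  unfolding form_minus_def flip_form_conj_form by (simp add: conj_form_def)

text \<open>Adding the two identities gives the single one, since
  \<open>form_minus \<Lambda> - form_plus \<Lambda>\<close> is \<open>- flip_form \<Lambda>\<close>.
  Conversely, flipping the single identity also determines the flip of
  \<open>conj_form \<Lambda>\<close>, because the flip is an involution.\<close>

lemma hermitian_form_iff:
  fixes \<Lambda> :: "'v::graded_lcs complexified \<Rightarrow> 'v complexified \<Rightarrow> complex"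
  assumes b: "cbilinear \<Lambda>"
  shows "((\<forall>v w. form_plus (conj_form \<Lambda>) v w = - form_plus \<Lambda> v w) \<and>
      (\<forall>v w. form_minus (conj_form \<Lambda>) v w = form_minus \<Lambda> v w)) \<longleftrightarrow>
    (\<forall>v w. conj_form \<Lambda> v w = - flip_form \<Lambda> v w)" (is "?L \<longleftrightarrow> ?R")
proof
  assume L: ?L
  show ?R
  proof (intro allI)
    fix v w
    have "conj_form \<Lambda> v w = form_plus (conj_form \<Lambda>) v w + form_minus (conj_form \<Lambda>) v w"
      by (simp add: form_plus_def form_minus_def field_simps)
    also have "\<dots> = - form_plus \<Lambda> v w + form_minus \<Lambda> v w" using L by simp
    also have "\<dots> = - flip_form \<Lambda> v w"
      by (simp add: form_plus_def form_minus_def field_simps)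
    finally show "conj_form \<Lambda> v w = - flip_form \<Lambda> v w" .
  qed
next
  assume R: ?R
  have "flip_form (conj_form \<Lambda>) v w = - \<Lambda> v w" for v w
  proof -
    have "flip_form (conj_form \<Lambda>) v w = - flip_form (flip_form \<Lambda>) v w"
      by (simp add: flip_form_def[of "conj_form \<Lambda>"] R flip_form_def[of "flip_form \<Lambda>"] UNIV_bool)
    then show ?thesis by (simp add: flip_form_flip_form[OF b])
  qed
  with R show ?L by (simp add: form_plus_def form_minus_def field_simps)
qed

section \<open>Hermitian forms and the conjugation of products\<close>

lemma sym_conj_sym_parity:
  "a \<in> sym_parity e \<Longrightarrow> sym_conj a \<in> sym_parity (e :: bool)"
proof (induction rule: sym_parity_induct)
  case (sym_prod es vs)
  have "sym_prod (map conj_vec vs) \<in> sym_parity e"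
    unfolding sym_parity_def
    by (rule complex_vector.span_base) (use sym_prod homogeneous_list_conj_vec in \<open>auto simp: list_parity_def\<close>)
  then show ?case by (simp add: sym_conj_sym_prod)
qed (simp_all add: sym_conj sym_parity_def complex_vector.span_add complex_vector.span_scale)

lemma sym_prod_singleton_parity: "homogeneous e v \<Longrightarrow> sym_prod [v] \<in> sym_parity e"
  unfolding sym_parity_def
  by (rule complex_vector.span_base, intro CollectI exI[of _ "[v]"] exI[of _ "[e]"]) (simp add: homogeneous_list_def)

text \<open>Conjugation turns \<open>z\<close> into \<open>- z\<close> and \<open>\<Lambda>\<close>
  into \<open>- flip_form \<Lambda>\<close>. The two signs cancel, and the star product of
  \<open>flip_form \<Lambda>\<close> is, up to the parity sign, the one of \<open>\<Lambda>\<close>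
  with exchanged factors.\<close>

lemma sym_conj_star_product_hermitian:
  fixes \<Lambda> :: "'v::graded_lcs complexified \<Rightarrow> 'v complexified \<Rightarrow> complex"
  assumes b: "cbilinear \<Lambda>" and ev: "even_form \<Lambda>" and herm: "\<And>v w. conj_form \<Lambda> v w = - flip_form \<Lambda> v w"
    and z: "cnj z = - z" and ab: "a \<in> sym_parity d" "b \<in> sym_parity e"
  shows "sym_conj (star_product z \<Lambda> a b) =
    parity_sign d e *\<^sub>C star_product z \<Lambda> (sym_conj b) (sym_conj a)"
proof -
  have "conj_form \<Lambda> = (\<lambda>v w. (-1) * flip_form \<Lambda> v w)"
    by (intro ext) (simp add: herm)
  then have "sym_conj (star_product z \<Lambda> a b) =
      star_product (- z) (\<lambda>v w. (-1) * flip_form \<Lambda> v w) (sym_conj a) (sym_conj b)"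
    by (simp only: sym_conj_star_product[OF b] z)
  also have "\<dots> = star_product z (flip_form \<Lambda>) (sym_conj a) (sym_conj b)"
    by (simp only: star_product_scaled[OF cbilinear_flip_form[OF b]]) simp
  also have "\<dots> = parity_sign d e *\<^sub>C star_product z \<Lambda> (sym_conj b) (sym_conj a)"
    by (rule star_product_flip[OF b ev sym_conj_sym_parity[OF ab(1)] sym_conj_sym_parity[OF ab(2)], symmetric])
  finally show ?thesis .
qed

lemma hermitian_from_generators:
  fixes \<Lambda> :: "'v::graded_lcs complexified \<Rightarrow> 'v complexified \<Rightarrow> complex"
  assumes b: "cbilinear \<Lambda>" and z: "cnj z = - z" "z \<noteq> 0"
    and inv: "\<And>d e v w. homogeneous d v \<Longrightarrow> homogeneous e w \<Longrightarrow>
      sym_conj (star_product z \<Lambda> (sym_prod [v]) (sym_prod [w])) =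
        parity_sign d e *\<^sub>C star_product z \<Lambda> (sym_conj (sym_prod [w])) (sym_conj (sym_prod [v]))"
  shows "conj_form \<Lambda> v w = - flip_form \<Lambda> v w"
proof -
  have "conj_form \<Lambda> v w = (-1) * flip_form \<Lambda> v w"
  proof (rule form_eqI[of "conj_form \<Lambda>" "\<lambda>v w. (-1) * flip_form \<Lambda> v w"])
    fix d e and v w :: "'v complexified"
    assume h: "homogeneous d v" "homogeneous e w"
    \<comment> \<open>The hypothesis is used at the conjugated vectors, whose conjugates are
      \<open>v\<close> and \<open>w\<close>, so that \<open>conj_form\<close> appears
      directly.\<close>
    let ?v = "conj_vec v" and ?w = "conj_vec w"
    note h' = homogeneous_conj_vec[OF h(1)] homogeneous_conj_vec[OF h(2)]
    have "sym_prod [v, w] = parity_sign d e *\<^sub>C sym_prod [w, v]"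
      using graded_symmetricD[OF graded_symmetric_sym_prod homogeneous_list_Nil homogeneous_list_Nil h] by simp
    moreover have "sym_prod [v, w] + (cnj z * cnj (\<Lambda> ?v ?w)) *\<^sub>C sym_prod [] =
        parity_sign d e *\<^sub>C (sym_prod [w, v] + (z * \<Lambda> w v) *\<^sub>C sym_prod [])"
      using inv[OF h']
      by (simp add: star_product_generators[OF b h'] sym_conj sym_conj_sym_prod conj_vec_conj_vec
          star_product_generators[OF b h(2,1)])
    \<comment> \<open>The quadratic parts agree by graded symmetry of \<open>sym_prod\<close>; only
      multiples of the empty product are left.\<close>
    ultimately have "(cnj z * cnj (\<Lambda> ?v ?w)) *\<^sub>C sym_prod [] =
        (parity_sign d e * (z * \<Lambda> w v)) *\<^sub>C (sym_prod [] :: 'v complexified symmetric_algebra)"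
      by (simp add: scaleC_add_right scaleC_scaleC)
    then have "cnj z * cnj (\<Lambda> ?v ?w) = parity_sign d e * (z * \<Lambda> w v)"
      using complex_vector.scale_right_imp_eq[OF sym_prod_Nil_nonzero] by blast
    then have "z * cnj (\<Lambda> ?v ?w) = z * (- (parity_sign d e * \<Lambda> w v))"
      by (simp add: z(1) algebra_simps) (metis add.inverse_inverse)
    then have "cnj (\<Lambda> ?v ?w) = - (parity_sign d e * \<Lambda> w v)"
      using z(2) by (simp only: mult_cancel_left simp_thms)
    then show "conj_form \<Lambda> v w = (-1) * flip_form \<Lambda> v w"
      by (simp add: conj_form_def flip_form_homogeneous[OF b h])
  qed (intro cbilinear_conj_form cbilinear_scaled cbilinear_flip_form b)+
  then show ?thesis by simp
qed

lemma conj_form_minus_from_generators: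
  fixes \<Lambda> :: "'v::graded_lcs complexified \<Rightarrow> 'v complexified \<Rightarrow> complex"
  assumes b: "cbilinear \<Lambda>"
    and inv: "\<And>d e v w. homogeneous d v \<Longrightarrow> homogeneous e w \<Longrightarrow>
      sym_conj (poisson_bracket \<Lambda> (sym_prod [v]) (sym_prod [w])) =
        poisson_bracket \<Lambda> (sym_conj (sym_prod [v])) (sym_conj (sym_prod [w]))"
  shows "form_minus (conj_form \<Lambda>) v w = form_minus \<Lambda> v w"
proof (rule form_eqI)
  fix d e and v w :: "'v complexified"
  assume h: "homogeneous d v" "homogeneous e w"
  note h' = homogeneous_conj_vec[OF h(1)] homogeneous_conj_vec[OF h(2)]
  have "(2 * cnj (form_minus \<Lambda> (conj_vec v) (conj_vec w))) *\<^sub>C sym_prod [] =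
      (2 * form_minus \<Lambda> v w) *\<^sub>C (sym_prod [] :: 'v complexified symmetric_algebra)"
    using inv[OF h']
    by (simp add: poisson_bracket_generators[OF b h'] poisson_bracket_generators[OF b h] sym_conj
        sym_conj_sym_prod conj_vec_conj_vec)
  then have "2 * cnj (form_minus \<Lambda> (conj_vec v) (conj_vec w)) = 2 * form_minus \<Lambda> v w"
    using complex_vector.scale_right_imp_eq[OF sym_prod_Nil_nonzero] by blast
  then show "form_minus (conj_form \<Lambda>) v w = form_minus \<Lambda> v w"
    by (simp add: conj_form_form_minus[symmetric]) (simp add: conj_form_def)
qed (intro cbilinear_form_minus cbilinear_conj_form b)+

theorem proposition3p25:
  fixes \<Lambda> :: "'v::graded_lcs complexified \<Rightarrow> 'v complexified \<Rightarrow> complex"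
    and \<iota> :: "'v complexified symmetric_algebra \<Rightarrow> 'w::complete_complex_tvs"
    and R hbar :: real
  assumes "cbilinear \<Lambda>" and "even_form \<Lambda>" and "continuous_on UNIV (\<lambda>(v, w). \<Lambda> v w)"
    and "R \<ge> 1 / 2" and "hbar \<noteq> 0"
    and "weyl_completion R \<iota>"
  shows
    "((\<forall>d e. \<forall>a\<in>weyl_parity \<iota> d. \<forall>b\<in>weyl_parity \<iota> e.
         weyl_conj \<iota> (weyl_star \<iota> (\<i> * complex_of_real hbar / 2) \<Lambda> a b) =
           parity_sign d e *\<^sub>C
             weyl_star \<iota> (\<i> * complex_of_real hbar / 2) \<Lambda> (weyl_conj \<iota> b) (weyl_conj \<iota> a))
      \<longleftrightarrow>
      (\<forall>v w. form_plus (conj_form \<Lambda>) v w = - form_plus \<Lambda> v w) \<and>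
      (\<forall>v w. form_minus (conj_form \<Lambda>) v w = form_minus \<Lambda> v w))
     \<and>
     ((\<forall>v w. form_plus (conj_form \<Lambda>) v w = - form_plus \<Lambda> v w) \<and>
      (\<forall>v w. form_minus (conj_form \<Lambda>) v w = form_minus \<Lambda> v w)
      \<longleftrightarrow>
      (\<forall>v w. form_plus (conj_form \<Lambda>) v w = - form_plus \<Lambda> v w) \<and>
      (\<forall>a b. weyl_conj \<iota> (weyl_poisson \<iota> \<Lambda> a b) =
         weyl_poisson \<iota> \<Lambda> (weyl_conj \<iota> a) (weyl_conj \<iota> b)))"
proof -
  note b = assms(1) and ev = assms(2) and \<iota> = assms(6)
  define z where "z = \<i> * complex_of_real hbar / 2"
  have z: "cnj z = - z" "z \<noteq> 0" using assms(5) by (simp_all add: z_def)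
  note lin = clinear_\<iota>[OF \<iota>]
  have star: "continuous_on UNIV (\<lambda>(x, y). weyl_star \<iota> z \<Lambda> x y)"
    "weyl_star \<iota> z \<Lambda> (\<iota> x) (\<iota> y) = \<iota> (star_product z \<Lambda> x y)" for x y
    unfolding weyl_star_def using extend2[OF \<iota> weyl_bounded2_star_product[OF b assms(3,4)]] by blast+
  have poisson: "continuous_on UNIV (\<lambda>(x, y). weyl_poisson \<iota> \<Lambda> x y)"
    "weyl_poisson \<iota> \<Lambda> (\<iota> x) (\<iota> y) = \<iota> (poisson_bracket \<Lambda> x y)" for x y
    unfolding weyl_poisson_def using extend2[OF \<iota> weyl_bounded2_poisson_bracket[OF b assms(3,4)]] by blast+
  note conj = weyl_conj[OF \<iota>]
  have conj_after: "continuous_on UNIV (\<lambda>z. weyl_conj \<iota> (F (fst z) (snd z)))"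
    if "continuous_on UNIV (\<lambda>(x, y). F x y)" for F
    using continuous_on_compose2[OF conj(1) that] by (simp add: case_prod_unfold)
  have conj_before: "continuous_on UNIV (\<lambda>z. F (weyl_conj \<iota> (f z)) (weyl_conj \<iota> (g z)))"
    if F: "continuous_on UNIV (\<lambda>(x, y). F x y)" and fg: "continuous_on UNIV f" "continuous_on UNIV g"
    for F and f g :: "'w \<times> 'w \<Rightarrow> 'w"
  proof -
    have "continuous_on UNIV (\<lambda>z. (weyl_conj \<iota> (f z), weyl_conj \<iota> (g z)))"
      by (intro continuous_on_Pair continuous_on_compose2[OF conj(1)] fg) auto
    from continuous_on_compose2[OF F this] show ?thesis by simp
  qed
  have fs: "continuous_on UNIV (fst :: 'w \<times> 'w \<Rightarrow> 'w)" "continuous_on UNIV (snd :: 'w \<times> 'w \<Rightarrow> 'w)"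
    by (intro continuous_on_fst continuous_on_snd continuous_on_id)+
  \<comment> \<open>The scalar is \<open>1\<close> or \<open>- 1\<close>, so this is continuity of
    negation.\<close>
  have sign: "continuous_on UNIV (\<lambda>z. parity_sign d e *\<^sub>C f z)"
    if "continuous_on UNIV f" for d e and f :: "'w \<times> 'w \<Rightarrow> 'w"
    using that by (cases "d \<and> e") (auto simp: parity_sign_def scaleC_one intro: continuous_on_minus)
  have star_iff: "(\<forall>d e. \<forall>a\<in>weyl_parity \<iota> d. \<forall>b\<in>weyl_parity \<iota> e.
         weyl_conj \<iota> (weyl_star \<iota> z \<Lambda> a b) =
           parity_sign d e *\<^sub>C weyl_star \<iota> z \<Lambda> (weyl_conj \<iota> b) (weyl_conj \<iota> a)) \<longleftrightarrow>
      (\<forall>v w. conj_form \<Lambda> v w = - flip_form \<Lambda> v w)" (is "?L \<longleftrightarrow> ?R")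
  proof
    assume L: ?L
    have "sym_conj (star_product z \<Lambda> (sym_prod [v]) (sym_prod [w])) =
        parity_sign d e *\<^sub>C star_product z \<Lambda> (sym_conj (sym_prod [w])) (sym_conj (sym_prod [v]))"
      if "homogeneous d v" "homogeneous e w" for d e v w
    proof -
      \<comment> \<open>A homogeneous vector is a homogeneous element of the completion, and
        \<open>\<iota>\<close> is injective, so the identity descends to the generators.\<close>
      have "\<iota> (sym_prod [v]) \<in> weyl_parity \<iota> d" "\<iota> (sym_prod [w]) \<in> weyl_parity \<iota> e"
        unfolding weyl_parity_def using that
        by (auto intro!: closure_subset[THEN subsetD] imageI sym_prod_singleton_parity)
      then have "weyl_conj \<iota> (weyl_star \<iota> z \<Lambda> (\<iota> (sym_prod [v])) (\<iota> (sym_prod [w]))) = parity_sign d e *\<^sub>C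
          weyl_star \<iota> z \<Lambda> (weyl_conj \<iota> (\<iota> (sym_prod [w]))) (weyl_conj \<iota> (\<iota> (sym_prod [v])))"
        using L by blast
      then show ?thesis
        by (simp only: star(2) conj(2) clinear_scale[OF lin, symmetric] \<iota>_eq[OF \<iota>])
    qed
    then show ?R
      using hermitian_from_generators[OF b z] by blast
  next
    assume R: ?R
    show ?L
    proof (intro allI ballI)
      fix d e x y
      assume "x \<in> weyl_parity \<iota> d" "y \<in> weyl_parity \<iota> e"
      \<comment> \<open>Elements of given parities lie in closures, so the pair is in the closure of
        the pairs from the symmetric algebra; there the identity is algebraic, and both sides are
        continuous.\<close>
      then have xy: "(x, y) \<in> closure (\<iota> ` sym_parity d \<times> \<iota> ` sym_parity e)"
        by (simp add: weyl_parity_def closure_Times)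
      have "weyl_conj \<iota> (weyl_star \<iota> z \<Lambda> (fst (x, y)) (snd (x, y))) =
           parity_sign d e *\<^sub>C weyl_star \<iota> z \<Lambda> (weyl_conj \<iota> (snd (x, y))) (weyl_conj \<iota> (fst (x, y)))"
      proof (rule continuous_eq_dense[OF conj_after[OF star(1)] sign[OF conj_before[OF star(1) fs(2,1)]] _ xy])
        fix s assume "s \<in> \<iota> ` sym_parity d \<times> \<iota> ` sym_parity e"
        then obtain a c where s: "s = (\<iota> a, \<iota> c)" "a \<in> sym_parity d" "c \<in> sym_parity e" by auto
        have "sym_conj (star_product z \<Lambda> a c) =
            parity_sign d e *\<^sub>C star_product z \<Lambda> (sym_conj c) (sym_conj a)"
          using R by (intro sym_conj_star_product_hermitian[OF b ev _ z(1) s(2,3)]) blast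
        then show "weyl_conj \<iota> (weyl_star \<iota> z \<Lambda> (fst s) (snd s)) =
           parity_sign d e *\<^sub>C weyl_star \<iota> z \<Lambda> (weyl_conj \<iota> (snd s)) (weyl_conj \<iota> (fst s))"
          by (simp add: s(1) star(2) conj(2) clinear_scale[OF lin])
      qed
      then show "weyl_conj \<iota> (weyl_star \<iota> z \<Lambda> x y) =
           parity_sign d e *\<^sub>C weyl_star \<iota> z \<Lambda> (weyl_conj \<iota> y) (weyl_conj \<iota> x)"
        by simp
    qed
  qed
  \<comment> \<open>Statements (ii) and (iii) share the condition on the symmetric part, so it
    suffices to compare their second halves.\<close>
  have poisson_iff: "(\<forall>v w. form_minus (conj_form \<Lambda>) v w = form_minus \<Lambda> v w) \<longleftrightarrow>
      (\<forall>a b. weyl_conj \<iota> (weyl_poisson \<iota> \<Lambda> a b) =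
         weyl_poisson \<iota> \<Lambda> (weyl_conj \<iota> a) (weyl_conj \<iota> b))" (is "?L \<longleftrightarrow> ?R")
  proof
    assume L: ?L
    have "conj_form (form_minus \<Lambda>) = form_minus \<Lambda>"
      by (intro ext) (simp add: conj_form_form_minus L)
    then have alg: "sym_conj (poisson_bracket \<Lambda> a c) = poisson_bracket \<Lambda> (sym_conj a) (sym_conj c)" for a c
      by (simp add: sym_conj_poisson_bracket[OF b]) (simp add: poisson_bracket_def)
    show ?R
    proof (intro allI)
      fix x y
      have xy: "(x, y) \<in> closure (range \<iota> \<times> range \<iota>)"
        by (simp add: closure_Times dense_\<iota>[OF \<iota>])
      have "weyl_conj \<iota> (weyl_poisson \<iota> \<Lambda> (fst (x, y)) (snd (x, y))) =
         weyl_poisson \<iota> \<Lambda> (weyl_conj \<iota> (fst (x, y))) (weyl_conj \<iota> (snd (x, y)))"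
        by (rule continuous_eq_dense[OF conj_after[OF poisson(1)] conj_before[OF poisson(1) fs] _ xy])
          (auto simp: poisson(2) conj(2) alg)
      then show "weyl_conj \<iota> (weyl_poisson \<iota> \<Lambda> x y) = weyl_poisson \<iota> \<Lambda> (weyl_conj \<iota> x) (weyl_conj \<iota> y)"
        by simp
    qed
  next
    assume R: ?R
    have "sym_conj (poisson_bracket \<Lambda> a c) = poisson_bracket \<Lambda> (sym_conj a) (sym_conj c)" for a c
      using R[rule_format, of "\<iota> a" "\<iota> c"] by (simp only: poisson(2) conj(2) \<iota>_eq[OF \<iota>])
    then show ?L
      using conj_form_minus_from_generators[OF b] by blast
  qed
  show ?thesis
    unfolding z_def[symmetric] star_iff hermitian_form_iff[OF b, symmetric] poisson_iff by blast
qed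

end
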